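(* Let $H$ be a semisimple Hopf algebra over an algebraically closed field $k$ of characteristic $0$. For $a,b\in H$ put $\{a,b\}=\sum a_1b_1S(a_2)S(b_2)$, and let $\mathrm{Com}=\mathrm{span}_k\{\{a,b\}\mid a,b\in H\}$. Then the commutator subalgebra $H'$ of $H$ is the algebra generated by $\mathrm{Com}$. Thus $H$ is commutative if and only if $\mathrm{Com}=k$.
   Context: $k$ is identified with $k\cdot1_H\subset H$. $H$ is finite dimensional with comultiplication $\Delta(h)=\sum h_1\otimes h_2$ (Sweedler notation), counit $\varepsilon$ and antipode $S$. A subspace $N\subseteq H$ is a left coideal if $\Delta(N)\subseteq H\otimes N$; a subalgebra $N$ is normal if $\sum h_1xS(h_2)\in N$ for all $h\in H$, $x\in N$; $N^+=N\cap\ker\varepsilon$. The commutator subalgebra $H'$ of $H$ is the normal left coideal subalgebra of $H$ for which $H/(HH'^+)$ is commutative and which is minimal with respect to this property; equivalently $H'=\{h\in H\mid \sigma\rightharpoonup h=h\ \text{for all }\sigma\in G(H^* )\}$, where $G(H^* )$ is the group of group-like elements of $H^*$ (algebra maps $H\to k$) and $\sigma\rightharpoonup h=\sum\langle\sigma,h_2\rangle h_1$. *)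

theory Defs
  imports
    "HOL-Computational_Algebra.Polynomial"
    "HOL-Library.Function_Algebras"
begin

section \<open>Tensor products\<close>

definition bilinear_map ::
    "('k::field \<Rightarrow> 'a::ab_group_add \<Rightarrow> 'a) \<Rightarrow> ('k \<Rightarrow> 'b::ab_group_add \<Rightarrow> 'b) \<Rightarrow>
     ('k \<Rightarrow> 'c::ab_group_add \<Rightarrow> 'c) \<Rightarrow> ('a \<Rightarrow> 'b \<Rightarrow> 'c) \<Rightarrow> bool" where
  "bilinear_map s1 s2 s3 f \<longleftrightarrow>
     (\<forall>x. Vector_Spaces.linear s2 s3 (f x)) \<and> (\<forall>y. Vector_Spaces.linear s1 s3 (\<lambda>x. f x y))"

text \<open>
  For a vector space \<open>V\<close> over \<open>k\<close>, the space \<open>V \<otimes> V\<close> is realised inside the dual of the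
  space of bilinear forms: \<open>x \<otimes> y\<close> is evaluation of bilinear forms at \<open>(x, y)\<close>. Likewise
  \<open>V \<otimes> V \<otimes> V\<close> is realised inside the dual of the space of trilinear forms. The value \<open>0\<close>
  on functions that are not multilinear is a convention that makes these maps total.
  Addition of tensors is pointwise addition of functions.
\<close>

locale tensor_square = vector_space scale
  for scale :: "'a::field \<Rightarrow> 'b::ab_group_add \<Rightarrow> 'b"
begin

definition tensor :: "'b \<Rightarrow> 'b \<Rightarrow> ('b \<Rightarrow> 'b \<Rightarrow> 'a) \<Rightarrow> 'a" (infix \<open>\<otimes>\<close> 70) where
  "x \<otimes> y = (\<lambda>\<beta>. if bilinear_map scale scale (*) \<beta> then \<beta> x y else 0)"

definition trilinear_form :: "('b \<Rightarrow> 'b \<Rightarrow> 'b \<Rightarrow> 'a) \<Rightarrow> bool" where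
  "trilinear_form \<gamma> \<longleftrightarrow>
     (\<forall>y z. Vector_Spaces.linear scale (*) (\<lambda>x. \<gamma> x y z)) \<and>
     (\<forall>x z. Vector_Spaces.linear scale (*) (\<lambda>y. \<gamma> x y z)) \<and>
     (\<forall>x y. Vector_Spaces.linear scale (*) (\<lambda>z. \<gamma> x y z))"

definition tensor3 :: "'b \<Rightarrow> 'b \<Rightarrow> 'b \<Rightarrow> ('b \<Rightarrow> 'b \<Rightarrow> 'b \<Rightarrow> 'a) \<Rightarrow> 'a" where
  "tensor3 x y z = (\<lambda>\<gamma>. if trilinear_form \<gamma> then \<gamma> x y z else 0)"

definition scale_tensor :: "'a \<Rightarrow> (('b \<Rightarrow> 'b \<Rightarrow> 'a) \<Rightarrow> 'a) \<Rightarrow> (('b \<Rightarrow> 'b \<Rightarrow> 'a) \<Rightarrow> 'a)" where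
  "scale_tensor c t = (\<lambda>\<beta>. c * t \<beta>)"

text \<open>
  For subspaces \<open>A\<close> and \<open>B\<close>, the set \<open>tensor_space A B\<close> is the subspace \<open>A \<otimes> B\<close> of
  \<open>V \<otimes> V\<close>; scalar multiples are absorbed into the factors.
\<close>

definition tensor_space :: "'b set \<Rightarrow> 'b set \<Rightarrow> (('b \<Rightarrow> 'b \<Rightarrow> 'a) \<Rightarrow> 'a) set" where
  "tensor_space A B = {\<Sum>(x, y)\<leftarrow>xs. x \<otimes> y | xs. set xs \<subseteq> A \<times> B}"

text \<open>
  The linear map on \<open>V \<otimes> V\<close> induced by a bilinear map \<open>f\<close>. The choice of the
  representation of \<open>t\<close> is irrelevant, see \<open>tensor_lift_sum\<close> below.
\<close>

definition tensor_lift :: "('b \<Rightarrow> 'b \<Rightarrow> 'c::ab_group_add) \<Rightarrow> (('b \<Rightarrow> 'b \<Rightarrow> 'a) \<Rightarrow> 'a) \<Rightarrow> 'c" where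
  "tensor_lift f t =
     (\<Sum>(x, y) \<leftarrow> (SOME xs. t = (\<Sum>(x, y)\<leftarrow>xs. x \<otimes> y)). f x y)"

lemma tensor_sum_apply:
  assumes "bilinear_map scale scale (*) \<beta>"
  shows "(\<Sum>(x, y)\<leftarrow>xs. x \<otimes> y) \<beta> = (\<Sum>(x, y)\<leftarrow>xs. \<beta> x y)"
  using assms by (induction xs) (auto simp: tensor_def)

lemma linear_sum_list_pairs:
  assumes "Vector_Spaces.linear s1 s2 \<phi>"
  shows "\<phi> (\<Sum>(x, y)\<leftarrow>xs. f x y) = (\<Sum>(x, y)\<leftarrow>xs. \<phi> (f x y))"
proof -
  interpret Vector_Spaces.linear s1 s2 \<phi> by fact
  show ?thesis by (induction xs) (auto simp: add)
qed

lemma tensor_lift_sum: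
  assumes f: "bilinear_map scale scale s f"
  shows "tensor_lift f (\<Sum>(x, y)\<leftarrow>xs. x \<otimes> y) = (\<Sum>(x, y)\<leftarrow>xs. f x y)"
proof (rule ccontr)
  define ys where "ys = (SOME ys. (\<Sum>(x, y)\<leftarrow>xs. x \<otimes> y) = (\<Sum>(x, y)\<leftarrow>ys. x \<otimes> y))"
  have ys: "(\<Sum>(x, y)\<leftarrow>xs. x \<otimes> y) = (\<Sum>(x, y)\<leftarrow>ys. x \<otimes> y)"
    unfolding ys_def by (rule someI[of _ xs]) simp
  define d where "d = (\<Sum>(x, y)\<leftarrow>ys. f x y) - (\<Sum>(x, y)\<leftarrow>xs. f x y)"
  assume "\<not> ?thesis"
  then have "d \<noteq> 0"
    unfolding tensor_lift_def d_def ys_def by simp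
  have lin: "Vector_Spaces.linear scale s (f x)" "Vector_Spaces.linear scale s (\<lambda>x. f x y)" for x y
    using f by (auto simp: bilinear_map_def)
  interpret S: vector_space s
    using lin(1) by (simp add: Vector_Spaces.linear_def)
  interpret K: vector_space "(*) :: 'a \<Rightarrow> 'a \<Rightarrow> 'a"
    by unfold_locales (auto simp: algebra_simps)
  interpret SK: vector_space_pair s "(*) :: 'a \<Rightarrow> 'a \<Rightarrow> 'a" ..
  have "S.independent {d}" using \<open>d \<noteq> 0\<close> by simp
  from SK.linear_independent_extend[OF this, of "\<lambda>_. 1"]
  obtain \<phi> where \<phi>: "Vector_Spaces.linear s (*) \<phi>" "\<phi> d = 1" by auto
  have \<beta>: "bilinear_map scale scale (*) (\<lambda>x y. \<phi> (f x y))"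
    unfolding bilinear_map_def
    using Vector_Spaces.linear_compose[OF lin(1) \<phi>(1)] Vector_Spaces.linear_compose[OF lin(2) \<phi>(1)]
    by (auto simp: o_def)
  have "\<phi> (\<Sum>(x, y)\<leftarrow>xs. f x y) = \<phi> (\<Sum>(x, y)\<leftarrow>ys. f x y)"
    unfolding linear_sum_list_pairs[OF \<phi>(1)] tensor_sum_apply[OF \<beta>, symmetric] ys ..
  moreover interpret \<phi>: Vector_Spaces.linear s "(*)" \<phi> by fact
  have "\<phi> d = \<phi> (\<Sum>(x, y)\<leftarrow>ys. f x y) - \<phi> (\<Sum>(x, y)\<leftarrow>xs. f x y)"
    unfolding d_def by (rule \<phi>.diff)
  ultimately show False using \<phi>(2) by simp
qed

end


section \<open>Hopf algebras\<close>

text \<open>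
  A ring is semisimple if it is semisimple as a left module over itself, i.e. every left
  ideal is a direct summand.
\<close>

definition left_ideal :: "'a::ring_1 set \<Rightarrow> bool" where
  "left_ideal I \<longleftrightarrow> 0 \<in> I \<and> (\<forall>x\<in>I. \<forall>y\<in>I. x + y \<in> I) \<and> (\<forall>r. \<forall>x\<in>I. r * x \<in> I)"

definition semisimple_ring :: "'a::ring_1 itself \<Rightarrow> bool" where
  "semisimple_ring _ \<longleftrightarrow>
     (\<forall>I::'a set. left_ideal I \<longrightarrow>
        (\<exists>J. left_ideal J \<and> I \<inter> J = {0} \<and> (\<forall>r. \<exists>x\<in>I. \<exists>y\<in>J. r = x + y)))"

locale hopf_algebra = tensor_square scale
  for scale :: "'k::field \<Rightarrow> 'h::ring_1 \<Rightarrow> 'h" (infixr \<open>*s\<close> 75) +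
  fixes comult :: "'h \<Rightarrow> ('h \<Rightarrow> 'h \<Rightarrow> 'k) \<Rightarrow> 'k" (\<open>\<Delta>\<close>)
    and counit :: "'h \<Rightarrow> 'k" (\<open>\<epsilon>\<close>)
    and antipode :: "'h \<Rightarrow> 'h" (\<open>S\<close>)
  assumes scale_mult_left: "(c *s x) * y = c *s (x * y)"
    and scale_mult_right: "x * (c *s y) = c *s (x * y)"
    and comult_in_tensor_space: "\<Delta> h \<in> tensor_space UNIV UNIV"
    and comult_linear: "Vector_Spaces.linear scale scale_tensor \<Delta>"
    and comult_coassoc:
      "tensor_lift (\<lambda>u z. tensor_lift (\<lambda>x y. tensor3 x y z) (\<Delta> u)) (\<Delta> h) =
       tensor_lift (\<lambda>x u. tensor_lift (\<lambda>y z. tensor3 x y z) (\<Delta> u)) (\<Delta> h)"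
    and comult_mult:
      "\<Delta> (a * b) =
       tensor_lift (\<lambda>a1 a2. tensor_lift (\<lambda>b1 b2. (a1 * b1) \<otimes> (a2 * b2)) (\<Delta> b)) (\<Delta> a)"
    and comult_one: "\<Delta> 1 = 1 \<otimes> 1"
    and counit_linear: "Vector_Spaces.linear scale (*) \<epsilon>"
    and counit_mult: "\<epsilon> (a * b) = \<epsilon> a * \<epsilon> b"
    and counit_one: "\<epsilon> 1 = 1"
    and counit_left: "tensor_lift (\<lambda>h1 h2. \<epsilon> h1 *s h2) (\<Delta> h) = h"
    and counit_right: "tensor_lift (\<lambda>h1 h2. \<epsilon> h2 *s h1) (\<Delta> h) = h"
    and antipode_linear: "Vector_Spaces.linear scale scale S"
    and antipode_left: "tensor_lift (\<lambda>h1 h2. S h1 * h2) (\<Delta> h) = \<epsilon> h *s 1"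
    and antipode_right: "tensor_lift (\<lambda>h1 h2. h1 * S h2) (\<Delta> h) = \<epsilon> h *s 1"
begin

text \<open>Sweedler notation: for bilinear \<open>f\<close>, \<open>sweedler h f\<close> is the sum of \<open>f h\<^sub>1 h\<^sub>2\<close>.\<close>

definition sweedler :: "'h \<Rightarrow> ('h \<Rightarrow> 'h \<Rightarrow> 'c::ab_group_add) \<Rightarrow> 'c" where
  "sweedler h f = tensor_lift f (\<Delta> h)"

definition subalgebra :: "'h set \<Rightarrow> bool" where
  "subalgebra N \<longleftrightarrow> subspace N \<and> 1 \<in> N \<and> (\<forall>x\<in>N. \<forall>y\<in>N. x * y \<in> N)"

definition left_coideal :: "'h set \<Rightarrow> bool" where
  "left_coideal N \<longleftrightarrow> subspace N \<and> (\<forall>x\<in>N. \<Delta> x \<in> tensor_space UNIV N)"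

definition normal :: "'h set \<Rightarrow> bool" where
  "normal N \<longleftrightarrow> (\<forall>h. \<forall>x\<in>N. sweedler h (\<lambda>h1 h2. h1 * x * S h2) \<in> N)"

definition augmentation :: "'h set \<Rightarrow> 'h set" where
  "augmentation N = N \<inter> {x. \<epsilon> x = 0}"

definition left_ideal_gen :: "'h set \<Rightarrow> 'h set" where
  "left_ideal_gen A = span {h * x | h x. x \<in> A}"

text \<open>
  For a normal left coideal subalgebra \<open>N\<close> the left ideal \<open>H N\<^sup>+\<close> is two-sided, so that
  \<open>H / H N\<^sup>+\<close> is an algebra. Its commutativity says that any two elements of \<open>H\<close>
  commute modulo \<open>H N\<^sup>+\<close>.
\<close>

definition commutative_quotient :: "'h set \<Rightarrow> bool" where
  "commutative_quotient N \<longleftrightarrow>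
     (\<forall>a b. a * b - b * a \<in> left_ideal_gen (augmentation N))"

definition normal_left_coideal_subalgebra :: "'h set \<Rightarrow> bool" where
  "normal_left_coideal_subalgebra N \<longleftrightarrow> subalgebra N \<and> left_coideal N \<and> normal N"

definition is_commutator_subalgebra :: "'h set \<Rightarrow> bool" where
  "is_commutator_subalgebra N \<longleftrightarrow>
     normal_left_coideal_subalgebra N \<and> commutative_quotient N \<and>
     (\<forall>M. normal_left_coideal_subalgebra M \<and> commutative_quotient M \<and> M \<subseteq> N \<longrightarrow> M = N)"

definition hopf_commutator :: "'h \<Rightarrow> 'h \<Rightarrow> 'h" where
  "hopf_commutator a b =
     sweedler a (\<lambda>a1 a2. sweedler b (\<lambda>b1 b2. a1 * b1 * S a2 * S b2))"

definition Com :: "'h set" where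
  "Com = span {hopf_commutator a b | a b. True}"

end

end

theory Submission
  imports Defs
begin

text \<open>
  Write \<open>ad h x = h1 x S(h2)\<close>, let \<open>D\<close> be the algebra generated by the commutators and let
  \<open>M\<close> be any normal left coideal subalgebra with commutative quotient. It is enough to show that
  \<open>D\<close> is itself such a subalgebra and that \<open>D \<subseteq> M\<close> for every \<open>M\<close>.

  That \<open>D\<close> qualifies comes from three identities, which read like identities between words in a
  group when every Sweedler component is treated as a group element:
  \<open>\<Delta>{a,b} = a1 b1 S(a3) S(b3) \<otimes> {a2,b2}\<close>, \<open>ad h {a,b} = {h1 a, b1} {b2, h2}\<close> and
  \<open>a b = {a1,b1} b2 a2\<close>. The last one puts \<open>a b - b a\<close> into \<open>D\<^sup>+ H\<close>, and \<open>D\<^sup>+ H \<subseteq> H D\<^sup>+\<close>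
  because \<open>x S(h) = S(h1) (ad h2 x)\<close> and the antipode is surjective. It also gives the criterion
  for commutativity of \<open>H\<close>.

  For \<open>D \<subseteq> M\<close>, the formula for \<open>\<Delta>{a,b}\<close> shows that commutators are coinvariant for
  \<open>H \<rightarrow> H / H M\<^sup>+\<close>, so one has to show that coinvariant elements lie in \<open>M\<close>. Both steps of this
  use one fact, \<open>ad_stable_contains_unit\<close>: if \<open>Y\<close> is a subspace of \<open>H\<close> closed under products and
  under \<open>ad\<close>, and if a central idempotent \<open>e\<close> generates the ideal \<open>H Y\<close>, then \<open>e \<in> Y\<close>. For
  \<open>Y = M\<^sup>+\<close> it yields an idempotent \<open>z = 1 - e \<in> M\<close> with \<open>m z = \<epsilon>(m) z\<close> for \<open>m \<in> M\<close>. The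
  space \<open>C\<close> of all \<open>f(z1) z2\<close>, for linear forms \<open>f\<close>, is contained in \<open>M\<close>, it is mapped into itself
  by left multiplication with coinvariant elements, and \<open>H C = H\<close>. A second application, to
  \<open>Y = C\<close>, gives \<open>1 \<in> C\<close>; hence a coinvariant \<open>h = h 1\<close> lies in \<open>C \<subseteq> M\<close>.

  The proof of \<open>ad_stable_contains_unit\<close> is a growth argument. Put \<open>A = k 1 + Y\<close>. The least
  \<open>ad\<close>-stable left ideal of \<open>A\<close> that is not contained in \<open>Y\<close> is generated by a central idempotent
  \<open>p \<in> 1 + Y\<close>, and the claim amounts to \<open>N = 0\<close> for the ideal \<open>N = e p H\<close>, for which
  \<open>N = Y N\<close>. Let \<open>n = dim H\<close> and suppose that \<open>w\<close> tuples generate \<open>N\<^sup>s\<close> as an \<open>A\<close>-module. They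
  give \<open>n w\<close> generators of \<open>Hom(H, N\<^sup>s)\<close>, which consists of tuples of length \<open>n s\<close>. The \<open>w\<close>
  generators built from the counit are invariant under \<open>H\<close>; the elements of \<open>A\<close> that send one of them into the span of the others
  form an \<open>ad\<close>-stable left ideal, not contained in \<open>Y\<close> because \<open>N = Y N\<close>, hence containing \<open>p\<close>,
  which acts as the identity. So these \<open>w\<close> generators are redundant, and \<open>N\<close> to the power
  \<open>n\<^sup>t\<close> is generated by a constant times \<open>(n - 1)\<^sup>t\<close> tuples, for every \<open>t\<close>. Counting dimensions
  forces \<open>N = 0\<close>.
\<close>

section \<open>Sweedler calculus\<close>

context vector_space
begin

lemma eq_if_functionals_eq:
  assumes "\<And>\<phi>. Vector_Spaces.linear scale (*) \<phi> \<Longrightarrow> \<phi> x = \<phi> y"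
  shows "x = y"
proof (rule ccontr)
  assume "x \<noteq> y"
  interpret K: vector_space "(*) :: 'a \<Rightarrow> 'a \<Rightarrow> 'a"
    by unfold_locales (auto simp: algebra_simps)
  interpret P: vector_space_pair scale "(*) :: 'a \<Rightarrow> 'a \<Rightarrow> 'a" ..
  have "independent {x - y}"
    using \<open>x \<noteq> y\<close> by simp
  from P.linear_independent_extend[OF this, of "\<lambda>_. 1"]
  obtain \<phi> where \<phi>: "Vector_Spaces.linear scale (*) \<phi>" "\<phi> (x - y) = 1"
    by auto
  interpret \<phi>: Vector_Spaces.linear scale "(*)" \<phi> by fact
  show False
    using \<phi>(2) assms[OF \<phi>(1)] by (simp add: \<phi>.diff)
qed

end

text \<open>Closure rules that decide linearity of explicit Sweedler expressions.\<close>

named_theorems lin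

context hopf_algebra
begin

abbreviation lin_to :: "('k \<Rightarrow> 'c::ab_group_add \<Rightarrow> 'c) \<Rightarrow> ('h \<Rightarrow> 'c) \<Rightarrow> bool" where
  "lin_to s f \<equiv> Vector_Spaces.linear scale s f"

abbreviation lin :: "('h \<Rightarrow> 'h) \<Rightarrow> bool" where
  "lin f \<equiv> Vector_Spaces.linear scale scale f"

abbreviation form :: "('h \<Rightarrow> 'k) \<Rightarrow> bool" where
  "form f \<equiv> Vector_Spaces.linear scale (*) f"

abbreviation bilin :: "('k \<Rightarrow> 'c::ab_group_add \<Rightarrow> 'c) \<Rightarrow> ('h \<Rightarrow> 'h \<Rightarrow> 'c) \<Rightarrow> bool" where
  "bilin s f \<equiv> bilinear_map scale scale s f"

lemma lin_toI:
  assumes "vector_space s" "\<And>x y. f (x + y) = f x + f y" "\<And>c x. f (c *s x) = s c (f x)"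
  shows "lin_to s f"
  using assms vector_space_axioms
  by (simp add: Vector_Spaces.linear_def module_hom_def module_hom_axioms_def
      vector_space_def module_def)

lemma lin_toD:
  assumes "lin_to s f"
  shows "vector_space s" "f (x + y) = f x + f y" "f (c *s x) = s c (f x)" "f 0 = 0"
    "f (x - y) = f x - f y" "f (sum g B) = (\<Sum>b\<in>B. f (g b))" "f (- x) = - f x"
proof -
  interpret f: Vector_Spaces.linear scale s f by fact
  show "vector_space s" by unfold_locales
  show "f (x + y) = f x + f y" "f (c *s x) = s c (f x)" "f 0 = 0"
    "f (x - y) = f x - f y" "f (sum g B) = (\<Sum>b\<in>B. f (g b))" "f (- x) = - f x"
    by (simp_all add: f.add f.scale f.diff f.sum f.neg)
qed

lemma vector_space_field: "vector_space ((*) :: 'k \<Rightarrow> 'k \<Rightarrow> 'k)"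
  by unfold_locales (auto simp: algebra_simps)

lemma bilinI [lin]:
  assumes "\<And>x. lin_to s (F x)" "\<And>y. lin_to s (\<lambda>x. F x y)"
  shows "bilin s F"
  using assms by (simp add: bilinear_map_def)

lemma bilinD:
  assumes "bilin s F"
  shows "lin_to s (F x)" "lin_to s (\<lambda>x. F x y)"
  using assms by (simp_all add: bilinear_map_def)

lemma lin_comp:
  assumes "lin_to s f" "lin g"
  shows "lin_to s (\<lambda>x. f (g x))"
  using Vector_Spaces.linear_compose[OF assms(2,1)] by (simp add: o_def)

lemma lin_after:
  assumes "lin_to s g" "Vector_Spaces.linear s t f"
  shows "lin_to t (\<lambda>x. f (g x))"
  using Vector_Spaces.linear_compose[OF assms(1,2)] by (simp add: o_def)

lemma lin_id [lin]: "lin (\<lambda>x. x)"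
  by (rule lin_toI) (auto intro: vector_space_axioms)

lemma lin_mult_left [lin]: "lin f \<Longrightarrow> lin (\<lambda>x. c * f x)"
  by (rule lin_toI) (auto intro: vector_space_axioms simp: lin_toD distrib_left scale_mult_right)

lemma lin_mult_right [lin]: "lin f \<Longrightarrow> lin (\<lambda>x. f x * c)"
  by (rule lin_toI) (auto intro: vector_space_axioms simp: lin_toD distrib_right scale_mult_left)

lemma lin_antipode [lin]: "lin f \<Longrightarrow> lin (\<lambda>x. S (f x))"
  by (rule lin_comp[OF antipode_linear])

lemma lin_scale [lin]: "lin f \<Longrightarrow> lin (\<lambda>x. c *s f x)"
  by (rule lin_toI) (auto intro: vector_space_axioms simp: lin_toD scale_right_distrib mult.commute)

lemma lin_scale_form [lin]: "form g \<Longrightarrow> lin (\<lambda>x. g x *s c)"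
  by (rule lin_toI) (auto intro: vector_space_axioms simp: lin_toD scale_left_distrib)

lemma form_counit [lin]: "lin f \<Longrightarrow> form (\<lambda>x. \<epsilon> (f x))"
  by (rule lin_comp[OF counit_linear])

lemma form_mult_left [lin]: "form g \<Longrightarrow> form (\<lambda>x. c * g x)"
  by (rule lin_toI) (auto intro: vector_space_field simp: lin_toD algebra_simps)

lemma form_mult_right [lin]: "form g \<Longrightarrow> form (\<lambda>x. g x * c)"
  by (rule lin_toI) (auto intro: vector_space_field simp: lin_toD algebra_simps)

text \<open>
  A Sweedler sum runs over a list of pairs that depends on the element only. This makes it
  additive in the summand without any linearity hypothesis.
\<close>

definition sw_list :: "'h \<Rightarrow> ('h \<times> 'h) list" where
  "sw_list h = (SOME xs. \<Delta> h = (\<Sum>(x, y)\<leftarrow>xs. x \<otimes> y))"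

lemma sweedler_list: "sweedler h F = (\<Sum>(x, y)\<leftarrow>sw_list h. F x y)"
  unfolding sweedler_def tensor_lift_def sw_list_def ..

lemma comult_list: "\<Delta> h = (\<Sum>(x, y)\<leftarrow>sw_list h. x \<otimes> y)"
proof -
  have "\<exists>xs. \<Delta> h = (\<Sum>(x, y)\<leftarrow>xs. x \<otimes> y)"
    using comult_in_tensor_space[of h] by (auto simp: tensor_space_def)
  then show ?thesis
    unfolding sw_list_def by (rule someI_ex)
qed

lemma sweedler_form: "bilin (*) \<beta> \<Longrightarrow> sweedler h \<beta> = \<Delta> h \<beta>"
  by (subst (1) comult_list) (simp add: tensor_sum_apply sweedler_list)

lemma sum_list_pairs_apply: "(\<Sum>(x, y)\<leftarrow>xs. F x y) \<gamma> = (\<Sum>(x, y)\<leftarrow>xs. F x y \<gamma>)"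
  by (induction xs) auto

lemma tensor_lift_apply: "tensor_lift F t \<gamma> = tensor_lift (\<lambda>x y. F x y \<gamma>) t"
  unfolding tensor_lift_def by (rule sum_list_pairs_apply)

lemma sweedler_apply: "sweedler h F \<gamma> = sweedler h (\<lambda>x y. F x y \<gamma>)"
  unfolding sweedler_def by (rule tensor_lift_apply)

lemma sweedler_linear:
  assumes "Vector_Spaces.linear s t \<phi>"
  shows "\<phi> (sweedler h F) = sweedler h (\<lambda>x y. \<phi> (F x y))"
  unfolding sweedler_list by (rule linear_sum_list_pairs[OF assms])

lemma lin_sweedler_summand [lin]:
  assumes "\<And>u v. lin_to s (\<lambda>x. F x u v)"
  shows "lin_to s (\<lambda>x. sweedler h (\<lambda>u v. F x u v))"
proof -
  have s: "vector_space s" by (rule lin_toD(1)[OF assms])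
  then interpret s: vector_space s .
  have "lin_to s (\<lambda>x. \<Sum>(u, v)\<leftarrow>xs. F x u v)" for xs
  proof (induction xs)
    case Nil
    show ?case by (rule lin_toI) (auto intro: s)
  next
    case (Cons a xs)
    obtain p q where a: "a = (p, q)" by fastforce
    show ?case
      unfolding a using lin_toD(2,3)[OF Cons.IH] lin_toD(2,3)[OF assms]
      by (intro lin_toI s) (simp_all add: s.scale_right_distrib algebra_simps)
  qed
  then show ?thesis by (simp add: sweedler_list)
qed

text \<open>
  Functionals separate points, so that identities between Sweedler sums with values in an arbitrary
  vector space reduce to bilinear or trilinear forms, on which tensors are defined by evaluation.
\<close>

lemma lin_sweedler [lin]:
  assumes F: "bilin s F" and g: "lin g"
  shows "lin_to s (\<lambda>x. sweedler (g x) F)"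
proof -
  have s: "vector_space s" using bilinD(1)[OF F] by (rule lin_toD)
  then interpret s: vector_space s .
  have *: "\<phi> (sweedler h F) = \<Delta> h (\<lambda>x y. \<phi> (F x y))"
    if "Vector_Spaces.linear s (*) \<phi>" for \<phi> h
    by (subst sweedler_linear[OF that], rule sweedler_form)
      (intro bilinI lin_after[OF _ that] bilinD[OF F])
  have "lin_to s (\<lambda>x. sweedler x F)"
  proof (rule lin_toI[OF s])
    show "sweedler (x + y) F = sweedler x F + sweedler y F" for x y
    proof (rule s.eq_if_functionals_eq)
      fix \<phi> assume \<phi>: "Vector_Spaces.linear s (*) \<phi>"
      interpret \<phi>: Vector_Spaces.linear s "(*)" \<phi> by fact
      show "\<phi> (sweedler (x + y) F) = \<phi> (sweedler x F + sweedler y F)"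
        by (simp add: \<phi>.add *[OF \<phi>] lin_toD(2)[OF comult_linear])
    qed
    show "sweedler (c *s x) F = s c (sweedler x F)" for c x
    proof (rule s.eq_if_functionals_eq)
      fix \<phi> assume \<phi>: "Vector_Spaces.linear s (*) \<phi>"
      interpret \<phi>: Vector_Spaces.linear s "(*)" \<phi> by fact
      show "\<phi> (sweedler (c *s x) F) = \<phi> (s c (sweedler x F))"
        by (simp add: \<phi>.scale *[OF \<phi>] lin_toD(3)[OF comult_linear] scale_tensor_def)
    qed
  qed
  then show ?thesis using g by (rule lin_comp)
qed

lemma sweedler_coassoc:
  assumes F: "\<And>y z. lin_to s (\<lambda>x. F x y z)" "\<And>x z. lin_to s (\<lambda>y. F x y z)"
    "\<And>x y. lin_to s (\<lambda>z. F x y z)"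
  shows "sweedler h (\<lambda>u z. sweedler u (\<lambda>x y. F x y z)) =
    sweedler h (\<lambda>x u. sweedler u (\<lambda>y z. F x y z))"
proof -
  have "vector_space s" by (rule lin_toD(1)[OF F(1)])
  then interpret s: vector_space s .
  show ?thesis
  proof (rule s.eq_if_functionals_eq)
    fix \<phi> assume \<phi>: "Vector_Spaces.linear s (*) \<phi>"
    let ?\<gamma> = "\<lambda>x y z. \<phi> (F x y z)"
    have "trilinear_form ?\<gamma>"
      unfolding trilinear_form_def by (intro allI conjI lin_after[OF _ \<phi>] F)
    then show "\<phi> (sweedler h (\<lambda>u z. sweedler u (\<lambda>x y. F x y z))) =
        \<phi> (sweedler h (\<lambda>x u. sweedler u (\<lambda>y z. F x y z)))"
      using fun_cong[OF comult_coassoc[of h], of ?\<gamma>]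
      by (simp add: sweedler_linear[OF \<phi>] sweedler_apply tensor3_def flip: sweedler_def)
  qed
qed

lemma sweedler_mult:
  assumes F: "bilin s F"
  shows "sweedler (a * b) F =
    sweedler a (\<lambda>a1 a2. sweedler b (\<lambda>b1 b2. F (a1 * b1) (a2 * b2)))"
proof -
  have "vector_space s" using bilinD(1)[OF F] by (rule lin_toD)
  then interpret s: vector_space s .
  show ?thesis
  proof (rule s.eq_if_functionals_eq)
    fix \<phi> assume \<phi>: "Vector_Spaces.linear s (*) \<phi>"
    let ?\<beta> = "\<lambda>x y. \<phi> (F x y)"
    have \<beta>: "bilin (*) ?\<beta>"
      by (intro bilinI lin_after[OF _ \<phi>] bilinD[OF F])
    have "\<phi> (sweedler (a * b) F) = \<Delta> (a * b) ?\<beta>"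
      using \<beta> by (simp add: sweedler_linear[OF \<phi>] sweedler_form)
    also have "\<dots> = \<phi> (sweedler a (\<lambda>a1 a2. sweedler b (\<lambda>b1 b2. F (a1 * b1) (a2 * b2))))"
      using \<beta> by (simp add: comult_mult sweedler_apply tensor_def sweedler_linear[OF \<phi>] flip: sweedler_def)
    finally show "\<phi> (sweedler (a * b) F) = \<dots>" .
  qed
qed

lemma sweedler_one:
  assumes F: "bilin s F"
  shows "sweedler 1 F = F 1 1"
  using tensor_lift_sum[OF F, of "[(1, 1)]"] by (simp add: sweedler_def comult_one)

lemma sweedler_counit_left:
  assumes f: "lin_to s f"
  shows "sweedler h (\<lambda>x y. s (\<epsilon> x) (f y)) = f h"
proof -
  have "f h = f (sweedler h (\<lambda>x y. \<epsilon> x *s y))"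
    by (simp add: sweedler_def counit_left)
  then show ?thesis
    by (simp add: sweedler_linear[OF f] lin_toD(3)[OF f])
qed

lemma sweedler_counit_right:
  assumes f: "lin_to s f"
  shows "sweedler h (\<lambda>x y. s (\<epsilon> y) (f x)) = f h"
proof -
  have "f h = f (sweedler h (\<lambda>x y. \<epsilon> y *s x))"
    by (simp add: sweedler_def counit_right)
  then show ?thesis
    by (simp add: sweedler_linear[OF f] lin_toD(3)[OF f])
qed

lemma sweedler_antipode_left:
  assumes f: "lin_to s f"
  shows "sweedler h (\<lambda>x y. f (S x * y)) = s (\<epsilon> h) (f 1)"
proof -
  have "f (sweedler h (\<lambda>x y. S x * y)) = s (\<epsilon> h) (f 1)"
    by (simp add: sweedler_def antipode_left lin_toD(3)[OF f])
  then show ?thesis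
    by (simp add: sweedler_linear[OF f])
qed

lemma sweedler_antipode_right:
  assumes f: "lin_to s f"
  shows "sweedler h (\<lambda>x y. f (x * S y)) = s (\<epsilon> h) (f 1)"
proof -
  have "f (sweedler h (\<lambda>x y. x * S y)) = s (\<epsilon> h) (f 1)"
    by (simp add: sweedler_def antipode_right lin_toD(3)[OF f])
  then show ?thesis
    by (simp add: sweedler_linear[OF f])
qed

lemma sweedler_swap:
  fixes F :: "'h \<Rightarrow> 'h \<Rightarrow> 'h \<Rightarrow> 'h \<Rightarrow> 'c::ab_group_add"
  shows "sweedler a (\<lambda>a1 a2. sweedler b (\<lambda>b1 b2. F a1 a2 b1 b2)) =
   sweedler b (\<lambda>b1 b2. sweedler a (\<lambda>a1 a2. F a1 a2 b1 b2))"
proof -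
  have "(\<Sum>(x, y)\<leftarrow>xs. \<Sum>(u, v)\<leftarrow>ys. F x y u v) = (\<Sum>(u, v)\<leftarrow>ys. \<Sum>(x, y)\<leftarrow>xs. F x y u v)" for xs ys
  proof (induction xs)
    case Nil
    show ?case by (induction ys) auto
  next
    case (Cons p xs)
    have "(\<Sum>(u, v)\<leftarrow>ys. G u v + H u v) = (\<Sum>(u, v)\<leftarrow>ys. G u v) + (\<Sum>(u, v)\<leftarrow>ys. H u v)"
      for G H :: "'h \<Rightarrow> 'h \<Rightarrow> 'c"
      by (induction ys) (auto simp: algebra_simps)
    then show ?case
      using Cons by (cases p) simp
  qed
  then show ?thesis by (simp add: sweedler_list)
qed

lemma sweedler_mult_left: "(c :: 'h) * sweedler h F = sweedler h (\<lambda>x y. c * F x y)"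
  by (rule sweedler_linear[where s=scale and t=scale and \<phi>="\<lambda>x. c * x"]) (intro lin)

lemma sweedler_mult_right: "sweedler h F * (c :: 'h) = sweedler h (\<lambda>x y. F x y * c)"
  by (rule sweedler_linear[where s=scale and t=scale and \<phi>="\<lambda>x. x * c"]) (intro lin)

lemma sweedler_scale: "c *s sweedler h F = sweedler h (\<lambda>x y. c *s F x y)"
  by (rule sweedler_linear[where s=scale and t=scale and \<phi>="\<lambda>x. c *s x"]) (intro lin)

lemma sweedler_zero: "sweedler h (\<lambda>x y. 0) = 0"
proof -
  have "(\<Sum>(x, y)\<leftarrow>xs. 0) = 0" for xs :: "('h \<times> 'h) list"
    by (induction xs) auto
  then show ?thesis by (simp add: sweedler_list)
qed

lemma sweedler_add:
  "sweedler h (\<lambda>x y. F x y + G x y) = sweedler h F + sweedler h G"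
proof -
  have "(\<Sum>(x, y)\<leftarrow>xs. F x y + G x y) = (\<Sum>(x, y)\<leftarrow>xs. F x y) + (\<Sum>(x, y)\<leftarrow>xs. G x y)" for xs
    by (induction xs) (auto simp: algebra_simps)
  then show ?thesis by (simp add: sweedler_list)
qed

lemma sweedler_sum:
  "sweedler h (\<lambda>x y. \<Sum>b\<in>B. F b x y) = (\<Sum>b\<in>B. sweedler h (F b))"
proof -
  have "(\<Sum>(x, y)\<leftarrow>xs. \<Sum>b\<in>B. F b x y) = (\<Sum>b\<in>B. \<Sum>(x, y)\<leftarrow>xs. F b x y)" for xs
    by (induction xs) (auto simp: sum.distrib)
  then show ?thesis by (simp add: sweedler_list)
qed

lemma sweedler_in_any_subspace:
  assumes "vector_space s" "module.subspace s V" "\<And>x y. F x y \<in> V"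
  shows "sweedler h F \<in> V"
proof -
  interpret W: vector_space s by fact
  have "(\<Sum>(x, y)\<leftarrow>xs. F x y) \<in> V" for xs
    using assms by (induction xs) (auto simp: W.subspace_0 W.subspace_add)
  then show ?thesis by (simp add: sweedler_list)
qed

lemma sweedler_in_subspace:
  "subspace N \<Longrightarrow> (\<And>x y. F x y \<in> N) \<Longrightarrow> sweedler h F \<in> N"
  by (rule sweedler_in_any_subspace[OF vector_space_axioms])

end

context hopf_algebra begin

text \<open>Adjacent Sweedler components \<open>S(h1) h2\<close> or \<open>h1 S(h2)\<close> cancel inside any multilinear expression.\<close>

lemma sweedler_cancel:
  assumes G: "bilin s G"
  shows "sweedler h (\<lambda>h1 h2. sweedler h1 (\<lambda>u v. G u (S v * h2))) = G h 1"
    and "sweedler h (\<lambda>h1 h2. sweedler h1 (\<lambda>u v. G u (v * S h2))) = G h 1"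
    and "sweedler h (\<lambda>h1 h2. sweedler h2 (\<lambda>u v. G (S h1 * u) v)) = G 1 h"
proof -
  note l = lin lin_comp[OF bilinD(1)[OF G]] lin_comp[OF bilinD(2)[OF G]]
  have "sweedler h (\<lambda>h1 h2. sweedler h1 (\<lambda>u v. G u (S v * h2))) =
      sweedler h (\<lambda>u w. sweedler w (\<lambda>v h2. G u (S v * h2)))"
    by (rule sweedler_coassoc[where s = s]; intro l)
  also have "\<dots> = sweedler h (\<lambda>u w. s (\<epsilon> w) (G u 1))"
    by (subst sweedler_antipode_left[OF bilinD(1)[OF G]]) simp
  also have "\<dots> = G h 1"
    by (rule sweedler_counit_right[OF bilinD(2)[OF G]])
  finally show "sweedler h (\<lambda>h1 h2. sweedler h1 (\<lambda>u v. G u (S v * h2))) = G h 1" .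
  have "sweedler h (\<lambda>h1 h2. sweedler h1 (\<lambda>u v. G u (v * S h2))) =
      sweedler h (\<lambda>u w. sweedler w (\<lambda>v h2. G u (v * S h2)))"
    by (rule sweedler_coassoc[where s = s]; intro l)
  also have "\<dots> = sweedler h (\<lambda>u w. s (\<epsilon> w) (G u 1))"
    by (subst sweedler_antipode_right[OF bilinD(1)[OF G]]) simp
  also have "\<dots> = G h 1"
    by (rule sweedler_counit_right[OF bilinD(2)[OF G]])
  finally show "sweedler h (\<lambda>h1 h2. sweedler h1 (\<lambda>u v. G u (v * S h2))) = G h 1" .
  have "sweedler h (\<lambda>h1 h2. sweedler h2 (\<lambda>u v. G (S h1 * u) v)) =
      sweedler h (\<lambda>w v. sweedler w (\<lambda>h1 u. G (S h1 * u) v))"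
    by (rule sweedler_coassoc[where s = s, symmetric]; intro l)
  also have "\<dots> = sweedler h (\<lambda>w v. s (\<epsilon> w) (G 1 v))"
    by (subst sweedler_antipode_left[where s = s and f = "\<lambda>x. G x _", OF bilinD(2)[OF G]]) simp
  also have "\<dots> = G 1 h"
    by (rule sweedler_counit_left[OF bilinD(1)[OF G]])
  finally show "sweedler h (\<lambda>h1 h2. sweedler h2 (\<lambda>u v. G (S h1 * u) v)) = G 1 h" .
qed

lemma sweedler_four:
  assumes G: "\<And>x y z. lin_to s (\<lambda>w. G w x y z)" "\<And>w y z. lin_to s (\<lambda>x. G w x y z)"
    "\<And>w x z. lin_to s (\<lambda>y. G w x y z)" "\<And>w x y. lin_to s (\<lambda>z. G w x y z)"
  shows "sweedler h (\<lambda>r t. sweedler r (\<lambda>w x. sweedler t (\<lambda>y z. G w x y z))) =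
    sweedler h (\<lambda>w t. sweedler t (\<lambda>u z. sweedler u (\<lambda>x y. G w x y z)))"
proof -
  note l = lin G lin_comp[OF G(1)] lin_comp[OF G(2)] lin_comp[OF G(3)] lin_comp[OF G(4)]
  have "sweedler h (\<lambda>r t. sweedler r (\<lambda>w x. sweedler t (\<lambda>y z. G w x y z))) =
      sweedler h (\<lambda>w t. sweedler t (\<lambda>x t. sweedler t (\<lambda>y z. G w x y z)))"
    by (rule sweedler_coassoc[where s = s]; intro l)
  also have "\<dots> = sweedler h (\<lambda>w t. sweedler t (\<lambda>u z. sweedler u (\<lambda>x y. G w x y z)))"
    by (subst sweedler_coassoc[where s = s]; (intro l)?) (rule refl)
  finally show ?thesis .
qed

lemma sweedler_cancel_middle:
  assumes G: "\<And>y z. lin_to s (\<lambda>x. G x y z)" "\<And>x z. lin_to s (\<lambda>y. G x y z)"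
    "\<And>x y. lin_to s (\<lambda>z. G x y z)"
  shows "sweedler h (\<lambda>r t. sweedler r (\<lambda>u v. sweedler t (\<lambda>p q. G u (S v * p) q))) =
      sweedler h (\<lambda>u q. G u 1 q)"
    and "sweedler h (\<lambda>r t. sweedler r (\<lambda>u v. sweedler t (\<lambda>p q. G u (v * S p) q))) =
      sweedler h (\<lambda>u q. G u 1 q)"
proof -
  note l = lin G lin_comp[OF G(1)] lin_comp[OF G(2)] lin_comp[OF G(3)]
  have "sweedler h (\<lambda>r t. sweedler r (\<lambda>u v. sweedler t (\<lambda>p q. G u (S v * p) q))) =
      sweedler h (\<lambda>u t. sweedler t (\<lambda>w q. sweedler w (\<lambda>v p. G u (S v * p) q)))"
    by (rule sweedler_four[where s = s]; intro l)
  also have "\<dots> = sweedler h (\<lambda>u t. sweedler t (\<lambda>w q. s (\<epsilon> w) (G u 1 q)))"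
    by (subst sweedler_antipode_left[where s = s and f = "\<lambda>x. G _ x _", OF G(2)]) (rule refl)
  also have "\<dots> = sweedler h (\<lambda>u q. G u 1 q)"
    by (subst sweedler_counit_left[OF G(3)]) simp
  finally show "sweedler h (\<lambda>r t. sweedler r (\<lambda>u v. sweedler t (\<lambda>p q. G u (S v * p) q))) =
      sweedler h (\<lambda>u q. G u 1 q)" .
  have "sweedler h (\<lambda>r t. sweedler r (\<lambda>u v. sweedler t (\<lambda>p q. G u (v * S p) q))) =
      sweedler h (\<lambda>u t. sweedler t (\<lambda>w q. sweedler w (\<lambda>v p. G u (v * S p) q)))"
    by (rule sweedler_four[where s = s]; intro l)
  also have "\<dots> = sweedler h (\<lambda>u t. sweedler t (\<lambda>w q. s (\<epsilon> w) (G u 1 q)))"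
    by (subst sweedler_antipode_right[where s = s and f = "\<lambda>x. G _ x _", OF G(2)]) (rule refl)
  also have "\<dots> = sweedler h (\<lambda>u q. G u 1 q)"
    by (subst sweedler_counit_left[OF G(3)]) simp
  finally show "sweedler h (\<lambda>r t. sweedler r (\<lambda>u v. sweedler t (\<lambda>p q. G u (v * S p) q))) =
      sweedler h (\<lambda>u q. G u 1 q)" .
qed

lemma antipode_one: "S 1 = 1"
proof -
  have "sweedler 1 (\<lambda>x y. S x * y) = S 1 * 1"
    by (rule sweedler_one[where s = scale]) (intro lin)
  then show ?thesis
    by (simp add: sweedler_antipode_left[OF lin_id] counit_one)
qed

text \<open>
  The maps \<open>a \<otimes> b \<mapsto> S(a b)\<close> and \<open>a \<otimes> b \<mapsto> S(b) S(a)\<close> are a left and a right convolution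
  inverse of multiplication.
\<close>

lemma antipode_mult: "S (a * b) = S b * S a"
proof -
  have "S (a * b) = sweedler a (\<lambda>a1 a'. \<epsilon> a' *s sweedler b (\<lambda>b1 b'. \<epsilon> b' *s S (a1 * b1)))"
    by (subst (2) sweedler_counit_right[where s = scale]; (intro lin)?)
      (subst sweedler_counit_right[where s = scale]; (intro lin)?; simp)
  also have "\<dots> = sweedler a (\<lambda>a1 a'. sweedler b (\<lambda>b1 b'. sweedler a' (\<lambda>a2 a3.
      sweedler b' (\<lambda>b2 b3. S (a1 * b1) * (a2 * (b2 * S b3) * S a3)))))"
  proof -
    have "sweedler a' (\<lambda>a2 a3. sweedler b' (\<lambda>b2 b3. c * (a2 * (b2 * S b3) * S a3))) =
        \<epsilon> a' *s \<epsilon> b' *s c" for a' b' c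
    proof -
      have "sweedler b' (\<lambda>b2 b3. c * (a2 * (b2 * S b3) * S a3)) = \<epsilon> b' *s (c * (a2 * S a3))"
        for a2 a3
        by (subst sweedler_antipode_right[where s = scale and f = "\<lambda>x. c * (a2 * x * S a3)"]; (intro lin)?) simp
      then show ?thesis
        by (simp add: sweedler_antipode_right[where s = scale and f = "\<lambda>x. _ *s (c * x)"] lin)
    qed
    then show ?thesis by (simp add: sweedler_scale)
  qed
  also have "\<dots> = sweedler a (\<lambda>a1 a'. sweedler a' (\<lambda>a2 a3. sweedler b (\<lambda>b1 b'.
      sweedler b' (\<lambda>b2 b3. S (a1 * b1) * (a2 * (b2 * S b3) * S a3)))))"
    by (subst sweedler_swap) (rule refl)
  also have "\<dots> = sweedler a (\<lambda>u a3. sweedler u (\<lambda>a1 a2. sweedler b (\<lambda>v b3.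
      sweedler v (\<lambda>b1 b2. S (a1 * b1) * (a2 * (b2 * S b3) * S a3)))))"
    by (subst sweedler_coassoc[where s = scale, symmetric]; (intro lin)?)
      (subst sweedler_coassoc[where s = scale, symmetric]; (intro lin)?; simp)
  also have "\<dots> = sweedler a (\<lambda>u a3. sweedler b (\<lambda>v b3. sweedler u (\<lambda>a1 a2.
      sweedler v (\<lambda>b1 b2. S (a1 * b1) * (a2 * b2) * (S b3 * S a3)))))"
    by (subst sweedler_swap) (simp add: mult.assoc)
  also have "\<dots> = sweedler a (\<lambda>u a3. sweedler b (\<lambda>v b3.
      sweedler (u * v) (\<lambda>x y. S x * y * (S b3 * S a3))))"
    by (subst sweedler_mult[where s = scale]; (intro lin)?) (rule refl)
  also have "\<dots> = sweedler a (\<lambda>u a3. sweedler b (\<lambda>v b3. \<epsilon> (u * v) *s (S b3 * S a3)))"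
    by (simp add: sweedler_antipode_left[where s = scale and f = "\<lambda>x. x * (S _ * S _)"] lin)
  also have "\<dots> = sweedler a (\<lambda>u a3. \<epsilon> u *s sweedler b (\<lambda>v b3. \<epsilon> v *s (S b3 * S a3)))"
    by (simp add: counit_mult sweedler_scale)
  also have "\<dots> = S b * S a"
    by (subst sweedler_counit_left[where s = scale]; (intro lin)?) (subst sweedler_counit_left[where s = scale]; (intro lin)?; simp)
  finally show ?thesis .
qed

text \<open>
  Both \<open>\<Delta>(S h)\<close> and \<open>S(h2) \<otimes> S(h1)\<close> are convolution inverses of \<open>\<Delta>\<close>. The auxiliary sum
  \<open>Q\<close> multiplies \<open>\<Delta>(S h)\<close> by \<open>\<Delta>\<close> and by the right-hand side; cancelling on the right or
  on the left gives the two expressions.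
\<close>

lemma sweedler_antipode:
  assumes \<beta>: "bilin s \<beta>"
  shows "sweedler (S h) \<beta> = sweedler h (\<lambda>x y. \<beta> (S y) (S x))"
proof -
  note l = lin lin_comp[OF bilinD(1)[OF \<beta>]] lin_comp[OF bilinD(2)[OF \<beta>]]
  define Q where "Q = sweedler h (\<lambda>h1 h2. sweedler h2 (\<lambda>r t. sweedler (S h1) (\<lambda>p q.
    sweedler r (\<lambda>u v. sweedler t (\<lambda>c d. \<beta> (p * u * S d) (q * v * S c))))))"
  have "sweedler h2 (\<lambda>r t. sweedler r (\<lambda>u v. sweedler t (\<lambda>c d. \<beta> (p * u * S d) (q * v * S c)))) =
      s (\<epsilon> h2) (\<beta> p q)" for h2 p q
  proof -
    have "sweedler h2 (\<lambda>r t. sweedler r (\<lambda>u v. sweedler t (\<lambda>c d. \<beta> (p * u * S d) (q * v * S c)))) =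
        sweedler h2 (\<lambda>u d. \<beta> (p * u * S d) (q * 1))"
      using sweedler_cancel_middle(2)[where G = "\<lambda>u m d. \<beta> (p * u * S d) (q * m)" and s = s and h = h2]
      by (simp add: mult.assoc l)
    also have "\<dots> = s (\<epsilon> h2) (\<beta> (p * 1) q)"
      using sweedler_antipode_right[where s = s and f = "\<lambda>x. \<beta> (p * x) q" and h = h2]
      by (simp add: mult.assoc l)
    finally show ?thesis by simp
  qed
  then have "Q = sweedler h (\<lambda>h1 h2. sweedler (S h1) (\<lambda>p q. s (\<epsilon> h2) (\<beta> p q)))"
    unfolding Q_def by (subst sweedler_swap) simp
  also have "\<dots> = sweedler h (\<lambda>h1 h2. s (\<epsilon> h2) (sweedler (S h1) \<beta>))"
  proof -
    have "vector_space s" using bilinD(1)[OF \<beta>] by (rule lin_toD)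
    then have "Vector_Spaces.linear s s (s c)" for c
      by (simp add: vector_space.linear_scale_self)
    from sweedler_linear[OF this] show ?thesis by simp
  qed
  also have "\<dots> = sweedler (S h) \<beta>"
    by (rule sweedler_counit_right[where s = s]) (intro lin \<beta>)
  finally have "Q = sweedler (S h) \<beta>" .
  moreover have "Q = sweedler h (\<lambda>h1 h2. sweedler h2 (\<lambda>r t. sweedler (S h1 * r) (\<lambda>p q.
      sweedler t (\<lambda>c d. \<beta> (p * S d) (q * S c)))))"
  proof -
    have "sweedler (S h1 * r) (\<lambda>p q. sweedler t (\<lambda>c d. \<beta> (p * S d) (q * S c))) =
        sweedler (S h1) (\<lambda>p q. sweedler r (\<lambda>u v. sweedler t (\<lambda>c d. \<beta> (p * u * S d) (q * v * S c))))"
      for h1 r t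
      by (rule sweedler_mult[where s = s]) (intro l)
    then show ?thesis by (simp add: Q_def)
  qed
  moreover have "\<dots> = sweedler 1 (\<lambda>p q. sweedler h (\<lambda>c d. \<beta> (p * S d) (q * S c)))"
    by (rule sweedler_cancel(3)[where s = s]) (intro l)
  moreover have "\<dots> = sweedler h (\<lambda>x y. \<beta> (S y) (S x))"
    by (subst sweedler_one[where s = s]; (intro l)?) simp
  ultimately show ?thesis by simp
qed

section \<open>The adjoint action and commutators\<close>

definition ad :: "'h \<Rightarrow> 'h \<Rightarrow> 'h" where
  "ad h x = sweedler h (\<lambda>h1 h2. h1 * x * S h2)"

lemma lin_ad_right [lin]: "lin f \<Longrightarrow> lin (\<lambda>x. ad h (f x))"
  unfolding ad_def by (intro lin)

lemma lin_ad_left [lin]: "lin f \<Longrightarrow> lin (\<lambda>h. ad (f h) x)"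
  unfolding ad_def by (intro lin)

lemma ad_one_left: "ad 1 x = x"
  unfolding ad_def by (subst sweedler_one[where s = scale]; (intro lin)?) (simp add: antipode_one)

lemma ad_one_right: "ad h 1 = \<epsilon> h *s 1"
  using sweedler_antipode_right[OF lin_id] by (simp add: ad_def)

lemma ad_mult_left: "ad (h * k) x = ad h (ad k x)"
proof -
  have "ad (h * k) x = sweedler h (\<lambda>h1 h2. sweedler k (\<lambda>k1 k2. h1 * (k1 * x * S k2) * S h2))"
    unfolding ad_def
    by (subst sweedler_mult[where s = scale]; (intro lin)?) (simp add: antipode_mult mult.assoc)
  then show ?thesis
    by (simp add: ad_def sweedler_mult_left sweedler_mult_right)
qed

lemma ad_mult_right: "ad h (x * y) = sweedler h (\<lambda>h1 h2. ad h1 x * ad h2 y)"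
proof -
  have "sweedler h (\<lambda>h1 h2. ad h1 x * ad h2 y) = sweedler h (\<lambda>r t. sweedler r (\<lambda>u v.
      sweedler t (\<lambda>p q. u * x * (S v * p) * (y * S q))))"
    by (simp add: ad_def sweedler_mult_left sweedler_mult_right mult.assoc)
      (subst sweedler_swap, rule refl)
  also have "\<dots> = sweedler h (\<lambda>u q. u * x * 1 * (y * S q))"
    by (rule sweedler_cancel_middle(1)[where s = scale]) (intro lin)+
  finally show ?thesis
    by (simp add: ad_def mult.assoc)
qed

lemma mult_eq_ad_mult: "h * x = sweedler h (\<lambda>h1 h2. ad h1 x * h2)"
proof -
  have "sweedler h (\<lambda>h1 h2. ad h1 x * h2) =
      sweedler h (\<lambda>h1 h2. sweedler h1 (\<lambda>u v. u * x * (S v * h2)))"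
    by (simp add: ad_def sweedler_mult_right mult.assoc)
  also have "\<dots> = h * x * 1"
    by (rule sweedler_cancel(1)[where s = scale]) (intro lin)
  finally show ?thesis by simp
qed

lemma mult_antipode_eq: "x * S h = sweedler h (\<lambda>h1 h2. S h1 * ad h2 x)"
proof -
  have "sweedler h (\<lambda>h1 h2. S h1 * ad h2 x) =
      sweedler h (\<lambda>h1 h2. sweedler h2 (\<lambda>u v. (S h1 * u) * x * S v))"
    by (simp add: ad_def sweedler_mult_left mult.assoc)
  also have "\<dots> = 1 * x * S h"
    by (rule sweedler_cancel(3)[where s = scale]) (intro lin)
  finally show ?thesis by simp
qed

lemma counit_ad: "\<epsilon> (ad h x) = \<epsilon> h * \<epsilon> x"
proof -
  have "\<epsilon> (ad h x) = sweedler h (\<lambda>h1 h2. \<epsilon> (h1 * S h2) * \<epsilon> x)"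
    by (simp add: ad_def sweedler_linear[OF counit_linear] counit_mult mult.commute mult.left_commute)
  also have "\<dots> = \<epsilon> h * \<epsilon> x"
    by (subst sweedler_antipode_right[where s = "(*)" and f = "\<lambda>y. \<epsilon> y * \<epsilon> x"]; (intro lin)?)
      (simp add: counit_one)
  finally show ?thesis .
qed

text \<open>
  The adjoint action can be undone componentwise. This replaces an action by \<open>H\<close> on modules that
  only carry an action of an adjoint-stable subalgebra.
\<close>

lemma ad_antipode_cancel: "sweedler h (\<lambda>h1 h2. ad h1 (ad (S h2) x)) = \<epsilon> h *s x"
  unfolding ad_mult_left[symmetric]
  by (subst sweedler_antipode_right[where s = scale and f = "\<lambda>y. ad y x"]; (intro lin)?)
    (simp add: ad_one_left)

definition central :: "'h \<Rightarrow> bool" where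
  "central x \<longleftrightarrow> (\<forall>h. h * x = x * h)"

lemma ad_central: "central x \<Longrightarrow> ad h x = \<epsilon> h *s x"
proof -
  assume "central x"
  then have "ad h x = sweedler h (\<lambda>h1 h2. h1 * S h2 * x)"
    by (simp add: ad_def central_def mult.assoc)
  also have "\<dots> = \<epsilon> h *s x"
    by (subst sweedler_antipode_right[where s = scale and f = "\<lambda>y. y * x"]; (intro lin)?) simp
  finally show ?thesis .
qed

lemma ad_mult_central:
  assumes "central c"
  shows "ad h (x * c) = ad h x * c"
proof -
  have "u * (x * c) * v = u * x * v * c" for u v
    using assms unfolding central_def by (metis mult.assoc)
  then show ?thesis
    by (simp add: ad_def sweedler_mult_right)
qed

text \<open>
  When \<open>h2 x\<close> simplifies, for instance for an integral \<open>x\<close>, this turns left multiplication on the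
  second tensor factor into multiplication by \<open>S h\<close> on the first one.
\<close>

lemma sweedler_shift:
  assumes F: "bilin s F"
  shows "sweedler x (\<lambda>u v. F u (h * v)) =
    sweedler h (\<lambda>h1 h2. sweedler (h2 * x) (\<lambda>u v. F (S h1 * u) v))"
proof -
  note l = lin lin_comp[OF bilinD(1)[OF F]] lin_comp[OF bilinD(2)[OF F]]
  have "sweedler h (\<lambda>h1 h2. sweedler (h2 * x) (\<lambda>u v. F (S h1 * u) v)) =
      sweedler h (\<lambda>h1 h2. sweedler h2 (\<lambda>p q. sweedler x (\<lambda>u v. F (S h1 * p * u) (q * v))))"
    by (subst sweedler_mult[where s = s]; (intro l)?) (simp add: mult.assoc)
  also have "\<dots> = sweedler x (\<lambda>u v. F (1 * u) (h * v))"
    by (rule sweedler_cancel(3)[where s = s]) (intro l)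
  finally show ?thesis by simp
qed

lemma hopf_commutator_eq_ad_right:
  "hopf_commutator a b = sweedler a (\<lambda>a1 a2. a1 * ad b (S a2))"
  by (simp add: hopf_commutator_def ad_def sweedler_mult_left mult.assoc)

lemma hopf_commutator_eq_ad_left:
  "hopf_commutator a b = sweedler b (\<lambda>b1 b2. ad a b1 * S b2)"
  unfolding hopf_commutator_def
  by (subst sweedler_swap) (simp add: ad_def sweedler_mult_right mult.assoc)

text \<open>
  The group identity \<open>h [a,b] h\<^sup>-\<^sup>1 = [h a, b] [b, h]\<close>. In terms of \<open>ad\<close> the left factor ends in
  \<open>S(b2)\<close> and the right factor starts with \<open>b3\<close>, which cancel.
\<close>

lemma ad_hopf_commutator:
  "ad h (hopf_commutator a b) =
    sweedler h (\<lambda>h1 h2. sweedler b (\<lambda>b1 b2. hopf_commutator (h1 * a) b1 * hopf_commutator b2 h2))"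
proof -
  have "sweedler b (\<lambda>b1 b2. hopf_commutator (h1 * a) b1 * hopf_commutator b2 h2) =
      sweedler b (\<lambda>b1 b2. ad (h1 * a) b1 * ad h2 (S b2))" for h1 h2
  proof -
    have "sweedler b (\<lambda>b1 b2. hopf_commutator (h1 * a) b1 * hopf_commutator b2 h2) =
        sweedler b (\<lambda>r t. sweedler r (\<lambda>u v. sweedler t (\<lambda>p q.
          ad (h1 * a) u * (S v * p) * ad h2 (S q))))"
      unfolding hopf_commutator_eq_ad_left[of "h1 * a"] hopf_commutator_eq_ad_right[of _ h2]
      by (simp add: sweedler_mult_left sweedler_mult_right mult.assoc)
        (subst sweedler_swap, rule refl)
    also have "\<dots> = sweedler b (\<lambda>u q. ad (h1 * a) u * 1 * ad h2 (S q))"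
      by (rule sweedler_cancel_middle(1)[where s = scale]) (intro lin)+
    finally show ?thesis by simp
  qed
  moreover have "ad h (hopf_commutator a b) =
      sweedler h (\<lambda>h1 h2. sweedler b (\<lambda>b1 b2. ad (h1 * a) b1 * ad h2 (S b2)))"
  proof -
    have "ad h (hopf_commutator a b) = sweedler b (\<lambda>b1 b2. ad h (ad a b1 * S b2))"
      unfolding hopf_commutator_eq_ad_left
      by (rule sweedler_linear[where s = scale and t = scale]) (intro lin)
    then show ?thesis
      by (simp add: ad_mult_right ad_mult_left) (subst sweedler_swap, rule refl)
  qed
  ultimately show ?thesis by simp
qed

text \<open>The group identity \<open>a b = [a,b] b a\<close>.\<close>

lemma mult_eq_hopf_commutator:
  "a * b = sweedler a (\<lambda>a1 a2. sweedler b (\<lambda>b1 b2. hopf_commutator a1 b1 * (b2 * a2)))"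
proof -
  have "sweedler b (\<lambda>b1 b2. hopf_commutator a1 b1 * (b2 * a2)) = ad a1 b * a2" for a1 a2
  proof -
    have "sweedler b (\<lambda>b1 b2. hopf_commutator a1 b1 * (b2 * a2)) =
        sweedler b (\<lambda>b1 b2. sweedler b1 (\<lambda>u v. ad a1 u * (S v * b2) * a2))"
      by (simp add: hopf_commutator_eq_ad_left sweedler_mult_right mult.assoc)
    also have "\<dots> = ad a1 b * 1 * a2"
      by (rule sweedler_cancel(1)[where s = scale]) (intro lin)
    finally show ?thesis by simp
  qed
  then show ?thesis by (simp add: mult_eq_ad_mult[of a b])
qed

text \<open>
  Both factors \<open>S(a2)\<close> and \<open>S(b2)\<close> reverse the order of the coproduct, so that the inner
  components of \<open>a\<close> and \<open>b\<close> assemble to a commutator: \<open>\<Delta>{a,b}\<close> is the sum of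
  \<open>a1 b1 S(a3) S(b3) \<otimes> {a2,b2}\<close>.
\<close>

lemma sweedler_hopf_commutator:
  assumes \<beta>: "bilin s \<beta>"
  shows "sweedler (hopf_commutator a b) \<beta> =
    sweedler a (\<lambda>a1 a'. sweedler a' (\<lambda>a2 a3. sweedler b (\<lambda>b1 b'. sweedler b' (\<lambda>b2 b3.
      \<beta> (a1 * b1 * S a3 * S b3) (hopf_commutator a2 b2)))))"
proof -
  note l = lin lin_comp[OF bilinD(1)[OF \<beta>]] lin_comp[OF bilinD(2)[OF \<beta>]]
  define K where "K r1 r2 t1 t2 v1 v2 w1 w2 =
    \<beta> (r1 * v1 * S t2 * S w2) (r2 * v2 * S t1 * S w1)" for r1 r2 t1 t2 v1 v2 w1 w2
  have "sweedler (hopf_commutator a b) \<beta> =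
      sweedler a (\<lambda>r t. sweedler b (\<lambda>v w. sweedler (r * v * S t * S w) \<beta>))"
    unfolding hopf_commutator_def
    by (subst sweedler_linear[where \<phi> = "\<lambda>x. sweedler x \<beta>" and s = scale and t = s];
      (intro lin \<beta>)?)+ (rule refl)
  also have "\<dots> = sweedler a (\<lambda>r t. sweedler b (\<lambda>v w. sweedler r (\<lambda>r1 r2. sweedler v (\<lambda>v1 v2.
      sweedler t (\<lambda>t1 t2. sweedler w (\<lambda>w1 w2. K r1 r2 t1 t2 v1 v2 w1 w2))))))"
  proof -
    have "sweedler (r * v * S t * S w) \<beta> = sweedler r (\<lambda>r1 r2. sweedler v (\<lambda>v1 v2.
      sweedler t (\<lambda>t1 t2. sweedler w (\<lambda>w1 w2. K r1 r2 t1 t2 v1 v2 w1 w2))))" for r v t w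
      unfolding K_def
      apply (subst sweedler_mult[where s = s], (intro l))
      apply (subst sweedler_mult[where s = s], (intro l))
      apply (subst sweedler_mult[where s = s], (intro l))
      apply (subst sweedler_antipode[where s = s], (intro l))+
      apply (rule refl)
      done
    then show ?thesis by simp
  qed
  also have "\<dots> = sweedler a (\<lambda>r t. sweedler r (\<lambda>r1 r2. sweedler t (\<lambda>t1 t2. sweedler b (\<lambda>v w.
      sweedler v (\<lambda>v1 v2. sweedler w (\<lambda>w1 w2. K r1 r2 t1 t2 v1 v2 w1 w2))))))"
  proof -
    have "sweedler b (\<lambda>v w. sweedler r (\<lambda>r1 r2. sweedler v (\<lambda>v1 v2.
        sweedler t (\<lambda>t1 t2. sweedler w (\<lambda>w1 w2. K r1 r2 t1 t2 v1 v2 w1 w2))))) =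
      sweedler r (\<lambda>r1 r2. sweedler t (\<lambda>t1 t2. sweedler b (\<lambda>v w.
        sweedler v (\<lambda>v1 v2. sweedler w (\<lambda>w1 w2. K r1 r2 t1 t2 v1 v2 w1 w2)))))" for r t
      by (subst sweedler_swap[of b r], subst sweedler_swap[of _ t], subst sweedler_swap[of b t])
        (rule refl)
    then show ?thesis by simp
  qed
  also have "\<dots> = sweedler a (\<lambda>r1 a'. sweedler a' (\<lambda>u t2. sweedler u (\<lambda>r2 t1.
      sweedler b (\<lambda>v w. sweedler v (\<lambda>v1 v2. sweedler w (\<lambda>w1 w2. K r1 r2 t1 t2 v1 v2 w1 w2))))))"
    by (rule sweedler_four[where s = s]; unfold K_def; intro l)
  also have "\<dots> = sweedler a (\<lambda>r1 a'. sweedler a' (\<lambda>u t2. sweedler u (\<lambda>r2 t1.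
      sweedler b (\<lambda>v1 b'. sweedler b' (\<lambda>x w2. sweedler x (\<lambda>v2 w1. K r1 r2 t1 t2 v1 v2 w1 w2))))))"
  proof -
    have "sweedler b (\<lambda>v w. sweedler v (\<lambda>v1 v2. sweedler w (\<lambda>w1 w2. K r1 r2 t1 t2 v1 v2 w1 w2))) =
        sweedler b (\<lambda>v1 b'. sweedler b' (\<lambda>x w2. sweedler x (\<lambda>v2 w1. K r1 r2 t1 t2 v1 v2 w1 w2)))"
      for r1 r2 t1 t2
      by (rule sweedler_four[where s = s]; unfold K_def; intro l)
    then show ?thesis by simp
  qed
  also have "\<dots> = sweedler a (\<lambda>a1 a'. sweedler a' (\<lambda>a2 a3. sweedler b (\<lambda>b1 b'. sweedler b' (\<lambda>b2 b3.
      \<beta> (a1 * b1 * S a3 * S b3) (hopf_commutator a2 b2)))))"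
  proof -
    have "\<beta> p (hopf_commutator u x) = sweedler u (\<lambda>r2 t1. sweedler x (\<lambda>v2 w1.
        \<beta> p (r2 * v2 * S t1 * S w1)))" for p u x
      unfolding hopf_commutator_def
      by (subst sweedler_linear[OF bilinD(1)[OF \<beta>]])+ (rule refl)
    moreover have "sweedler u (\<lambda>r2 t1. sweedler b (\<lambda>v1 b'. sweedler b' (\<lambda>x w2. sweedler x (\<lambda>v2 w1.
        K r1 r2 t1 t2 v1 v2 w1 w2)))) = sweedler b (\<lambda>v1 b'. sweedler b' (\<lambda>x w2.
        sweedler u (\<lambda>r2 t1. sweedler x (\<lambda>v2 w1. K r1 r2 t1 t2 v1 v2 w1 w2))))" for u r1 t2
      by (subst sweedler_swap[of u b], subst sweedler_swap[of u]) (rule refl)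
    ultimately show ?thesis by (simp add: K_def)
  qed
  finally show ?thesis .
qed

end

section \<open>Central idempotents and integrals\<close>

text \<open>
  A complement of \<open>I\<close> gives a right unit \<open>e\<close> of \<open>I\<close>. For \<open>x \<in> I\<close> the element
  \<open>y = (1 - e) x\<close> satisfies \<open>y r y = 0\<close> for all \<open>r\<close>, because \<open>x r (1 - e) = 0\<close>; but the left
  ideal generated by \<open>y\<close> has a right unit as well, which forces \<open>y = 0\<close>. So \<open>e\<close> is also a
  left unit, and a two-sided unit of a two-sided ideal is central.
\<close>

lemma semisimple_ring_ideal_idempotent:
  fixes I :: "'a::ring_1 set"
  assumes ss: "semisimple_ring TYPE('a)" and I: "left_ideal I"
    and right: "\<And>x h. x \<in> I \<Longrightarrow> x * h \<in> I"
  obtains e where "e \<in> I" "\<And>x. x \<in> I \<Longrightarrow> x * e = x" "\<And>h. h * e = e * h"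
proof -
  have complement: "\<exists>e\<in>L. \<exists>f. e + f = 1 \<and> (\<forall>x\<in>L. x * e = x \<and> x * f = 0)"
    if L: "left_ideal L" for L :: "'a set"
  proof -
    obtain J where J: "left_ideal J" "L \<inter> J = {0}" "\<forall>r. \<exists>x\<in>L. \<exists>y\<in>J. r = x + y"
      using ss L unfolding semisimple_ring_def by metis
    from J(3) obtain e f where ef: "e \<in> L" "f \<in> J" "1 = e + f" by blast
    have "x * e = x \<and> x * f = 0" if x: "x \<in> L" for x
    proof -
      have 1: "x * e + x * f = x"
        using ef(3) by (metis distrib_left mult.right_neutral)
      have "x * e \<in> L" "x * f \<in> J"
        using L J(1) ef unfolding left_ideal_def by simp_all
      moreover from this have "x + (- 1) * (x * e) \<in> L"
        using L x unfolding left_ideal_def by metis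
      moreover have "x + (- 1) * (x * e) = x * f"
        using 1 by (simp add: algebra_simps)
      ultimately have "x * f = 0" using J(2) by auto
      then show ?thesis using 1 by simp
    qed
    then show ?thesis using ef by metis
  qed
  obtain e f where e: "e \<in> I" "e + f = 1" "\<forall>x\<in>I. x * e = x \<and> x * f = 0"
    using complement[OF I] by blast
  have left: "e * x = x" if x: "x \<in> I" for x
  proof -
    define y where "y = f * x"
    have nil: "y * r * y = 0" for r
    proof -
      have "x * r * f = 0" using e(3) right[OF x] by blast
      then have "f * (x * r * f) * x = 0" by simp
      then show ?thesis by (simp add: y_def mult.assoc)
    qed
    have "left_ideal {r * y | r. True}"
      unfolding left_ideal_def
    proof (intro conjI ballI allI)
      show "0 \<in> {r * y | r. True}" by (auto intro: exI[of _ 0])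
      show "a + b \<in> {r * y | r. True}" if "a \<in> {r * y | r. True}" "b \<in> {r * y | r. True}" for a b
        using that by (auto simp flip: distrib_right)
      show "r * a \<in> {r * y | r. True}" if "a \<in> {r * y | r. True}" for a r
        using that by (auto simp flip: mult.assoc)
    qed
    from complement[OF this] obtain r where r: "\<forall>a\<in>{r * y | r. True}. a * (r * y) = a"
      by blast
    have "y \<in> {r * y | r. True}" by (auto intro: exI[of _ 1])
    then have "y * (r * y) = y" using r by blast
    then have "y = 0" using nil[of r] by (simp add: mult.assoc)
    then have "x = e * x + 0"
      using e(2) by (metis y_def distrib_right mult.left_neutral)
    then show ?thesis by simp
  qed
  have "h * e = e * h" for h
  proof -
    have "h * e \<in> I" using I e(1) unfolding left_ideal_def by simp
    then have "h * e = e * (h * e)" using left by simp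
    also have "\<dots> = e * h" using e(3) right[OF e(1), of h] by (metis mult.assoc)
    finally show ?thesis .
  qed
  then show ?thesis using that e by blast
qed

context hopf_algebra begin

text \<open>The right action of the dual algebra, \<open>z \<leftharpoonup> f\<close>. Its orbits are the left coideals generated by one element.\<close>

definition right_hit :: "('h \<Rightarrow> 'k) \<Rightarrow> 'h \<Rightarrow> 'h" where
  "right_hit f z = sweedler z (\<lambda>u v. f u *s v)"

text \<open>
  If \<open>z\<close> is the idempotent complementary to \<open>H N\<^sup>+\<close>, then multiplication by \<open>z\<close> identifies
  \<open>H / H N\<^sup>+\<close> with \<open>H z\<close>, and the equation \<open>h1 \<otimes> h2 z = h \<otimes> z\<close> is coinvariance for the projection
  onto \<open>H / H N\<^sup>+\<close>. Bilinear maps take the place of tensors.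
\<close>

definition coinvariant :: "'h \<Rightarrow> 'h \<Rightarrow> bool" where
  "coinvariant z h \<longleftrightarrow> (\<forall>F. bilin scale F \<longrightarrow> sweedler h (\<lambda>h1 h2. F h1 (h2 * z)) = F h z)"

lemma form_comp:
  assumes "form f" "lin g"
  shows "form (\<lambda>x. f (g x))"
  using assms by (rule lin_comp)

text \<open>Coinvariance is what \<open>sweedler_shift\<close> needs to turn left multiplication by \<open>h\<close> into a change of the form \<open>f\<close>.\<close>

lemma coinvariant_mult_right_hit:
  assumes h: "coinvariant z h" and f: "form f"
  shows "h * right_hit f z = right_hit (\<lambda>u. f (S h * u)) z"
proof -
  note l = lin form_comp[OF f]
  have "h * right_hit f z = sweedler z (\<lambda>u v. f u *s (h * v))"
    by (simp add: right_hit_def sweedler_mult_left scale_mult_right)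
  also have "\<dots> = sweedler h (\<lambda>h1 h2. sweedler (h2 * z) (\<lambda>u v. f (S h1 * u) *s v))"
    by (rule sweedler_shift[where s = scale]) (intro l f)
  also have "\<dots> = sweedler z (\<lambda>u v. f (S h * u) *s v)"
  proof -
    have "bilin scale (\<lambda>h1 y. sweedler y (\<lambda>u v. f (S h1 * u) *s v))" by (intro l)
    then show ?thesis using h unfolding coinvariant_def by blast
  qed
  finally show ?thesis by (simp add: right_hit_def)
qed

lemma left_coideal_coinvariant:
  assumes N: "left_coideal N" and z: "\<And>x. x \<in> N \<Longrightarrow> x * z = \<epsilon> x *s z" and h: "h \<in> N"
  shows "coinvariant z h"
  unfolding coinvariant_def
proof (intro allI impI)
  fix F :: "'h \<Rightarrow> 'h \<Rightarrow> 'h" assume F: "bilin scale F"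
  note l = lin lin_comp[OF bilinD(1)[OF F]] lin_comp[OF bilinD(2)[OF F]]
  obtain xs where xs: "\<Delta> h = (\<Sum>(x, y)\<leftarrow>xs. x \<otimes> y)" "set xs \<subseteq> UNIV \<times> N"
    using N h unfolding left_coideal_def tensor_space_def by blast
  have "sweedler h (\<lambda>h1 h2. F h1 (h2 * z)) = (\<Sum>(x, y)\<leftarrow>xs. F x (y * z))"
    unfolding sweedler_def xs(1) by (rule tensor_lift_sum[where s = scale]) (intro l)
  also have "\<dots> = (\<Sum>(x, y)\<leftarrow>xs. \<epsilon> y *s F x z)"
    using xs(2) by (intro arg_cong[where f = sum_list] map_cong refl)
      (auto simp: z lin_toD(3)[OF bilinD(1)[OF F]])
  also have "\<dots> = sweedler h (\<lambda>h1 h2. \<epsilon> h2 *s F h1 z)"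
    unfolding sweedler_def xs(1) by (rule tensor_lift_sum[where s = scale, symmetric]) (intro l)
  also have "\<dots> = F h z"
    by (rule sweedler_counit_right) (rule bilinD(2)[OF F])
  finally show "sweedler h (\<lambda>h1 h2. F h1 (h2 * z)) = F h z" .
qed

lemma subspace_right_hit_range: "subspace {right_hit f z | f. form f}"
proof -
  have eq: "right_hit f z + right_hit g z = right_hit (\<lambda>x. f x + g x) z" "c *s right_hit f z = right_hit (\<lambda>x. c * f x) z" for f g c
  proof -
    have "(\<Sum>(x, y)\<leftarrow>xs. f x *s y) + (\<Sum>(x, y)\<leftarrow>xs. g x *s y) = (\<Sum>(x, y)\<leftarrow>xs. (f x + g x) *s y)" for xs
      by (induction xs) (auto simp: algebra_simps scale_left_distrib)
    then show "right_hit f z + right_hit g z = right_hit (\<lambda>x. f x + g x) z"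
      by (simp add: right_hit_def sweedler_list)
    show "c *s right_hit f z = right_hit (\<lambda>x. c * f x) z"
      by (simp add: right_hit_def sweedler_scale)
  qed
  have zero: "form (\<lambda>x. 0)"
    by (rule lin_toI) (auto intro: vector_space_field)
  have add: "form (\<lambda>x. f x + g x)" if "form f" "form g" for f g
    using that by (intro lin_toI vector_space_field) (auto simp: lin_toD algebra_simps)
  have right_hit_zero: "right_hit (\<lambda>x. 0) z = 0"
    using eq(2)[of 0 "\<lambda>_. 0"] by simp
  show ?thesis
  proof (rule subspaceI)
    show "0 \<in> {right_hit f z | f. form f}"
      using zero right_hit_zero by force
    show "x + y \<in> {right_hit f z | f. form f}"
      if "x \<in> {right_hit f z | f. form f}" "y \<in> {right_hit f z | f. form f}" for x y
      using that eq(1) add by blast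
    show "c *s x \<in> {right_hit f z | f. form f}" if "x \<in> {right_hit f z | f. form f}" for c x
      using that eq(2) form_mult_left by blast
  qed
qed

definition ad_stable :: "'h set \<Rightarrow> bool" where
  "ad_stable N \<longleftrightarrow> subspace N \<and> (\<forall>h. \<forall>x\<in>N. ad h x \<in> N)"

text \<open>
  For central \<open>z\<close>, conjugating \<open>z2\<close> amounts to conjugating \<open>z1\<close>:
  \<open>z1 \<otimes> ad k z2 = S(k1) z1 k2 \<otimes> z2\<close>, and a form composed with \<open>u \<mapsto> S(k1) u k2\<close> is again a form.
\<close>

lemma right_hit_range_ad_stable:
  assumes z: "central z"
  shows "ad_stable {right_hit f z | f. form f}"
  unfolding ad_stable_def
proof (intro conjI allI ballI subspace_right_hit_range)
  fix k x assume "x \<in> {right_hit f z | f. form f}"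
  then obtain f where f: "form f" "x = right_hit f z" by blast
  note l = lin form_comp[OF f(1)]
  have "ad k x = sweedler z (\<lambda>u v. f u *s ad k v)"
    unfolding f(2) right_hit_def
    by (subst sweedler_linear[where \<phi> = "ad k" and s = scale and t = scale]; (intro lin)?)
      (simp add: lin_toD(3)[OF lin_ad_right[OF lin_id]])
  also have "\<dots> = sweedler k (\<lambda>k1 k2. sweedler z (\<lambda>u v. f u *s (k1 * v * S k2)))"
    unfolding ad_def sweedler_scale by (rule sweedler_swap)
  also have "\<dots> = sweedler k (\<lambda>k' k3. sweedler k' (\<lambda>k1 k2. sweedler (k2 * z)
      (\<lambda>u v. f (S k1 * u) *s (v * S k3))))"
    by (subst sweedler_shift[where F = "\<lambda>u v. f u *s (v * S _)" and s = scale]; (intro l)?)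
      (rule refl)
  also have "\<dots> = sweedler k (\<lambda>k' k3. sweedler k' (\<lambda>k1 k2. sweedler (z * k2)
      (\<lambda>u v. f (S k1 * u) *s (v * S k3))))"
    using z by (simp add: central_def)
  also have "\<dots> = sweedler k (\<lambda>k' k3. sweedler k' (\<lambda>k1 k2. sweedler z (\<lambda>u v. sweedler k2
      (\<lambda>p q. f (S k1 * (u * p)) *s (v * q * S k3)))))"
    by (subst sweedler_mult[where s = scale]; (intro l)?) (rule refl)
  also have "\<dots> = sweedler k (\<lambda>k1 w. sweedler w (\<lambda>k2 k3. sweedler k2
      (\<lambda>p q. sweedler z (\<lambda>u v. f (S k1 * (u * p)) *s (v * (q * S k3))))))"
    by (subst sweedler_coassoc[where s = scale]; (intro l)?)
      (subst sweedler_swap, simp add: mult.assoc)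
  also have "\<dots> = sweedler k (\<lambda>k1 w. sweedler z (\<lambda>u v. f (S k1 * (u * w)) *s (v * 1)))"
    by (subst sweedler_cancel(2)[where s = scale and
        G = "\<lambda>p q. sweedler z (\<lambda>u v. f (S _ * (u * p)) *s (v * q))"]; (intro l)?)
      (rule refl)
  also have "\<dots> \<in> {right_hit f z | f. form f}"
  proof (rule sweedler_in_subspace[OF subspace_right_hit_range])
    fix k1 w
    have "form (\<lambda>u. f (S k1 * (u * w)))" by (intro l)
    then show "sweedler z (\<lambda>u v. f (S k1 * (u * w)) *s (v * 1)) \<in> {right_hit f z | f. form f}"
      unfolding right_hit_def by auto
  qed
  finally show "ad k x \<in> {right_hit f z | f. form f}" .
qed

lemma left_ideal_genI: "x \<in> N \<Longrightarrow> h * x \<in> left_ideal_gen N"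
  unfolding left_ideal_gen_def by (rule span_base) blast

lemma subspace_left_ideal_gen: "subspace (left_ideal_gen N)"
  unfolding left_ideal_gen_def by (rule subspace_span)

lemma left_ideal_gen_induct [consumes 1, case_names subspace mult]:
  assumes "g \<in> left_ideal_gen N" "subspace V" "\<And>h x. x \<in> N \<Longrightarrow> h * x \<in> V"
  shows "g \<in> V"
  using assms(1) unfolding left_ideal_gen_def
  by (rule span_subspace_induct[OF _ assms(2)]) (use assms(3) in auto)

end

locale semisimple_hopf_algebra = hopf_algebra scale comult counit antipode
  for scale :: "'k::field \<Rightarrow> 'h::ring_1 \<Rightarrow> 'h" (infixr \<open>*s\<close> 75)
    and comult (\<open>\<Delta>\<close>) and counit (\<open>\<epsilon>\<close>) and antipode (\<open>S\<close>) +
  assumes finite_dimensional: "\<exists>B. finite B \<and> span B = UNIV"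
    and semisimple: "semisimple_ring TYPE('h)"
begin

lemma ideal_central_idempotent:
  assumes I: "subspace I" and left: "\<And>h x. x \<in> I \<Longrightarrow> h * x \<in> I" and right: "\<And>h x. x \<in> I \<Longrightarrow> x * h \<in> I"
  obtains e where "e \<in> I" "\<And>x. x \<in> I \<Longrightarrow> x * e = x" "central e"
proof -
  have "left_ideal I"
    using I left by (simp add: left_ideal_def subspace_0 subspace_add)
  with semisimple obtain e where "e \<in> I" "\<And>x. x \<in> I \<Longrightarrow> x * e = x" "\<And>h. h * e = e * h"
    using right semisimple_ring_ideal_idempotent by blast
  then show ?thesis using that unfolding central_def by blast
qed

definition integral :: 'h where
  "integral = (SOME z. central z \<and> \<epsilon> z = 1 \<and> (\<forall>h. h * z = \<epsilon> h *s z))"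

text \<open>The integral is the idempotent complementary to the ideal \<open>ker \<epsilon>\<close>.\<close>

lemma integral:
  "central integral" "\<epsilon> integral = 1" "h * integral = \<epsilon> h *s integral"
  "integral * h = \<epsilon> h *s integral"
proof -
  have \<epsilon>: "\<epsilon> 0 = 0" "\<epsilon> (x + y) = \<epsilon> x + \<epsilon> y" "\<epsilon> (x - y) = \<epsilon> x - \<epsilon> y" "\<epsilon> (c *s x) = c * \<epsilon> x" for x y c
    by (simp_all add: lin_toD[OF counit_linear])
  have "subspace {x. \<epsilon> x = 0}"
    by (rule subspaceI) (simp_all add: \<epsilon>)
  then obtain e where e: "e \<in> {x. \<epsilon> x = 0}" "\<And>x. x \<in> {x. \<epsilon> x = 0} \<Longrightarrow> x * e = x" "central e"
    by (rule ideal_central_idempotent) (simp_all add: counit_mult)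
  have "central (1 - e) \<and> \<epsilon> (1 - e) = 1 \<and> (\<forall>h. h * (1 - e) = \<epsilon> h *s (1 - e))"
  proof (intro conjI allI)
    show "central (1 - e)" using e(3) by (simp add: central_def algebra_simps)
    show "\<epsilon> (1 - e) = 1" using e(1) by (simp add: \<epsilon> counit_one)
    fix h
    have "(h - \<epsilon> h *s 1) * e = h - \<epsilon> h *s 1"
      by (rule e(2)) (simp add: \<epsilon> counit_one)
    then show "h * (1 - e) = \<epsilon> h *s (1 - e)"
      by (simp add: algebra_simps scale_mult_left scale_right_diff_distrib)
  qed
  then have *: "central integral \<and> \<epsilon> integral = 1 \<and> (\<forall>h. h * integral = \<epsilon> h *s integral)"
    unfolding integral_def by (rule someI)
  then show "central integral" "\<epsilon> integral = 1" "h * integral = \<epsilon> h *s integral"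
    "integral * h = \<epsilon> h *s integral"
    unfolding central_def by metis+
qed

text \<open>
  In a basis consisting of the integral and of elements of \<open>ker \<epsilon>\<close>, the coordinate function of the
  integral is the counit. The counting argument below depends on this choice.
\<close>

lemma adapted_basis:
  obtains B where "finite B" "independent B" "span B = UNIV" "integral \<in> B"
    "\<And>b. b \<in> B \<Longrightarrow> b \<noteq> integral \<Longrightarrow> \<epsilon> b = 0"
proof -
  have \<epsilon>: "\<epsilon> 0 = 0" "\<epsilon> (x + y) = \<epsilon> x + \<epsilon> y" "\<epsilon> (x - y) = \<epsilon> x - \<epsilon> y" "\<epsilon> (c *s x) = c * \<epsilon> x" for x y c
    by (simp_all add: lin_toD[OF counit_linear])
  have ker: "subspace {x. \<epsilon> x = 0}"
    by (rule subspaceI) (simp_all add: \<epsilon>)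
  obtain K where K: "K \<subseteq> {x. \<epsilon> x = 0}" "independent K" "{x. \<epsilon> x = 0} \<subseteq> span K"
    using basis_exists[of "{x. \<epsilon> x = 0}"] by metis
  have span_K: "span K = {x. \<epsilon> x = 0}"
    using K(3) span_minimal[OF K(1) ker] by (simp add: subset_antisym)
  have ind: "independent (insert integral K)"
    by (rule independent_insertI[OF _ K(2)]) (simp add: span_K integral(2))
  have "h \<in> span (insert integral K)" for h
  proof -
    have "h - \<epsilon> h *s integral \<in> span (insert integral K)"
      by (rule subsetD[OF span_mono[of K]]) (auto simp: span_K \<epsilon> integral(2))
    moreover have "\<epsilon> h *s integral \<in> span (insert integral K)"
      by (intro span_scale span_base) simp
    ultimately have "(h - \<epsilon> h *s integral) + \<epsilon> h *s integral \<in> span (insert integral K)"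
      by (rule span_add)
    then show ?thesis by simp
  qed
  moreover obtain F where "finite F" "span F = UNIV" using finite_dimensional by blast
  then have fin: "finite (insert integral K)"
    using independent_span_bound[OF _ ind, of F] by simp
  ultimately have "span (insert integral K) = UNIV" by blast
  from that[OF fin ind this] show ?thesis
    using K(1) by blast
qed

definition basis :: "'h set" where
  "basis = (SOME B. finite B \<and> independent B \<and> span B = UNIV \<and> integral \<in> B \<and>
     (\<forall>b\<in>B. b \<noteq> integral \<longrightarrow> \<epsilon> b = 0))"

lemma basis: "finite basis" "independent basis" "span basis = UNIV" "integral \<in> basis"
    "b \<in> basis \<Longrightarrow> b \<noteq> integral \<Longrightarrow> \<epsilon> b = 0"
proof -
  have "\<exists>B. finite B \<and> independent B \<and> span B = UNIV \<and> integral \<in> B \<and>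
     (\<forall>b\<in>B. b \<noteq> integral \<longrightarrow> \<epsilon> b = 0)"
    by (rule adapted_basis) blast
  from someI_ex[OF this]
  show "finite basis" "independent basis" "span basis = UNIV" "integral \<in> basis"
    "b \<in> basis \<Longrightarrow> b \<noteq> integral \<Longrightarrow> \<epsilon> b = 0"
    unfolding basis_def[symmetric] by blast+
qed

definition coef :: "'h \<Rightarrow> 'h \<Rightarrow> 'k" where
  "coef b h = representation basis h b"

lemma coef_expand: "(\<Sum>b\<in>basis. coef b h *s b) = h"
  unfolding coef_def by (rule sum_representation_eq) (use basis in auto)

lemma form_coef: "form (coef b)"
  unfolding coef_def
  by (rule lin_toI[OF vector_space_field])
    (use basis in \<open>auto simp: representation_add representation_scale\<close>)

lemma coef_basis: "b \<in> basis \<Longrightarrow> coef b' b = (if b' = b then 1 else 0)"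
  using representation_basis[OF basis(2)] by (simp add: coef_def)

lemma coef_integral: "coef integral h = \<epsilon> h"
proof -
  have "\<epsilon> h = \<epsilon> (\<Sum>b\<in>basis. coef b h *s b)" by (simp add: coef_expand)
  also have "\<dots> = (\<Sum>b\<in>basis. if b = integral then coef b h else 0)"
    unfolding lin_toD(6)[OF counit_linear]
    by (intro sum.cong) (simp_all add: lin_toD[OF counit_linear] integral(2) basis(5))
  finally show ?thesis using basis(1,4) by (simp add: sum.delta)
qed

lemmas lin_coef [lin] = form_comp[OF form_coef]

lemma lin_expand:
  assumes f: "lin_to s f"
  shows "f h = (\<Sum>b\<in>basis. s (coef b h) (f b))"
proof -
  have "f h = f (\<Sum>b\<in>basis. coef b h *s b)" by (simp add: coef_expand)
  then show ?thesis by (simp add: lin_toD(3,6)[OF f])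
qed

lemma sweedler_expand:
  assumes F: "bilin scale F"
  shows "sweedler z F = (\<Sum>b\<in>basis. F b (right_hit (coef b) z))"
proof -
  have "sweedler z F = sweedler z (\<lambda>u v. \<Sum>b\<in>basis. coef b u *s F b v)"
    by (intro arg_cong[where f = "sweedler z"] ext lin_expand bilinD(2)[OF F])
  also have "\<dots> = (\<Sum>b\<in>basis. sweedler z (\<lambda>u v. coef b u *s F b v))"
    by (rule sweedler_sum)
  finally show ?thesis
    by (simp add: right_hit_def sweedler_linear[OF bilinD(1)[OF F]] lin_toD(3)[OF bilinD(1)[OF F]])
qed

text \<open>Together with \<open>comult_in_tensor_spaceI\<close>: left coideals are the subspaces preserved by the right action of the dual algebra.\<close>

lemma left_coideal_right_hit:
  assumes N: "left_coideal N" and x: "x \<in> N" and f: "form f"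
  shows "right_hit f x \<in> N"
proof -
  have sub: "subspace N" using N by (simp add: left_coideal_def)
  obtain xs where xs: "\<Delta> x = (\<Sum>(x, y)\<leftarrow>xs. x \<otimes> y)" "set xs \<subseteq> UNIV \<times> N"
    using N x unfolding left_coideal_def tensor_space_def by blast
  have "right_hit f x = (\<Sum>(x, y)\<leftarrow>xs. f x *s y)"
    unfolding right_hit_def sweedler_def xs(1)
    by (rule tensor_lift_sum[where s = scale]) (intro lin form_comp[OF f] f)
  moreover have "(\<Sum>(x, y)\<leftarrow>xs. f x *s y) \<in> N"
    using xs(2) by (induction xs) (auto simp: subspace_0[OF sub] intro!: subspace_add[OF sub] subspace_scale[OF sub])
  ultimately show ?thesis by simp
qed

lemma comult_in_tensor_spaceI:
  assumes "\<And>f. form f \<Longrightarrow> right_hit f x \<in> N"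
  shows "\<Delta> x \<in> tensor_space UNIV N"
proof -
  obtain bs where bs: "set bs = basis" "distinct bs"
    using finite_distinct_list[OF basis(1)] by blast
  have "\<Delta> x = (\<Sum>(u, v)\<leftarrow>map (\<lambda>b. (b, right_hit (coef b) x)) bs. u \<otimes> v)"
  proof
    fix \<beta>
    show "\<Delta> x \<beta> = (\<Sum>(u, v)\<leftarrow>map (\<lambda>b. (b, right_hit (coef b) x)) bs. u \<otimes> v) \<beta>"
    proof (cases "bilin (*) \<beta>")
      case True
      have "\<Delta> x \<beta> = sweedler x (\<lambda>u v. \<Sum>b\<in>basis. coef b u * \<beta> b v)"
        by (subst lin_expand[OF bilinD(2)[OF True], symmetric]) (simp add: sweedler_form[OF True])
      also have "\<dots> = (\<Sum>b\<in>basis. sweedler x (\<lambda>u v. coef b u * \<beta> b v))"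
        by (rule sweedler_sum)
      also have "\<dots> = (\<Sum>b\<leftarrow>bs. \<beta> b (right_hit (coef b) x))"
        using bs by (simp add: right_hit_def sweedler_linear[OF bilinD(1)[OF True]]
            lin_toD(3)[OF bilinD(1)[OF True]] sum_list_distinct_conv_sum_set)
      finally show ?thesis
        unfolding tensor_sum_apply[OF True] by (simp add: o_def)
    next
      case False
      have zero: "(\<Sum>(x, y)\<leftarrow>xs. x \<otimes> y) \<beta> = 0" for xs
        using False by (induction xs) (auto simp: tensor_def)
      show ?thesis by (subst (1) comult_list) (rule trans[OF zero zero[symmetric]])
    qed
  qed
  moreover have "set (map (\<lambda>b. (b, right_hit (coef b) x)) bs) \<subseteq> UNIV \<times> N"
    using assms form_coef by auto
  ultimately show ?thesis unfolding tensor_space_def by blast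
qed

text \<open>\<open>S(z1) z2 = \<epsilon>(z) 1\<close>, expanded in a basis.\<close>

lemma one_in_left_ideal_gen_right_hit:
  assumes "\<epsilon> z = 1"
  shows "1 \<in> left_ideal_gen {right_hit f z | f. form f}"
proof -
  have "1 = sweedler z (\<lambda>u v. S u * v)"
    using sweedler_antipode_left[OF lin_id] assms by simp
  also have "\<dots> = (\<Sum>b\<in>basis. S b * right_hit (coef b) z)"
    by (rule sweedler_expand) (intro lin)
  also have "\<dots> \<in> left_ideal_gen {right_hit f z | f. form f}"
    by (intro subspace_sum subspace_left_ideal_gen left_ideal_genI) (use form_coef in blast)
  finally show ?thesis .
qed

text \<open>
  Injectivity suffices. If \<open>S h = 0\<close> and \<open>\<Lambda>\<close> is the integral, then \<open>h\<close> annihilates every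
  \<open>f(\<Lambda>1) \<Lambda>2\<close>, since \<open>h\<close> acts on these by composing \<open>f\<close> with multiplication by \<open>S h\<close>. They
  form a left ideal by the same rule, and the left ideal that they generate contains \<open>1\<close>.
\<close>

lemma surj_antipode: "surj S"
proof -
  have coinv: "coinvariant integral h" for h
    by (rule left_coideal_coinvariant[of UNIV])
      (auto simp: left_coideal_def comult_in_tensor_space integral(3))
  have ker: "h = 0" if h: "S h = 0" for h
  proof -
    have "1 \<in> {x. h * x = 0}"
    proof (rule left_ideal_gen_induct[OF one_in_left_ideal_gen_right_hit[OF integral(2)]])
      show "subspace {x. h * x = 0}"
        by (rule subspaceI) (auto simp: distrib_left scale_mult_right)
      fix k x assume "x \<in> {right_hit f integral | f. form f}"
      then obtain f where f: "form f" "x = right_hit f integral" by blast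
      define g where "g = (\<lambda>u. f (S k * u))"
      have g: "form g" unfolding g_def by (intro lin form_comp[OF f(1)])
      have "h * (k * x) = h * right_hit g integral"
        using coinvariant_mult_right_hit[OF coinv f(1), of k] by (simp add: f(2) g_def)
      also have "\<dots> = right_hit (\<lambda>u. g (S h * u)) integral"
        by (rule coinvariant_mult_right_hit[OF coinv g])
      also have "\<dots> = 0"
        by (simp add: lin_toD(4)[OF g] right_hit_def h sweedler_zero)
      finally show "k * x \<in> {x. h * x = 0}" by simp
    qed
    then show ?thesis by simp
  qed
  interpret H: finite_dimensional_vector_space scale basis
    by unfold_locales (use basis in auto)
  interpret S: Vector_Spaces.linear scale scale S by (rule antipode_linear)
  have "inj S"
    using ker by (auto simp: S.inj_iff_eq_0)
  then show ?thesis
    using H.linear_inj_imp_surj antipode_linear by blast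
qed

text \<open>Every element is of the form \<open>S k\<close>, and \<open>x S(k) = S(k1) (ad k2 x)\<close>.\<close>

lemma left_ideal_gen_mult_right:
  assumes N: "ad_stable N" and g: "g \<in> left_ideal_gen N"
  shows "g * k \<in> left_ideal_gen N"
proof -
  have "g \<in> {g. g * k \<in> left_ideal_gen N}"
    using g
  proof (rule left_ideal_gen_induct)
    show "subspace {g. g * k \<in> left_ideal_gen N}"
      by (rule subspaceI)
        (auto simp: distrib_right scale_mult_left subspace_0 subspace_add subspace_scale subspace_left_ideal_gen)
    fix h x assume x: "x \<in> N"
    obtain k' where k: "k = S k'" using surj_antipode by blast
    have "h * x * k = sweedler k' (\<lambda>k1 k2. h * S k1 * ad k2 x)"
      by (simp only: k mult.assoc mult_antipode_eq[of x k'] sweedler_mult_left)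
    also have "\<dots> \<in> left_ideal_gen N"
      using N x by (intro sweedler_in_subspace subspace_left_ideal_gen left_ideal_genI) (simp add: ad_stable_def)
    finally show "h * x \<in> {g. g * k \<in> left_ideal_gen N}" by simp
  qed
  then show ?thesis by simp
qed

lemma left_ideal_gen_mult_left:
  assumes g: "g \<in> left_ideal_gen N"
  shows "k * g \<in> left_ideal_gen N"
proof -
  have "g \<in> {g. k * g \<in> left_ideal_gen N}"
    using g
    by (rule left_ideal_gen_induct, intro subspaceI)
      (auto simp: distrib_left scale_mult_right subspace_0 subspace_add subspace_scale
        subspace_left_ideal_gen left_ideal_genI simp flip: mult.assoc)
  then show ?thesis by simp
qed

text \<open>Since \<open>h \<Lambda> = \<epsilon>(h) \<Lambda>\<close>, the operator \<open>ad \<Lambda>\<close> projects onto the invariants of the adjoint action, which are central.\<close>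

lemma central_ad_integral: "central (ad integral x)"
  unfolding central_def
proof
  fix h
  have "h * ad integral x = sweedler h (\<lambda>h1 h2. ad (h1 * integral) x * h2)"
    by (simp add: mult_eq_ad_mult[of h "ad integral x"] ad_mult_left)
  also have "\<dots> = sweedler h (\<lambda>h1 h2. \<epsilon> h1 *s (ad integral x * h2))"
    by (simp add: integral(3) lin_toD(3)[OF lin_ad_left[OF lin_id]] scale_mult_left)
  also have "\<dots> = ad integral x * h"
    by (rule sweedler_counit_left) (intro lin)
  finally show "h * ad integral x = ad integral x * h" .
qed

end

section \<open>Modules over an adjoint-stable subalgebra\<close>

lemma sum_fun_apply: "(\<Sum>b\<in>B. G b) x = (\<Sum>b\<in>B. G b x)"
  by (induction B rule: infinite_finite_induct) auto

text \<open>
  The setting of the counting argument, whose outcome is \<open>N = 0\<close>. The set \<open>Y\<close> plays the role of an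
  augmentation ideal of \<open>A\<close>, and the last two assumptions make \<open>N = Y N\<close>.
\<close>

locale ad_stable_augmentation = semisimple_hopf_algebra scale comult counit antipode
  for scale :: "'k::field \<Rightarrow> 'h::ring_1 \<Rightarrow> 'h" (infixr \<open>*s\<close> 75)
    and comult (\<open>\<Delta>\<close>) and counit (\<open>\<epsilon>\<close>) and antipode (\<open>S\<close>) +
  fixes A Y N :: "'h set" and p e :: 'h
  assumes A: "ad_stable A" "1 \<in> A" "\<And>a b. a \<in> A \<Longrightarrow> b \<in> A \<Longrightarrow> a * b \<in> A"
    and Y: "ad_stable Y" "Y \<subseteq> A" "\<And>y a. y \<in> Y \<Longrightarrow> a \<in> A \<Longrightarrow> y * a \<in> Y" "1 \<notin> Y"
    and p_central: "central p"
    and p_least: "\<And>L. ad_stable L \<Longrightarrow> L \<subseteq> A \<Longrightarrow> (\<And>y x. y \<in> Y \<Longrightarrow> x \<in> L \<Longrightarrow> y * x \<in> L) \<Longrightarrow>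
      \<not> L \<subseteq> Y \<Longrightarrow> p \<in> L"
    and N: "subspace N" "\<And>h n. n \<in> N \<Longrightarrow> h * n \<in> N"
    and p_N: "\<And>n. n \<in> N \<Longrightarrow> p * n = n"
    and e_N: "\<And>n. n \<in> N \<Longrightarrow> e * n = n"
    and e: "e \<in> span {y * h | y h. y \<in> Y}"
begin

definition tuples :: "'i set \<Rightarrow> ('i \<Rightarrow> 'h) set" where
  "tuples I = {v. (\<forall>i\<in>I. v i \<in> N) \<and> (\<forall>i. i \<notin> I \<longrightarrow> v i = 0)}"

definition generated :: "'i set \<Rightarrow> 'j set \<Rightarrow> bool" where
  "generated I J \<longleftrightarrow> (\<exists>g. (\<forall>j\<in>J. g j \<in> tuples I) \<and>
     (\<forall>v\<in>tuples I. \<exists>a. (\<forall>j\<in>J. a j \<in> A) \<and> v = (\<lambda>i. \<Sum>j\<in>J. a j * g j i)))"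

text \<open>
  On linear maps \<open>\<Psi>\<close> from \<open>H\<close> to tuples, \<open>a\<close> acts by \<open>(a \<Psi>)(x) = (ad x1 a) \<Psi>(x2)\<close> and \<open>h\<close> acts by right
  translation \<open>(h \<Psi>)(x) = \<Psi>(x h)\<close>. This is the module coinduced from \<open>A\<close> to the smash product
  of \<open>A\<close> and \<open>H\<close>. In this form neither action refers to an action of \<open>H\<close> on tuples, which in general
  does not preserve the span of a generating family.
\<close>

definition twist_mult :: "'h \<Rightarrow> ('h \<Rightarrow> 'i \<Rightarrow> 'h) \<Rightarrow> 'h \<Rightarrow> 'i \<Rightarrow> 'h" where
  "twist_mult a \<Psi> = (\<lambda>x i. sweedler x (\<lambda>x1 x2. ad x1 a * \<Psi> x2 i))"

definition pure :: "('h \<Rightarrow> 'k) \<Rightarrow> ('i \<Rightarrow> 'h) \<Rightarrow> 'h \<Rightarrow> 'i \<Rightarrow> 'h" where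
  "pure f v = (\<lambda>x i. f x *s v i)"

definition fscale :: "'k \<Rightarrow> ('h \<Rightarrow> 'i \<Rightarrow> 'h) \<Rightarrow> 'h \<Rightarrow> 'i \<Rightarrow> 'h" where
  "fscale c \<Psi> = (\<lambda>x i. c *s \<Psi> x i)"

lemma A_subspace: "subspace A" and Y_subspace: "subspace Y"
  using A(1) Y(1) by (simp_all add: ad_stable_def)

lemma fun_vector_space: "vector_space fscale"
  by unfold_locales (auto simp: fscale_def fun_eq_iff algebra_simps scale_right_distrib scale_left_distrib)

end

locale augmentation_generators = ad_stable_augmentation scale comult counit antipode A Y N p e
  for scale :: "'k::field \<Rightarrow> 'h::ring_1 \<Rightarrow> 'h" (infixr \<open>*s\<close> 75)
    and comult (\<open>\<Delta>\<close>) and counit (\<open>\<epsilon>\<close>) and antipode (\<open>S\<close>)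
    and A Y N :: "'h set" and p e :: 'h +
  fixes I :: "'i set" and J :: "'j set" and g :: "'j \<Rightarrow> 'i \<Rightarrow> 'h"
  assumes J: "finite J" and g: "\<And>j. j \<in> J \<Longrightarrow> g j \<in> tuples I"
    and gen: "\<And>v. v \<in> tuples I \<Longrightarrow> \<exists>a. (\<forall>j\<in>J. a j \<in> A) \<and> v = (\<lambda>i. \<Sum>j\<in>J. a j * g j i)"
begin

sublocale fn: vector_space "fscale :: 'k \<Rightarrow> ('h \<Rightarrow> 'i \<Rightarrow> 'h) \<Rightarrow> 'h \<Rightarrow> 'i \<Rightarrow> 'h"
  by (rule fun_vector_space)

definition linear_families :: "('h \<Rightarrow> 'i \<Rightarrow> 'h) set" where
  "linear_families = {\<Psi>. (\<forall>x. \<Psi> x \<in> tuples I) \<and> (\<forall>i. lin (\<lambda>x. \<Psi> x i))}"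

text \<open>
  The coordinate function of the integral is the counit. So \<open>F\<close> selects the invariant families
  \<open>\<epsilon> \<otimes> g j\<close> that are still among the generators; they are removed one at a time.
\<close>

definition twisted_span :: "'j set \<Rightarrow> ('h \<Rightarrow> 'i \<Rightarrow> 'h) set" where
  "twisted_span F = fn.span {twist_mult a (pure (coef b) (g j)) | a b j.
     a \<in> A \<and> b \<in> basis \<and> j \<in> J \<and> (b = integral \<longrightarrow> j \<in> F)}"

lemma twisted_spanI:
  "a \<in> A \<Longrightarrow> b \<in> basis \<Longrightarrow> j \<in> J \<Longrightarrow> (b = integral \<Longrightarrow> j \<in> F) \<Longrightarrow>
    twist_mult a (pure (coef b) (g j)) \<in> twisted_span F"
  unfolding twisted_span_def by (rule fn.span_base) blast

lemma subspace_twisted_span: "fn.subspace (twisted_span F)"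
  unfolding twisted_span_def by (rule fn.subspace_span)

lemma twisted_span_induct [consumes 1, case_names subspace base]:
  assumes "\<Phi> \<in> twisted_span F" "fn.subspace V"
    "\<And>a b j. a \<in> A \<Longrightarrow> b \<in> basis \<Longrightarrow> j \<in> J \<Longrightarrow> (b = integral \<Longrightarrow> j \<in> F) \<Longrightarrow>
      twist_mult a (pure (coef b) (g j)) \<in> V"
  shows "\<Phi> \<in> V"
  using assms(1) unfolding twisted_span_def
  by (rule fn.span_subspace_induct[OF _ assms(2)]) (use assms(3) in blast)

lemma twist_mult_add_left: "twist_mult (a + b) \<Psi> = twist_mult a \<Psi> + twist_mult b \<Psi>"
  and twist_mult_scale_left: "twist_mult (c *s a) \<Psi> = fscale c (twist_mult a \<Psi>)"
  and twist_mult_diff_left: "twist_mult (a - b) \<Psi> = twist_mult a \<Psi> - twist_mult b \<Psi>"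
  for \<Psi> :: "'h \<Rightarrow> 'i \<Rightarrow> 'h"
proof -
  note ad = lin_toD[OF lin_ad_right[OF lin_id]]
  show add: "twist_mult (a + b) \<Psi> = twist_mult a \<Psi> + twist_mult b \<Psi>" for a b
    by (simp add: twist_mult_def fun_eq_iff ad distrib_right sweedler_add)
  show "twist_mult (c *s a) \<Psi> = fscale c (twist_mult a \<Psi>)"
    by (simp add: twist_mult_def fun_eq_iff ad fscale_def scale_mult_left sweedler_scale)
  show "twist_mult (a - b) \<Psi> = twist_mult a \<Psi> - twist_mult b \<Psi>"
    using add[of "a - b" b] by simp
qed

lemma twist_mult_add_right: "twist_mult a (\<Psi> + \<Phi>) = twist_mult a \<Psi> + twist_mult a \<Phi>"
  and twist_mult_scale_right: "twist_mult a (fscale c \<Psi>) = fscale c (twist_mult a \<Psi>)"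
  and twist_mult_zero_right: "twist_mult a 0 = 0"
  for \<Psi> \<Phi> :: "'h \<Rightarrow> 'i \<Rightarrow> 'h"
  by (simp_all add: twist_mult_def fun_eq_iff fscale_def distrib_left sweedler_add scale_mult_right
      sweedler_scale sweedler_zero)

lemma twist_mult_one:
  assumes "\<And>i. lin (\<lambda>x. \<Psi> x i)"
  shows "twist_mult 1 \<Psi> = \<Psi>"
proof (intro ext)
  fix x i
  have "twist_mult 1 \<Psi> x i = sweedler x (\<lambda>x1 x2. \<epsilon> x1 *s \<Psi> x2 i)"
    by (simp add: twist_mult_def ad_one_right scale_mult_left)
  also have "\<dots> = \<Psi> x i"
    by (rule sweedler_counit_left[OF assms])
  finally show "twist_mult 1 \<Psi> x i = \<Psi> x i" .
qed

lemma twist_mult_assoc: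
  assumes \<Psi>: "\<And>i. lin (\<lambda>x. \<Psi> x i)"
  shows "twist_mult a (twist_mult b \<Psi>) = twist_mult (a * b) \<Psi>"
proof (intro ext)
  fix x i
  note l = lin lin_comp[OF \<Psi>]
  have "twist_mult a (twist_mult b \<Psi>) x i =
      sweedler x (\<lambda>x1 w. sweedler w (\<lambda>x2 x3. ad x1 a * ad x2 b * \<Psi> x3 i))"
    by (simp add: twist_mult_def sweedler_mult_left mult.assoc)
  also have "\<dots> = sweedler x (\<lambda>w x3. sweedler w (\<lambda>x1 x2. ad x1 a * ad x2 b * \<Psi> x3 i))"
    by (rule sweedler_coassoc[where s = scale, symmetric]; intro l)
  also have "\<dots> = twist_mult (a * b) \<Psi> x i"
    by (simp add: twist_mult_def ad_mult_right sweedler_mult_right)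
  finally show "twist_mult a (twist_mult b \<Psi>) x i = twist_mult (a * b) \<Psi> x i" .
qed

lemma lin_pure: "form f \<Longrightarrow> lin (\<lambda>x. pure f v x i)"
  unfolding pure_def by (intro lin)

lemma tuples_closed:
  "0 \<in> tuples I" "v \<in> tuples I \<Longrightarrow> w \<in> tuples I \<Longrightarrow> (\<lambda>i. v i + w i) \<in> tuples I"
  "v \<in> tuples I \<Longrightarrow> (\<lambda>i. c *s v i) \<in> tuples I"
  "v \<in> tuples I \<Longrightarrow> (\<lambda>i. h * v i) \<in> tuples I"
  using N by (auto simp: tuples_def subspace_0 subspace_add subspace_scale)

lemma pure_linear_families: "form f \<Longrightarrow> v \<in> tuples I \<Longrightarrow> pure f v \<in> linear_families"
  by (auto simp: linear_families_def lin_pure) (simp add: pure_def tuples_closed)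

lemma twist_mult_mult_closed:
  assumes "\<Phi> \<in> twisted_span F" "a \<in> A"
  shows "twist_mult a \<Phi> \<in> twisted_span F"
proof -
  have "\<Phi> \<in> {\<Phi>. twist_mult a \<Phi> \<in> twisted_span F}"
    using assms(1)
  proof (rule twisted_span_induct)
    show "fn.subspace {\<Phi>. twist_mult a \<Phi> \<in> twisted_span F}"
      using subspace_twisted_span[of F]
      by (intro fn.subspaceI)
        (simp_all add: twist_mult_add_right twist_mult_scale_right twist_mult_zero_right fn.subspace_0 fn.subspace_add fn.subspace_scale)
    show "twist_mult b (pure (coef c) (g j)) \<in> {\<Phi>. twist_mult a \<Phi> \<in> twisted_span F}"
      if "b \<in> A" "c \<in> basis" "j \<in> J" "c = integral \<Longrightarrow> j \<in> F" for b c j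
      using that assms(2) by (simp add: twist_mult_assoc lin_pure form_coef twisted_spanI A(3))
  qed
  then show ?thesis by simp
qed

lemma pure_expand:
  assumes f: "form f"
  shows "twist_mult a (pure f v) = (\<Sum>b\<in>basis. fscale (f b) (twist_mult a (pure (coef b) v)))"
proof (intro ext)
  fix x i
  have "twist_mult a (pure f v) x i = sweedler x (\<lambda>x1 x2. \<Sum>b\<in>basis. f b *s (ad x1 a * (coef b x2 *s v i)))"
    unfolding twist_mult_def pure_def
    by (subst lin_expand[OF f]) (simp add: scale_sum_left scale_mult_right sum_distrib_left mult.commute)
  also have "\<dots> = (\<Sum>b\<in>basis. fscale (f b) (twist_mult a (pure (coef b) v))) x i"
    by (simp add: sweedler_sum sweedler_scale fscale_def twist_mult_def pure_def sum_fun_apply)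
  finally show "twist_mult a (pure f v) x i = (\<Sum>b\<in>basis. fscale (f b) (twist_mult a (pure (coef b) v))) x i" .
qed

text \<open>
  For \<open>b\<close> different from the integral \<open>\<Lambda>\<close>, translation of \<open>coef b\<close> stays within the span of the coordinate functions that vanish on
  \<open>\<Lambda>\<close>, because \<open>coef b (\<Lambda> h) = \<epsilon>(h) coef b \<Lambda>\<close>; and translation fixes \<open>\<epsilon>\<close> up to a
  scalar.
\<close>

lemma twisted_span_translate:
  assumes "\<Phi> \<in> twisted_span F"
  shows "(\<lambda>x. \<Phi> (x * h)) \<in> twisted_span F"
proof -
  have "\<Phi> \<in> {\<Phi>. (\<lambda>x. \<Phi> (x * h)) \<in> twisted_span F}"
    using assms
  proof (rule twisted_span_induct)
    have "(\<lambda>x. (\<Phi> + \<Psi>) (x * h)) = (\<lambda>x. \<Phi> (x * h)) + (\<lambda>x. \<Psi> (x * h))"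
      "(\<lambda>x. fscale c \<Phi> (x * h)) = fscale c (\<lambda>x. \<Phi> (x * h))"
      for \<Phi> \<Psi> :: "'h \<Rightarrow> 'i \<Rightarrow> 'h" and c
      by (auto simp: fscale_def)
    then show "fn.subspace {\<Phi>. (\<lambda>x. \<Phi> (x * h)) \<in> twisted_span F}"
      using subspace_twisted_span[of F]
      by (intro fn.subspaceI)
        (simp_all add: fn.subspace_0[unfolded zero_fun_def] fn.subspace_add fn.subspace_scale zero_fun_def)
    fix a b j assume that: "a \<in> A" "b \<in> basis" "j \<in> J" "b = integral \<Longrightarrow> j \<in> F"
    have "(\<lambda>x. twist_mult a (pure (coef b) (g j)) (x * h)) =
        sweedler h (\<lambda>h1 h2. twist_mult (ad h1 a) (pure (\<lambda>y. coef b (y * h2)) (g j)))"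
    proof (intro ext)
      fix x i
      have "twist_mult a (pure (coef b) (g j)) (x * h) i = sweedler x (\<lambda>x1 x2. sweedler h (\<lambda>h1 h2.
          ad (x1 * h1) a * (coef b (x2 * h2) *s g j i)))"
        unfolding twist_mult_def pure_def by (rule sweedler_mult[where s = scale]) (intro lin)
      also have "\<dots> = sweedler h (\<lambda>h1 h2. twist_mult (ad h1 a) (pure (\<lambda>y. coef b (y * h2)) (g j))) x i"
        unfolding twist_mult_def pure_def ad_mult_left by (subst sweedler_swap) (simp add: sweedler_apply)
      finally show "twist_mult a (pure (coef b) (g j)) (x * h) i =
          sweedler h (\<lambda>h1 h2. twist_mult (ad h1 a) (pure (\<lambda>y. coef b (y * h2)) (g j))) x i" .
    qed
    also have "\<dots> \<in> twisted_span F"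
    proof (rule sweedler_in_any_subspace[OF fn.vector_space_axioms subspace_twisted_span])
      fix h1 h2
      have "twist_mult (ad h1 a) (pure (\<lambda>y. coef b (y * h2)) (g j)) =
          (\<Sum>b'\<in>basis. fscale (coef b (b' * h2)) (twist_mult (ad h1 a) (pure (coef b') (g j))))"
        by (rule pure_expand) (intro lin)
      also have "\<dots> \<in> twisted_span F"
      proof (rule fn.subspace_sum[OF subspace_twisted_span])
        fix b' assume b': "b' \<in> basis"
        have a: "ad h1 a \<in> A" using that(1) A(1) by (simp add: ad_stable_def)
        show "fscale (coef b (b' * h2)) (twist_mult (ad h1 a) (pure (coef b') (g j))) \<in> twisted_span F"
        proof (cases "b' = integral \<and> b \<noteq> integral")
          case True
          then have "coef b (b' * h2) = 0"
            using basis(4) by (simp add: integral(4) lin_toD(3)[OF form_coef] coef_basis)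
          then show ?thesis
            by (simp add: fn.subspace_0[OF subspace_twisted_span])
        next
          case False
          then show ?thesis
            using that a b' by (intro fn.subspace_scale[OF subspace_twisted_span] twisted_spanI) auto
        qed
      qed
      finally show "twist_mult (ad h1 a) (pure (\<lambda>y. coef b (y * h2)) (g j)) \<in> twisted_span F" .
    qed
    finally show "twist_mult a (pure (coef b) (g j)) \<in> {\<Phi>. (\<lambda>x. \<Phi> (x * h)) \<in> twisted_span F}" by simp
  qed
  then show ?thesis by simp
qed

text \<open>
  Pointwise multiples \<open>f \<otimes> a v\<close> are combinations of twisted multiples \<open>c (f' \<otimes> v)\<close>: write \<open>f(x) a\<close> as
  \<open>(ad x1 (ad (S x2) a)) f(x3)\<close> and expand \<open>ad (S x2) a\<close> in a basis of \<open>V\<close>, with coefficients that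
  depend linearly on \<open>x2\<close>.
\<close>

lemma pure_mult_in_span:
  assumes V: "ad_stable V" and a: "a \<in> V" and f: "form f"
  shows "(\<lambda>x i. f x *s (a * v i)) \<in> fn.span {twist_mult c (pure f' v) | c f'. c \<in> V \<and> form f'}"
proof -
  obtain C where C: "C \<subseteq> V" "independent C" "V \<subseteq> span C"
    using basis_exists[of V] by metis
  have fin: "finite C"
    using independent_span_bound[OF basis(1) C(2)] basis(3) by simp
  define r where "r c x = representation C (ad (S x) a) c" for c x
  have in_span: "ad h a \<in> span C" for h
    using V a C(3) by (auto simp: ad_stable_def)
  have r: "form (r c)" for c
    unfolding r_def
    by (rule lin_toI[OF vector_space_field])
      (use C(2) in \<open>auto simp: representation_add representation_scale in_span
        lin_toD[OF lin_ad_left[OF lin_antipode[OF lin_id]]]\<close>)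
  have ad_r: "ad (S x) a = (\<Sum>c\<in>C. r c x *s c)" for x
    unfolding r_def by (rule sum_representation_eq[symmetric]) (use C fin in_span in auto)
  note l = lin form_comp[OF f] form_comp[OF r]
  have "(\<lambda>x i. f x *s (a * v i)) =
      (\<Sum>c\<in>C. twist_mult c (pure (\<lambda>y. sweedler y (\<lambda>y1 y2. r c y1 * f y2)) v))"
  proof (intro ext)
    fix x i
    have "f x *s (a * v i) = sweedler x (\<lambda>w x3. \<epsilon> w *s (f x3 *s (a * v i)))"
      by (rule sweedler_counit_left[symmetric]) (intro l f)
    also have "\<dots> = sweedler x (\<lambda>w x3. sweedler w (\<lambda>x1 x2. ad x1 (ad (S x2) a) * (f x3 *s v i)))"
      unfolding sweedler_mult_right[symmetric] ad_antipode_cancel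
      by (simp add: scale_mult_left scale_mult_right mult.commute)
    also have "\<dots> = sweedler x (\<lambda>x1 w. sweedler w (\<lambda>x2 x3. ad x1 (ad (S x2) a) * (f x3 *s v i)))"
      by (rule sweedler_coassoc[where s = scale]; intro l f)
    also have "\<dots> = sweedler x (\<lambda>x1 w. sweedler w (\<lambda>x2 x3.
        \<Sum>c\<in>C. (r c x2 * f x3) *s (ad x1 c * v i)))"
      unfolding ad_r lin_toD(6)[OF lin_ad_right[OF lin_id]]
      by (simp add: lin_toD(3)[OF lin_ad_right[OF lin_id]] sum_distrib_right scale_mult_left
          scale_mult_right scale_sum_right mult.commute)
    also have "\<dots> = (\<Sum>c\<in>C. sweedler x (\<lambda>x1 w. sweedler w (\<lambda>x2 x3. (r c x2 * f x3) *s (ad x1 c * v i))))"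
      by (simp add: sweedler_sum)
    also have "\<dots> = (\<Sum>c\<in>C. twist_mult c (pure (\<lambda>y. sweedler y (\<lambda>y1 y2. r c y1 * f y2)) v)) x i"
    proof -
      have "sweedler w (\<lambda>x2 x3. (r c x2 * f x3) *s y) = sweedler w (\<lambda>y1 y2. r c y1 * f y2) *s y"
        for w c y
        by (rule sweedler_linear[where \<phi> = "\<lambda>t. t *s y" and s = "(*)" and t = scale, symmetric])
          (rule linear_scale_left)
      then show ?thesis
        by (simp add: twist_mult_def pure_def sum_fun_apply scale_mult_right)
    qed
    finally show "f x *s (a * v i) =
      (\<Sum>c\<in>C. twist_mult c (pure (\<lambda>y. sweedler y (\<lambda>y1 y2. r c y1 * f y2)) v)) x i" .
  qed
  also have "\<dots> \<in> fn.span {twist_mult c (pure f' v) | c f'. c \<in> V \<and> form f'}"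
  proof (rule fn.span_sum, rule fn.span_base)
    fix c assume "c \<in> C"
    moreover have "form (\<lambda>y. sweedler y (\<lambda>y1 y2. r c y1 * f y2))"
      by (intro l f r)
    ultimately show "twist_mult c (pure (\<lambda>y. sweedler y (\<lambda>y1 y2. r c y1 * f y2)) v)
        \<in> {twist_mult c (pure f' v) | c f'. c \<in> V \<and> form f'}"
      using C(1) by blast
  qed
  finally show ?thesis .
qed

lemma subspace_mod_twisted_span:
  fixes \<Psi> :: "'h \<Rightarrow> 'i \<Rightarrow> 'h"
  assumes V: "subspace V"
  shows "fn.subspace {\<Phi>. \<exists>a\<in>V. \<Phi> - twist_mult a \<Psi> \<in> twisted_span F}"
proof (rule fn.subspaceI)
  note sub = subspace_twisted_span[of F]
  have "0 - twist_mult 0 \<Psi> = 0" using twist_mult_diff_left[of 0 0 \<Psi>] by simp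
  then have "0 - twist_mult 0 \<Psi> \<in> twisted_span F" using fn.subspace_0[OF sub] by (simp only:)
  then show "0 \<in> {\<Phi>. \<exists>a\<in>V. \<Phi> - twist_mult a \<Psi> \<in> twisted_span F}"
    using subspace_0[OF V] by blast
  show "\<Phi> + \<Phi>' \<in> {\<Phi>. \<exists>a\<in>V. \<Phi> - twist_mult a \<Psi> \<in> twisted_span F}"
    if "\<Phi> \<in> {\<Phi>. \<exists>a\<in>V. \<Phi> - twist_mult a \<Psi> \<in> twisted_span F}"
      "\<Phi>' \<in> {\<Phi>. \<exists>a\<in>V. \<Phi> - twist_mult a \<Psi> \<in> twisted_span F}" for \<Phi> \<Phi>'
  proof -
    from that obtain a b where ab: "a \<in> V" "b \<in> V" "\<Phi> - twist_mult a \<Psi> \<in> twisted_span F"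
      "\<Phi>' - twist_mult b \<Psi> \<in> twisted_span F" by blast
    have "(\<Phi> + \<Phi>') - twist_mult (a + b) \<Psi> = (\<Phi> - twist_mult a \<Psi>) + (\<Phi>' - twist_mult b \<Psi>)"
      by (simp add: twist_mult_add_left)
    then have "(\<Phi> + \<Phi>') - twist_mult (a + b) \<Psi> \<in> twisted_span F"
      using fn.subspace_add[OF sub ab(3,4)] by (simp only:)
    then show ?thesis
      using subspace_add[OF V ab(1,2)] by blast
  qed
  show "fscale c \<Phi> \<in> {\<Phi>. \<exists>a\<in>V. \<Phi> - twist_mult a \<Psi> \<in> twisted_span F}"
    if "\<Phi> \<in> {\<Phi>. \<exists>a\<in>V. \<Phi> - twist_mult a \<Psi> \<in> twisted_span F}" for c \<Phi>
  proof -
    from that obtain a where a: "a \<in> V" "\<Phi> - twist_mult a \<Psi> \<in> twisted_span F" by blast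
    have "fscale c \<Phi> - twist_mult (c *s a) \<Psi> \<in> twisted_span F"
      using fn.subspace_scale[OF sub a(2), of c] by (simp add: twist_mult_scale_left fn.scale_right_diff_distrib)
    then show ?thesis
      using subspace_scale[OF V a(1)] by blast
  qed
qed

text \<open>The module of linear families inherits \<open>N = Y N\<close>.\<close>

lemma pure_in_span_augmentation:
  assumes f: "form f" and v: "v \<in> tuples I"
  shows "pure f v \<in> fn.span {twist_mult y (pure f' w) | y f' w. y \<in> Y \<and> form f' \<and> w \<in> tuples I}"
    (is "_ \<in> ?Z")
proof -
  have sub_Z: "fn.subspace ?Z" by (rule fn.subspace_span)
  have "e \<in> {t. (\<lambda>x i. f x *s (t * v i)) \<in> ?Z}"
    using e
  proof (rule span_subspace_induct)
    show "subspace {t. (\<lambda>x i. f x *s (t * v i)) \<in> ?Z}"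
    proof (rule subspaceI)
      have "(\<lambda>x i. f x *s (0 * v i)) = 0"
        by (simp add: fun_eq_iff)
      then show "0 \<in> {t. (\<lambda>x i. f x *s (t * v i)) \<in> ?Z}"
        unfolding mem_Collect_eq by (rule ssubst) (rule fn.subspace_0[OF sub_Z])
      show "s + t \<in> {t. (\<lambda>x i. f x *s (t * v i)) \<in> ?Z}"
        if "s \<in> {t. (\<lambda>x i. f x *s (t * v i)) \<in> ?Z}" "t \<in> {t. (\<lambda>x i. f x *s (t * v i)) \<in> ?Z}" for s t
      proof -
        have "(\<lambda>x i. f x *s ((s + t) * v i)) = (\<lambda>x i. f x *s (s * v i)) + (\<lambda>x i. f x *s (t * v i))"
          by (simp add: fun_eq_iff distrib_right scale_right_distrib)
        then show ?thesis using fn.subspace_add[OF sub_Z] that unfolding mem_Collect_eq by (simp only:)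
      qed
      show "c *s t \<in> {t. (\<lambda>x i. f x *s (t * v i)) \<in> ?Z}"
        if "t \<in> {t. (\<lambda>x i. f x *s (t * v i)) \<in> ?Z}" for c t
      proof -
        have "(\<lambda>x i. f x *s ((c *s t) * v i)) = fscale c (\<lambda>x i. f x *s (t * v i))"
          by (simp add: fscale_def scale_mult_left mult.commute)
        then show ?thesis using fn.subspace_scale[OF sub_Z, of _ c] that unfolding mem_Collect_eq by (simp only:)
      qed
    qed
    fix t assume "t \<in> {y * h | y h. y \<in> Y}"
    then obtain y h where t: "t = y * h" "y \<in> Y" by blast
    have "(\<lambda>x i. f x *s (y * (h * v i))) \<in>
        fn.span {twist_mult c (pure f' (\<lambda>i. h * v i)) | c f'. c \<in> Y \<and> form f'}"
      by (rule pure_mult_in_span[OF Y(1) t(2) f])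
    also have "\<dots> \<subseteq> ?Z"
      using tuples_closed(4)[OF v] by (intro fn.span_mono) blast
    finally show "t \<in> {t. (\<lambda>x i. f x *s (t * v i)) \<in> ?Z}"
      by (simp add: t(1) mult.assoc)
  qed
  moreover have "e * v i = v i" for i
    using v e_N by (cases "i \<in> I") (auto simp: tuples_def)
  ultimately show ?thesis by (simp add: pure_def)
qed

lemma twist_mult_pure_counit: "twist_mult a (pure \<epsilon> v) = (\<lambda>x i. ad x a * v i)" for v :: "'i \<Rightarrow> 'h"
proof (intro ext)
  fix x i
  have "twist_mult a (pure \<epsilon> v) x i = sweedler x (\<lambda>x1 x2. \<epsilon> x2 *s (ad x1 a * v i))"
    by (simp add: twist_mult_def pure_def scale_mult_right)
  also have "\<dots> = ad x a * v i"
    by (rule sweedler_counit_right) (intro lin)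
  finally show "twist_mult a (pure \<epsilon> v) x i = ad x a * v i" .
qed

text \<open>
  The elements \<open>a\<close> of \<open>A\<close> that move \<open>G = \<epsilon> \<otimes> g j\<close> into the submodule generated by the remaining
  families form a left ideal, which is \<open>ad\<close>-stable as \<open>G\<close> is invariant under \<open>H\<close>. Modulo that
  submodule, \<open>G\<close> generates the module \<open>X\<close> of all linear families. Since \<open>X = Y X\<close>, it follows that
  \<open>G\<close> is congruent to \<open>y G\<close> for some \<open>y \<in> Y\<close>. So the left ideal contains \<open>1 - y\<close>, hence it is not
  contained in \<open>Y\<close> and contains \<open>p\<close>; but \<open>p G = G\<close>.
\<close>

lemma twisted_span_remove:
  assumes j: "j \<in> J" and full: "linear_families \<subseteq> twisted_span (insert j F)"
  shows "linear_families \<subseteq> twisted_span F"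
proof -
  define G where "G = pure \<epsilon> (g j)"
  have \<epsilon>: "coef integral = \<epsilon>" by (rule ext) (rule coef_integral)
  note sub = subspace_twisted_span[of F]
  have lin_G: "lin (\<lambda>x. G x i)" for i unfolding G_def by (rule lin_pure[OF counit_linear])
  have zero: "\<Phi> - twist_mult 0 G = \<Phi>" for \<Phi> using twist_mult_diff_left[of 0 0 G] by simp
  have decompose: "\<exists>a\<in>A. \<Phi> - twist_mult a G \<in> twisted_span F" if "\<Phi> \<in> twisted_span (insert j F)" for \<Phi>
  proof -
    have "\<Phi> \<in> {\<Phi>. \<exists>a\<in>A. \<Phi> - twist_mult a G \<in> twisted_span F}"
      using that
    proof (rule twisted_span_induct)
      show "fn.subspace {\<Phi>. \<exists>a\<in>A. \<Phi> - twist_mult a G \<in> twisted_span F}"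
        by (rule subspace_mod_twisted_span[OF A_subspace])
      fix a b j' assume *: "a \<in> A" "b \<in> basis" "j' \<in> J" "b = integral \<Longrightarrow> j' \<in> insert j F"
      have "\<exists>a'\<in>A. twist_mult a (pure (coef b) (g j')) - twist_mult a' G \<in> twisted_span F"
      proof (cases "b = integral \<and> j' = j")
        case True
        then have "twist_mult a (pure (coef b) (g j')) - twist_mult a G = 0" by (simp add: \<epsilon> G_def)
        then show ?thesis
          using *(1) fn.subspace_0[OF sub] by (intro bexI[of _ a]) simp_all
      next
        case False
        then have "twist_mult a (pure (coef b) (g j')) \<in> twisted_span F"
          using * by (intro twisted_spanI) auto
        then show ?thesis
          using subspace_0[OF A_subspace] by (intro bexI[of _ 0]) (simp_all only: zero)
      qed
      then show "twist_mult a (pure (coef b) (g j')) \<in> {\<Phi>. \<exists>a\<in>A. \<Phi> - twist_mult a G \<in> twisted_span F}" by simp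
    qed
    then show ?thesis by simp
  qed
  have "G \<in> {\<Phi>. \<exists>y\<in>Y. \<Phi> - twist_mult y G \<in> twisted_span F}"
    unfolding G_def
    using pure_in_span_augmentation[OF counit_linear g[OF j]]
  proof (rule fn.span_subspace_induct, fold G_def)
    show "fn.subspace {\<Phi>. \<exists>y\<in>Y. \<Phi> - twist_mult y G \<in> twisted_span F}"
      by (rule subspace_mod_twisted_span[OF Y_subspace])
    fix \<Phi> assume "\<Phi> \<in> {twist_mult y (pure f v) | y f v. y \<in> Y \<and> form f \<and> v \<in> tuples I}"
    then obtain y f v where \<Phi>: "\<Phi> = twist_mult y (pure f v)" "y \<in> Y" "form f" "v \<in> tuples I" by blast
    obtain a where a: "a \<in> A" "pure f v - twist_mult a G \<in> twisted_span F"
      using decompose[of "pure f v"] subsetD[OF full pure_linear_families[OF \<Phi>(3,4)]] by blast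
    have "\<Phi> = twist_mult y (pure f v - twist_mult a G) + twist_mult y (twist_mult a G)"
      using twist_mult_add_right[of y "pure f v - twist_mult a G" "twist_mult a G"] \<Phi>(1) by simp
    then have "\<Phi> - twist_mult (y * a) G = twist_mult y (pure f v - twist_mult a G)"
      by (simp add: twist_mult_assoc[OF lin_G])
    also have "\<dots> \<in> twisted_span F"
      using twist_mult_mult_closed[OF a(2)] \<Phi>(2) Y(2) by blast
    finally show "\<Phi> \<in> {\<Phi>. \<exists>y\<in>Y. \<Phi> - twist_mult y G \<in> twisted_span F}"
      using Y(3)[OF \<Phi>(2) a(1)] by blast
  qed
  then obtain y where y: "y \<in> Y" "G - twist_mult y G \<in> twisted_span F" by blast
  define L where "L = {a \<in> A. twist_mult a G \<in> twisted_span F}"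
  have "p \<in> L"
  proof (rule p_least)
    have "ad h a \<in> L" if "a \<in> L" for h a
    proof -
      have "twist_mult (ad h a) G = (\<lambda>x. twist_mult a G (x * h))"
        by (simp add: twist_mult_pure_counit G_def ad_mult_left)
      then show ?thesis
        using that twisted_span_translate[of "twist_mult a G" F h] A(1) by (simp add: L_def ad_stable_def)
    qed
    moreover have "subspace L"
    proof (rule subspaceI)
      have "twist_mult 0 G = 0" using twist_mult_diff_left[of 0 0 G] by simp
      then show "0 \<in> L" using fn.subspace_0[OF sub] subspace_0[OF A_subspace] by (simp add: L_def)
      show "x + z \<in> L" if "x \<in> L" "z \<in> L" for x z
        using that by (simp add: L_def twist_mult_add_left subspace_add[OF A_subspace] fn.subspace_add[OF sub])
      show "c *s x \<in> L" if "x \<in> L" for c x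
        using that by (simp add: L_def twist_mult_scale_left subspace_scale[OF A_subspace] fn.subspace_scale[OF sub])
    qed
    ultimately show "ad_stable L" by (simp add: ad_stable_def)
    show "L \<subseteq> A" by (auto simp: L_def)
    show "y * x \<in> L" if "y \<in> Y" "x \<in> L" for y x
    proof -
      have "twist_mult (y * x) G = twist_mult y (twist_mult x G)" by (simp add: twist_mult_assoc[OF lin_G])
      moreover have "y \<in> A" using that(1) Y(2) by blast
      ultimately show ?thesis
        using that(2) A(3) twist_mult_mult_closed[of "twist_mult x G" F y] by (simp add: L_def)
    qed
    have "y \<in> A" using y(1) Y(2) by blast
    then have "1 - y \<in> L"
      using y(2) A(2) subspace_diff[OF A_subspace, of 1 y]
      by (simp add: L_def twist_mult_diff_left twist_mult_one[OF lin_G])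
    moreover have "1 - y \<notin> Y"
      using subspace_add[OF Y_subspace, of "1 - y" y] y(1) Y(4) by auto
    ultimately show "\<not> L \<subseteq> Y" by blast
  qed
  then have "twist_mult p G \<in> twisted_span F" by (simp add: L_def)
  moreover have "twist_mult p G = G"
  proof -
    have "p * g j i = g j i" for i
      using g[OF j] p_N by (cases "i \<in> I") (auto simp: tuples_def)
    then show ?thesis
      unfolding G_def twist_mult_pure_counit
      unfolding ad_central[OF p_central] pure_def scale_mult_left by (simp only:)
  qed
  ultimately have G_in: "G \<in> twisted_span F" by simp
  show ?thesis
  proof
    fix \<Psi> assume "\<Psi> \<in> linear_families"
    then have "\<Psi> \<in> twisted_span (insert j F)" by (rule subsetD[OF full])
    from decompose[OF this] obtain a where a: "a \<in> A" "\<Psi> - twist_mult a G \<in> twisted_span F" ..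
    show "\<Psi> \<in> twisted_span F"
      using fn.subspace_add[OF sub a(2) twist_mult_mult_closed[OF G_in a(1)]]
      unfolding diff_add_cancel .
  qed
qed

lemma linear_families_full: "linear_families \<subseteq> twisted_span J"
proof
  fix \<Psi> assume \<Psi>: "\<Psi> \<in> linear_families"
  have elem: "(\<lambda>x i. f x *s (a * g j i)) \<in> twisted_span J" if f: "form f" "a \<in> A" "j \<in> J" for f a j
  proof -
    have "fn.span {twist_mult c (pure f' (g j)) | c f'. c \<in> A \<and> form f'} \<subseteq> twisted_span J"
    proof (rule fn.span_minimal[OF _ subspace_twisted_span], clarify)
      fix c f' assume c: "c \<in> A" "form f'"
      show "twist_mult c (pure f' (g j)) \<in> twisted_span J"
        unfolding pure_expand[OF c(2)]
        using c(1) that(3) by (intro fn.subspace_sum[OF subspace_twisted_span]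
            fn.subspace_scale[OF subspace_twisted_span] twisted_spanI)
    qed
    then show ?thesis
      using pure_mult_in_span[OF A(1) that(2,1)] by blast
  qed
  have "\<forall>b. \<exists>a. (\<forall>j\<in>J. a j \<in> A) \<and> \<Psi> b = (\<lambda>i. \<Sum>j\<in>J. a j * g j i)"
    using gen \<Psi> by (simp add: linear_families_def)
  then obtain a where a: "\<And>b j. j \<in> J \<Longrightarrow> a b j \<in> A" "\<And>b. \<Psi> b = (\<lambda>i. \<Sum>j\<in>J. a b j * g j i)"
    by metis
  have "\<Psi> = (\<Sum>b\<in>basis. \<Sum>j\<in>J. (\<lambda>x i. coef b x *s (a b j * g j i)))"
  proof (intro ext)
    fix x i
    have "\<Psi> x i = (\<Sum>b\<in>basis. coef b x *s \<Psi> b i)"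
      using \<Psi> by (intro lin_expand) (simp add: linear_families_def)
    also have "\<dots> = (\<Sum>b\<in>basis. \<Sum>j\<in>J. (\<lambda>x i. coef b x *s (a b j * g j i))) x i"
      by (simp add: a(2) sum_fun_apply scale_sum_right)
    finally show "\<Psi> x i = (\<Sum>b\<in>basis. \<Sum>j\<in>J. (\<lambda>x i. coef b x *s (a b j * g j i))) x i" .
  qed
  also have "\<dots> \<in> twisted_span J"
    by (intro fn.subspace_sum[OF subspace_twisted_span] elem form_coef a)
  finally show "\<Psi> \<in> twisted_span J" .
qed

text \<open>The families \<open>coef b \<otimes> g j\<close> with \<open>b \<noteq> \<Lambda>\<close> generate. They are only \<open>dim H - 1\<close> times as many as the tuples \<open>g j\<close>.\<close>

lemma linear_families_reduced: "linear_families \<subseteq> twisted_span {}"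
proof -
  have "linear_families \<subseteq> twisted_span (J - F)" if "finite F" "F \<subseteq> J" for F
    using that
  proof (induction F rule: finite_induct)
    case empty
    show ?case using linear_families_full by simp
  next
    case (insert j F)
    have eq: "insert j (J - insert j F) = J - F" using insert.prems insert.hyps(2) by blast
    have "F \<subseteq> J" "j \<in> J" using insert.prems by blast+
    then show ?case
      using insert.IH[OF \<open>F \<subseteq> J\<close>] by (simp only: eq twisted_span_remove[of j "J - insert j F", OF \<open>j \<in> J\<close>])
  qed
  from this[OF J] show ?thesis by simp
qed

text \<open>The action of \<open>H\<close> on tuples transforms the twisted action of \<open>A\<close> into the pointwise one.\<close>

definition untwist :: "('h \<Rightarrow> 'i \<Rightarrow> 'h) \<Rightarrow> 'h \<Rightarrow> 'i \<Rightarrow> 'h" where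
  "untwist \<Psi> = (\<lambda>x i. sweedler x (\<lambda>x1 x2. S x1 * \<Psi> x2 i))"

lemma untwist_twisted:
  assumes \<Psi>: "\<And>i. lin (\<lambda>x. \<Psi> x i)"
  shows "untwist (twist_mult a \<Psi>) x i = a * untwist \<Psi> x i"
proof -
  note l = lin lin_comp[OF \<Psi>]
  have "untwist (twist_mult a \<Psi>) x i =
      sweedler x (\<lambda>x1 w. sweedler w (\<lambda>x2 x3. S x1 * ad x2 a * \<Psi> x3 i))"
    by (simp add: untwist_def twist_mult_def sweedler_mult_left mult.assoc)
  also have "\<dots> = sweedler x (\<lambda>w x3. sweedler w (\<lambda>x1 x2. S x1 * ad x2 a * \<Psi> x3 i))"
    by (rule sweedler_coassoc[where s = scale, symmetric]; intro l)
  also have "\<dots> = sweedler x (\<lambda>w x3. a * S w * \<Psi> x3 i)"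
    unfolding mult_antipode_eq[of a] sweedler_mult_right ..
  finally show ?thesis
    by (simp add: untwist_def sweedler_mult_left mult.assoc)
qed

lemma untwist_in_tuples:
  assumes "\<And>x. \<Psi> x \<in> tuples I"
  shows "untwist \<Psi> x \<in> tuples I"
proof -
  have "untwist \<Psi> x i \<in> N" if "i \<in> I" for i
    unfolding untwist_def using assms that N(2)
    by (intro sweedler_in_subspace[OF N(1)]) (simp add: tuples_def)
  moreover have "untwist \<Psi> x i = 0" if "i \<notin> I" for i
  proof -
    have "\<Psi> x i = 0" for x using assms[of x] that by (simp add: tuples_def)
    then show ?thesis by (simp add: untwist_def sweedler_zero)
  qed
  ultimately show ?thesis by (simp add: tuples_def)
qed

lemma linear_families_generated:
  assumes \<Psi>: "\<Psi> \<in> linear_families"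
  shows "\<exists>\<alpha>. (\<forall>q. \<alpha> q \<in> A) \<and> (\<forall>x i. \<Psi> x i =
    (\<Sum>q\<in>(basis - {integral}) \<times> J. \<alpha> q * untwist (pure (coef (fst q)) (g (snd q))) x i))"
proof -
  let ?Q = "(basis - {integral}) \<times> J"
  let ?G = "\<lambda>q. untwist (pure (coef (fst q)) (g (snd q)))"
  define V where "V = {\<Phi>. \<exists>\<alpha>. (\<forall>q. \<alpha> q \<in> A) \<and> (\<forall>x i. untwist \<Phi> x i = (\<Sum>q\<in>?Q. \<alpha> q * ?G q x i))}"
  have lin_\<Psi>: "lin (\<lambda>x. \<Psi> x i)" for i using \<Psi> by (simp add: linear_families_def)
  note l = lin lin_comp[OF lin_\<Psi>]
  define \<Phi> where "\<Phi> = (\<lambda>x i. sweedler x (\<lambda>x1 x2. x1 * \<Psi> x2 i))"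
  \<comment> \<open>\<open>\<Phi>\<close> is the inverse transform of \<open>\<Psi>\<close>, so that generators of the twisted module can be applied to it.\<close>
  have "\<Phi> \<in> linear_families"
  proof -
    have "\<Phi> x i \<in> N" if "i \<in> I" for x i
      unfolding \<Phi>_def using \<Psi> that N(2)
      by (intro sweedler_in_subspace[OF N(1)]) (simp add: tuples_def linear_families_def)
    moreover have "\<Phi> x i = 0" if "i \<notin> I" for x i
    proof -
      have "\<Psi> x i = 0" for x using \<Psi> that by (simp add: tuples_def linear_families_def)
      then show ?thesis by (simp add: \<Phi>_def sweedler_zero)
    qed
    moreover have "lin (\<lambda>x. \<Phi> x i)" for i
      unfolding \<Phi>_def by (intro l)
    ultimately show ?thesis by (simp add: tuples_def linear_families_def)
  qed
  then have "\<Phi> \<in> twisted_span {}" by (rule subsetD[OF linear_families_reduced])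
  then have "\<Phi> \<in> V"
  proof (rule twisted_span_induct)
    show "fn.subspace V"
    proof (rule fn.subspaceI)
      have "untwist 0 x i = (\<Sum>q\<in>?Q. 0 * ?G q x i)" for x i
        by (simp add: untwist_def sweedler_zero)
      then show "0 \<in> V"
        unfolding V_def using subspace_0[OF A_subspace] by (intro CollectI exI[of _ "\<lambda>_. 0"]) blast
    next
      fix \<Phi> \<Phi>' assume "\<Phi> \<in> V" "\<Phi>' \<in> V"
      then obtain \<alpha> \<alpha>' where
        \<alpha>: "\<And>q. \<alpha> q \<in> A" "\<And>x i. untwist \<Phi> x i = (\<Sum>q\<in>?Q. \<alpha> q * ?G q x i)" and
        \<alpha>': "\<And>q. \<alpha>' q \<in> A" "\<And>x i. untwist \<Phi>' x i = (\<Sum>q\<in>?Q. \<alpha>' q * ?G q x i)"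
        unfolding V_def by blast
      have "untwist (\<Phi> + \<Phi>') x i = untwist \<Phi> x i + untwist \<Phi>' x i" for x i
        by (simp add: untwist_def distrib_left sweedler_add)
      then have "untwist (\<Phi> + \<Phi>') x i = (\<Sum>q\<in>?Q. (\<alpha> q + \<alpha>' q) * ?G q x i)" for x i
        by (simp only: \<alpha>(2) \<alpha>'(2) distrib_right sum.distrib)
      moreover have "\<alpha> q + \<alpha>' q \<in> A" for q
        by (rule subspace_add[OF A_subspace \<alpha>(1) \<alpha>'(1)])
      ultimately show "\<Phi> + \<Phi>' \<in> V"
        unfolding V_def by (intro CollectI exI[of _ "\<lambda>q. \<alpha> q + \<alpha>' q"]) blast
    next
      fix c \<Phi> assume "\<Phi> \<in> V"
      then obtain \<alpha> where
        \<alpha>: "\<And>q. \<alpha> q \<in> A" "\<And>x i. untwist \<Phi> x i = (\<Sum>q\<in>?Q. \<alpha> q * ?G q x i)"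
        unfolding V_def by blast
      have "untwist (fscale c \<Phi>) x i = c *s untwist \<Phi> x i" for x i
        by (simp add: untwist_def fscale_def sweedler_scale scale_mult_right)
      then have "untwist (fscale c \<Phi>) x i = (\<Sum>q\<in>?Q. (c *s \<alpha> q) * ?G q x i)" for x i
        by (simp only: \<alpha>(2) scale_sum_right scale_mult_left)
      moreover have "c *s \<alpha> q \<in> A" for q
        by (rule subspace_scale[OF A_subspace \<alpha>(1)])
      ultimately show "fscale c \<Phi> \<in> V"
        unfolding V_def by (intro CollectI exI[of _ "\<lambda>q. c *s \<alpha> q"]) blast
    qed
    fix a b j assume *: "a \<in> A" "b \<in> basis" "j \<in> J" "b = integral \<Longrightarrow> j \<in> {}"
    define \<alpha> where "\<alpha> q = (if q = (b, j) then a else 0)" for q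
    have "untwist (twist_mult a (pure (coef b) (g j))) x i = (\<Sum>q\<in>?Q. \<alpha> q * ?G q x i)" for x i
    proof -
      have "(b, j) \<in> ?Q" "finite ?Q" using * basis(1) J by auto
      have "(\<Sum>q\<in>?Q. \<alpha> q * ?G q x i) = (\<Sum>q\<in>?Q. if q = (b, j) then a * ?G q x i else 0)"
        by (intro sum.cong refl) (simp add: \<alpha>_def)
      also have "\<dots> = a * ?G (b, j) x i"
        using \<open>finite ?Q\<close> \<open>(b, j) \<in> ?Q\<close> by (simp only: sum.delta) simp
      finally show ?thesis
        by (simp add: untwist_twisted lin_pure form_coef)
    qed
    moreover have "\<alpha> q \<in> A" for q
      using *(1) subspace_0[OF A_subspace] by (simp add: \<alpha>_def)
    ultimately show "twist_mult a (pure (coef b) (g j)) \<in> V"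
      unfolding V_def by (intro CollectI exI[of _ \<alpha>]) blast
  qed
  moreover have "untwist \<Phi> x i = \<Psi> x i" for x i
  proof -
    have "untwist \<Phi> x i = sweedler x (\<lambda>x1 w. sweedler w (\<lambda>x2 x3. (S x1 * x2) * \<Psi> x3 i))"
      by (simp add: untwist_def \<Phi>_def sweedler_mult_left mult.assoc)
    also have "\<dots> = 1 * \<Psi> x i"
      by (rule sweedler_cancel(3)[where s = scale]) (intro l)
    finally show ?thesis by simp
  qed
  ultimately show ?thesis unfolding V_def by (simp only: mem_Collect_eq)
qed

lemma generated_step: "generated (basis \<times> I) ((basis - {integral}) \<times> J)"
proof -
  let ?Q = "(basis - {integral}) \<times> J"
  define g' where "g' q r = (if r \<in> basis \<times> I then
    untwist (pure (coef (fst q)) (g (snd q))) (fst r) (snd r) else 0)" for q r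
  have "g' q \<in> tuples (basis \<times> I)" if "q \<in> ?Q" for q
  proof -
    have "untwist (pure (coef (fst q)) (g (snd q))) x \<in> tuples I" for x
      using that g pure_linear_families[OF form_coef, of "g (snd q)" "fst q"]
      by (intro untwist_in_tuples) (auto simp: linear_families_def)
    then show ?thesis by (auto simp: g'_def tuples_def)
  qed
  moreover have "\<exists>\<alpha>. (\<forall>q\<in>?Q. \<alpha> q \<in> A) \<and> v = (\<lambda>r. \<Sum>q\<in>?Q. \<alpha> q * g' q r)"
    if v: "v \<in> tuples (basis \<times> I)" for v
  proof -
    define \<Psi> where "\<Psi> = (\<lambda>x i. \<Sum>b\<in>basis. coef b x *s v (b, i))"
    have "\<Psi> \<in> linear_families"
    proof -
      have "\<Psi> x i \<in> N" if "i \<in> I" for x i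
        unfolding \<Psi>_def using v that
        by (intro subspace_sum[OF N(1)] subspace_scale[OF N(1)]) (simp add: tuples_def)
      moreover have "\<Psi> x i = 0" if "i \<notin> I" for x i
        unfolding \<Psi>_def using v that by (simp add: tuples_def)
      moreover have "lin (\<lambda>x. \<Psi> x i)" for i
        unfolding \<Psi>_def
        by (rule lin_toI) (simp_all add: vector_space_axioms lin_toD[OF form_coef] scale_left_distrib
            sum.distrib scale_sum_right)
      ultimately show ?thesis by (simp add: tuples_def linear_families_def)
    qed
    from linear_families_generated[OF this] obtain \<alpha> where \<alpha>: "\<And>q. \<alpha> q \<in> A"
      "\<And>x i. \<Psi> x i = (\<Sum>q\<in>?Q. \<alpha> q * untwist (pure (coef (fst q)) (g (snd q))) x i)" by blast
    have "v r = (\<Sum>q\<in>?Q. \<alpha> q * g' q r)" for r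
    proof (cases "r \<in> basis \<times> I")
      case True
      then have "\<Psi> (fst r) (snd r) = (\<Sum>b\<in>basis. if b = fst r then v (b, snd r) else 0)"
        unfolding \<Psi>_def by (intro sum.cong refl) (auto simp: coef_basis)
      also have "\<dots> = v r"
        using True basis(1) by (simp add: sum.delta mem_Times_iff)
      finally show ?thesis
        using True by (simp add: \<alpha>(2) g'_def)
    next
      case False
      then have "v r = 0" using v unfolding tuples_def by blast
      then show ?thesis using False by (simp only: g'_def if_False mult_zero_right sum.neutral_const)
    qed
    then show ?thesis using \<alpha>(1) by blast
  qed
  ultimately show ?thesis unfolding generated_def by blast
qed

end

context ad_stable_augmentation begin

lemma generated_tensor:
  assumes "finite J" "generated I J"
  shows "generated (basis \<times> I) ((basis - {integral}) \<times> J)"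
proof -
  from assms(2) obtain g where g: "\<forall>j\<in>J. g j \<in> tuples I"
    "\<forall>v\<in>tuples I. \<exists>a. (\<forall>j\<in>J. a j \<in> A) \<and> v = (\<lambda>i. \<Sum>j\<in>J. a j * g j i)"
    unfolding generated_def by blast
  interpret augmentation_generators scale comult counit antipode A Y N p e I J g
    by unfold_locales (use assms(1) g in auto)
  show ?thesis by (rule generated_step)
qed

lemma generated_reindex:
  assumes gen: "generated I J" and f: "bij_betw f I' I" and h: "bij_betw h J' J"
  shows "generated I' J'"
proof -
  from gen obtain g where g: "\<And>j. j \<in> J \<Longrightarrow> g j \<in> tuples I"
    "\<And>v. v \<in> tuples I \<Longrightarrow> \<exists>a. (\<forall>j\<in>J. a j \<in> A) \<and> v = (\<lambda>i. \<Sum>j\<in>J. a j * g j i)"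
    unfolding generated_def by blast
  define g' where "g' j i = (if i \<in> I' then g (h j) (f i) else 0)" for j i
  have fI: "f i \<in> I" if "i \<in> I'" for i using f that by (auto simp: bij_betw_def)
  have hJ: "h j \<in> J" if "j \<in> J'" for j using h that by (auto simp: bij_betw_def)
  have "g' j \<in> tuples I'" if "j \<in> J'" for j
    using g(1)[OF hJ[OF that]] fI by (auto simp: g'_def tuples_def)
  moreover have "\<exists>a. (\<forall>j\<in>J'. a j \<in> A) \<and> v = (\<lambda>i. \<Sum>j\<in>J'. a j * g' j i)" if v: "v \<in> tuples I'" for v
  proof -
    define u where "u i = (if i \<in> I then v (the_inv_into I' f i) else 0)" for i
    have inv: "the_inv_into I' f i \<in> I'" if "i \<in> I" for i
      using f that by (metis bij_betw_def the_inv_into_into order_refl)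
    then have "u \<in> tuples I" using v by (auto simp: u_def tuples_def)
    from g(2)[OF this] obtain a where a: "\<forall>j\<in>J. a j \<in> A" "u = (\<lambda>i. \<Sum>j\<in>J. a j * g j i)" by blast
    have "v i = (\<Sum>j\<in>J'. a (h j) * g' j i)" for i
    proof (cases "i \<in> I'")
      case True
      then have "v i = u (f i)"
        using f fI by (simp add: u_def the_inv_into_f_f bij_betw_def)
      also have "\<dots> = (\<Sum>j\<in>J. a j * g j (f i))" using a(2) by simp
      also have "\<dots> = (\<Sum>j\<in>J'. a (h j) * g (h j) (f i))"
        by (rule sum.reindex_bij_betw[OF h, symmetric])
      finally show ?thesis using True by (simp add: g'_def)
    next
      case False
      then show ?thesis using v by (simp add: g'_def tuples_def)
    qed
    then show ?thesis using a(1) hJ by (intro exI[of _ "\<lambda>j. a (h j)"]) auto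
  qed
  ultimately show ?thesis unfolding generated_def by blast
qed

lemma generated_card:
  assumes gen: "generated I J" and fin: "finite I" "finite J"
    and card: "card I' = card I" "card J' = card J" "finite I'" "finite J'"
  shows "generated I' J'"
  using finite_same_card_bij[OF card(3) fin(1) card(1)] finite_same_card_bij[OF card(4) fin(2) card(2)]
    generated_reindex[OF gen] by blast

text \<open>
  The index set of the tuples grows by the factor \<open>dim H\<close> in each step, the number of generators only
  by the factor \<open>dim H - 1\<close>.
\<close>

lemma generated_power:
  "\<exists>w. \<forall>t. generated {..<card basis ^ t} {..<(card basis - 1) ^ t * w}"
proof -
  obtain C where C: "C \<subseteq> N" "independent C" "N \<subseteq> span C"
    using basis_exists[of N] by metis
  have fin: "finite C"
    using independent_span_bound[OF basis(1) C(2)] basis(3) by simp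
  have "generated {..<1::nat} C"
  proof -
    define g where "g c i = (if i = 0 then c else 0)" for c :: 'h and i :: nat
    have "\<exists>a. (\<forall>c\<in>C. a c \<in> A) \<and> v = (\<lambda>i. \<Sum>c\<in>C. a c * g c i)" if v: "v \<in> tuples {..<1::nat}" for v
    proof -
      have "v 0 \<in> N" using v by (simp add: tuples_def)
      then have v0: "(\<Sum>c\<in>C. representation C (v 0) c *s c) = v 0"
        by (intro sum_representation_eq C(2) fin subset_refl subsetD[OF C(3)])
      have "v i = (\<Sum>c\<in>C. (representation C (v 0) c *s 1) * g c i)" for i
        using v v0 by (cases "i = 0") (simp_all add: g_def scale_mult_left tuples_def)
      then show ?thesis
        using A(2) subspace_scale[OF A_subspace]
        by (intro exI[of _ "\<lambda>c. representation C (v 0) c *s 1"]) blast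
    qed
    moreover have "\<forall>c\<in>C. g c \<in> tuples {..<1}" using C(1) by (auto simp: g_def tuples_def)
    ultimately show ?thesis unfolding generated_def by blast
  qed
  have "generated {..<card basis ^ t} {..<(card basis - 1) ^ t * card C}" for t
  proof (induction t)
    case 0
    show ?case
      by (rule generated_card[OF \<open>generated {..<1::nat} C\<close>]) (simp_all add: fin)
  next
    case (Suc t)
    show ?case
      by (rule generated_card[OF generated_tensor[OF _ Suc]])
        (simp_all add: basis(1,4) card_cartesian_product card_Diff_singleton)
  qed
  then show ?thesis by blast
qed

text \<open>\<open>card J\<close> tuples span at most \<open>dim H \<cdot> card J\<close> dimensions, while the tuples supported at one index already give \<open>card I\<close> independent vectors.\<close>

lemma generated_bound:
  fixes I :: "'i set" and J :: "'j set"
  assumes gen: "generated I J" and fin: "finite I" "finite J" and n: "n \<in> N" "n \<noteq> 0"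
  shows "card I \<le> card basis * card J"
proof -
  interpret fn: vector_space "fscale :: 'k \<Rightarrow> ('h \<Rightarrow> 'i \<Rightarrow> 'h) \<Rightarrow> 'h \<Rightarrow> 'i \<Rightarrow> 'h"
    by (rule fun_vector_space)
  from gen obtain g where g: "\<And>j. j \<in> J \<Longrightarrow> g j \<in> tuples I"
    "\<And>v. v \<in> tuples I \<Longrightarrow> \<exists>a. (\<forall>j\<in>J. a j \<in> A) \<and> v = (\<lambda>i. \<Sum>j\<in>J. a j * g j i)"
    unfolding generated_def by blast
  define E :: "'i \<Rightarrow> 'h \<Rightarrow> 'i \<Rightarrow> 'h" where "E k = (\<lambda>x i. if i = k then n else 0)" for k
  define G :: "'h \<times> 'j \<Rightarrow> 'h \<Rightarrow> 'i \<Rightarrow> 'h" where "G q = (\<lambda>x i. fst q * g (snd q) i)" for q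
  have inj: "inj_on E I"
  proof (rule inj_onI)
    fix k l assume "E k = E l"
    then have "E k 0 k = E l 0 k" by simp
    then show "k = l" using n(2) by (auto simp: E_def split: if_splits)
  qed
  have "fn.independent (E ` I)"
  proof (rule fn.independent_if_scalars_zero)
    fix f \<Phi> assume sum: "(\<Sum>\<Phi>\<in>E ` I. fscale (f \<Phi>) \<Phi>) = 0" and "\<Phi> \<in> E ` I"
    then obtain k where k: "k \<in> I" "\<Phi> = E k" by blast
    have "(\<Sum>\<Phi>\<in>E ` I. fscale (f \<Phi>) \<Phi>) 0 k = (\<Sum>l\<in>I. if l = k then f (E l) *s n else 0)"
      unfolding sum.reindex[OF inj] sum_fun_apply
      by (intro sum.cong refl) (auto simp: fscale_def E_def)
    also have "\<dots> = f (E k) *s n" using fin(1) k(1) by (simp add: sum.delta)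
    finally show "f \<Phi> = 0" using sum n(2) by (simp add: k(2))
  qed (use fin in simp)
  moreover have "E ` I \<subseteq> fn.span (G ` (basis \<times> J))"
  proof clarify
    fix k assume k: "k \<in> I"
    have "(\<lambda>i. if i = k then n else 0) \<in> tuples I"
      using n(1) k subspace_0[OF N(1)] by (auto simp: tuples_def)
    from g(2)[OF this] obtain a where a: "(\<lambda>i. if i = k then n else 0) = (\<lambda>i. \<Sum>j\<in>J. a j * g j i)"
      by blast
    have "E k = (\<Sum>j\<in>J. \<Sum>b\<in>basis. fscale (coef b (a j)) (G (b, j)))"
    proof (intro ext)
      fix x i
      have "a j * g j i = (\<Sum>b\<in>basis. coef b (a j) *s (b * g j i))" for j
        by (subst coef_expand[of "a j", symmetric]) (simp only: sum_distrib_right scale_mult_left)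
      then show "E k x i = (\<Sum>j\<in>J. \<Sum>b\<in>basis. fscale (coef b (a j)) (G (b, j))) x i"
        using fun_cong[OF a, of i] by (simp add: E_def G_def fscale_def sum_fun_apply)
    qed
    also have "\<dots> \<in> fn.span (G ` (basis \<times> J))"
      by (intro fn.span_sum fn.span_scale fn.span_base) auto
    finally show "E k \<in> fn.span (G ` (basis \<times> J))" .
  qed
  ultimately have "card (E ` I) \<le> card (G ` (basis \<times> J))"
    using fn.independent_span_bound[of "G ` (basis \<times> J)" "E ` I"] fin basis(1) by simp
  also have "\<dots> \<le> card (basis \<times> J)" using fin basis(1) by (intro card_image_le) simp
  finally show ?thesis using card_image[OF inj] by (simp add: card_cartesian_product)
qed

lemma augmentation_module_trivial:
  assumes "n \<in> N"
  shows "n = 0"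
proof (rule ccontr)
  assume "n \<noteq> 0"
  define d where "d = card basis"
  have d: "d > 0" using basis(1,4) by (auto simp: d_def card_gt_0_iff)
  obtain w where w: "generated {..<d ^ t} {..<(d - 1) ^ t * w}" for t
    using generated_power by (auto simp: d_def)
  have le: "d ^ t \<le> d * ((d - 1) ^ t * w)" for t
    using generated_bound[OF w[of t] _ _ assms \<open>n \<noteq> 0\<close>] by (simp add: d_def)
  define c where "c = real d * real w + 1"
  have c: "c > 0" unfolding c_def by (intro add_nonneg_pos) simp_all
  then have "0 < 1 / c" by simp
  moreover have "real (d - 1) / real d < 1" using d by simp
  ultimately obtain t where "(real (d - 1) / real d) ^ t < 1 / c"
    using real_arch_pow_inv by blast
  then have "real (d - 1) ^ t / real d ^ t * c < 1"
    using c by (simp only: pos_less_divide_eq power_divide)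
  then have "real (d - 1) ^ t * c < real d ^ t"
    using d by (simp add: pos_divide_less_eq)
  moreover have "real d ^ t \<le> real d * (real (d - 1) ^ t * real w)"
    using le[of t] by (metis of_nat_le_iff of_nat_mult of_nat_power)
  moreover have "real (d - 1) ^ t * c = real d * (real (d - 1) ^ t * real w) + real (d - 1) ^ t"
    by (simp add: c_def algebra_simps)
  moreover have "0 \<le> real (d - 1) ^ t" by simp
  ultimately show False by linarith
qed

end

section \<open>The commutator subalgebra\<close>

context semisimple_hopf_algebra begin

lemma ad_stableD: "ad_stable N \<Longrightarrow> subspace N" "ad_stable N \<Longrightarrow> x \<in> N \<Longrightarrow> ad h x \<in> N"
  by (simp_all add: ad_stable_def)

lemma left_ideal_gen_subset_right:
  assumes "ad_stable Y"
  shows "left_ideal_gen Y \<subseteq> span {y * h | y h. y \<in> Y}"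
proof
  fix g assume "g \<in> left_ideal_gen Y"
  then show "g \<in> span {y * h | y h. y \<in> Y}"
  proof (rule left_ideal_gen_induct[OF _ subspace_span])
    fix h x assume "x \<in> Y"
    then have "ad h1 x * h2 \<in> span {y * h | y h. y \<in> Y}" for h1 h2
      using ad_stableD(2)[OF assms] by (intro span_base) blast
    then show "h * x \<in> span {y * h | y h. y \<in> Y}"
      unfolding mult_eq_ad_mult[of h x] by (rule sweedler_in_subspace[OF subspace_span])
  qed
qed

text \<open>
  With \<open>A = k 1 + Y\<close>, applying \<open>ad\<close> of the integral shows that an \<open>ad\<close>-stable left ideal of \<open>A\<close> that
  is not contained in \<open>Y\<close> has a central element in \<open>1 + Y\<close>. Products of such elements stay in
  \<open>1 + Y\<close>, so these left ideals are closed under intersection and there is a least one, \<open>P\<close>. Being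
  least, \<open>P\<close> agrees with its multiples by central elements of \<open>1 + Y\<close>, and this produces a central
  idempotent \<open>p \<in> P\<close>. The module \<open>N = e p H\<close> vanishes by the counting argument, so \<open>e p = 0\<close>
  and \<open>e = e (1 - p) = 1 - p\<close> is in \<open>Y\<close>.
\<close>

lemma ad_stable_contains_unit:
  assumes Y: "ad_stable Y" "\<And>x y. x \<in> Y \<Longrightarrow> y \<in> Y \<Longrightarrow> x * y \<in> Y"
    and e: "central e" "e \<in> left_ideal_gen Y" "\<And>y. y \<in> Y \<Longrightarrow> y * e = y"
  shows "e \<in> Y"
proof (cases "1 \<in> Y")
  case True
  then show ?thesis using e(3)[OF True] by simp
next
  case False
  note sub_Y = ad_stableD(1)[OF Y(1)]
  define A where "A = {c *s 1 + y | c y. y \<in> Y}"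
  have AI: "c *s 1 + y \<in> A" if "y \<in> Y" for c y
    using that unfolding A_def by blast
  have sub_A: "subspace A"
  proof (rule subspaceI)
    show "0 \<in> A" using AI[of 0 0] subspace_0[OF sub_Y] by simp
  next
    fix a b assume "a \<in> A" "b \<in> A"
    then obtain c y d z where "a = c *s 1 + y" "b = d *s 1 + z" "y \<in> Y" "z \<in> Y"
      unfolding A_def by blast
    then show "a + b \<in> A"
      using AI[of "y + z" "c + d"] subspace_add[OF sub_Y] by (simp add: scale_left_distrib algebra_simps)
  next
    fix k a assume "a \<in> A"
    then obtain c y where "a = c *s 1 + y" "y \<in> Y" unfolding A_def by blast
    then show "k *s a \<in> A"
      using AI[of "k *s y" "k * c"] subspace_scale[OF sub_Y] by (simp add: scale_right_distrib)
  qed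
  have A: "ad_stable A" "1 \<in> A" "\<And>a b. a \<in> A \<Longrightarrow> b \<in> A \<Longrightarrow> a * b \<in> A" "Y \<subseteq> A"
    "\<And>y a. y \<in> Y \<Longrightarrow> a \<in> A \<Longrightarrow> y * a \<in> Y"
  proof -
    show "1 \<in> A" using AI[of 0 1] subspace_0[OF sub_Y] by simp
    show "Y \<subseteq> A" using AI[of _ 0] by auto
    show YA: "y * a \<in> Y" if "y \<in> Y" "a \<in> A" for y a
    proof -
      obtain c z where "a = c *s 1 + z" "z \<in> Y" using \<open>a \<in> A\<close> unfolding A_def by blast
      then show ?thesis
        using that(1) Y(2) by (simp add: distrib_left scale_mult_right subspace_add[OF sub_Y] subspace_scale[OF sub_Y])
    qed
    show "a * b \<in> A" if "a \<in> A" "b \<in> A" for a b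
    proof -
      obtain c y where "a = c *s 1 + y" "y \<in> Y" using \<open>a \<in> A\<close> unfolding A_def by blast
      moreover from this have "y * b \<in> A" using YA that(2) \<open>Y \<subseteq> A\<close> by blast
      ultimately show ?thesis
        using that(2) by (simp add: distrib_right scale_mult_left subspace_add[OF sub_A] subspace_scale[OF sub_A])
    qed
    show "ad_stable A" unfolding ad_stable_def
    proof (intro conjI sub_A allI ballI)
      fix h a assume "a \<in> A"
      then obtain c y where "a = c *s 1 + y" "y \<in> Y" unfolding A_def by blast
      then show "ad h a \<in> A"
        using AI[OF ad_stableD(2)[OF Y(1)], of y "c * \<epsilon> h" h]
        by (simp add: lin_toD[OF lin_ad_right[OF lin_id]] ad_one_right)
    qed
  qed
  define admissible where "admissible L \<longleftrightarrow> ad_stable L \<and> L \<subseteq> A \<and> (\<forall>y\<in>Y. \<forall>x\<in>L. y * x \<in> L) \<and> \<not> L \<subseteq> Y" for L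
  have "admissible A"
    using A False by (auto simp: admissible_def)
  then obtain P where P: "admissible P" "\<And>L. admissible L \<Longrightarrow> dim P \<le> dim L"
    using ex_has_least_nat[of admissible A dim] by blast
  have rep: "\<exists>c\<in>L. central c \<and> c - 1 \<in> Y" if L: "admissible L" for L
  proof -
    have L': "ad_stable L" "L \<subseteq> A" "\<not> L \<subseteq> Y" using L by (auto simp: admissible_def)
    then obtain x where x: "x \<in> L" "x \<notin> Y" by blast
    then obtain k y where y: "x = k *s 1 + y" "y \<in> Y" using L'(2) unfolding A_def by blast
    have "k \<noteq> 0" using x y by auto
    let ?c = "ad integral (inverse k *s x)"
    have "?c \<in> L" using L'(1) x(1) by (auto simp: ad_stable_def subspace_scale)
    moreover have "?c - 1 = ad integral (inverse k *s y)"
      using \<open>k \<noteq> 0\<close> by (simp add: y(1) scale_right_distrib lin_toD[OF lin_ad_right[OF lin_id]]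
          ad_one_right integral(2))
    then have "?c - 1 \<in> Y"
      using Y(1) y(2) by (simp add: ad_stable_def subspace_scale)
    ultimately show ?thesis using central_ad_integral by blast
  qed
  have stable: "a * x \<in> L" if "admissible L" "a \<in> A" "x \<in> L" for L a x
  proof -
    obtain c y where a: "a = c *s 1 + y" "y \<in> Y" using \<open>a \<in> A\<close> unfolding A_def by blast
    have "subspace L" "y * x \<in> L" using that a(2) by (auto simp: admissible_def ad_stable_def)
    then show ?thesis
      using that(3) by (simp add: a(1) distrib_right scale_mult_left subspace_add subspace_scale)
  qed
  have in_A: "a \<in> A" if "a - 1 \<in> Y" for a using AI[OF that, of 1] by simp
  have prod_not_in: "c * d \<notin> Y" "c * d - 1 \<in> Y" if "c - 1 \<in> Y" "d - 1 \<in> Y" for c d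
  proof -
    have "(c - 1) * (d - 1) + (c - 1) + (d - 1) \<in> Y"
      using that Y(2) by (intro subspace_add[OF sub_Y])
    then show *: "c * d - 1 \<in> Y" by (simp add: algebra_simps)
    then show "c * d \<notin> Y"
      using False subspace_diff[OF sub_Y, of "c * d" "c * d - 1"] by auto
  qed
  have least: "P \<subseteq> L" if L: "admissible L" for L
  proof -
    obtain c where c: "c \<in> P" "central c" "c - 1 \<in> Y" using rep[OF P(1)] by blast
    obtain d where d: "d \<in> L" "central d" "d - 1 \<in> Y" using rep[OF L] by blast
    have "c * d \<in> L" by (rule stable[OF L in_A[OF c(3)] d(1)])
    moreover have "d * c \<in> P" by (rule stable[OF P(1) in_A[OF d(3)] c(1)])
    then have "c * d \<in> P" using c(2) by (simp add: central_def)
    ultimately have "admissible (P \<inter> L)"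
      using P(1) L prod_not_in(1)[OF c(3) d(3)]
      by (auto simp: admissible_def ad_stable_def intro: subspace_inter)
    then have "dim P \<le> dim (P \<inter> L)" by (rule P(2))
    interpret H: finite_dimensional_vector_space scale basis
      by unfold_locales (use basis in auto)
    have "P \<inter> L = P"
      using \<open>admissible (P \<inter> L)\<close> P(1) \<open>dim P \<le> dim (P \<inter> L)\<close>
      by (intro H.subspace_dim_equal) (auto simp: admissible_def ad_stable_def)
    then show ?thesis by blast
  qed
  obtain c where c: "c \<in> P" "central c" "c - 1 \<in> Y" using rep[OF P(1)] by blast
  have central_mult: "central (u * v)" if "central u" "central v" for u v
    using that unfolding central_def by (metis mult.assoc)
  \<comment> \<open>Multiplying by \<open>c\<^sup>2\<close> instead of \<open>c\<close> gives \<open>c = d c\<^sup>2\<close> with central \<open>d\<close>, the relation of an inverse in a von Neumann regular ring, so that \<open>d c\<close> is idempotent.\<close>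
  define c2 where "c2 = c * c"
  have c2: "central c2" "c2 - 1 \<in> Y"
    unfolding c2_def by (rule central_mult[OF c(2) c(2)], rule prod_not_in(2)[OF c(3) c(3)])
  have "admissible ((\<lambda>x. x * c2) ` P)"
    unfolding admissible_def
  proof (intro conjI ballI)
    have sub_P: "subspace P" using P(1) by (simp add: admissible_def ad_stable_def)
    have comm: "x * c2 = c2 * x" for x using c2(1) by (simp add: central_def)
    show "ad_stable ((\<lambda>x. x * c2) ` P)"
      unfolding ad_stable_def
    proof (intro conjI allI ballI)
      show "subspace ((\<lambda>x. x * c2) ` P)"
      proof (rule subspaceI)
        show "0 \<in> (\<lambda>x. x * c2) ` P" using subspace_0[OF sub_P] by (intro image_eqI[of _ _ 0]) simp_all
        show "u + v \<in> (\<lambda>x. x * c2) ` P" if "u \<in> (\<lambda>x. x * c2) ` P" "v \<in> (\<lambda>x. x * c2) ` P" for u v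
          using that subspace_add[OF sub_P] by (auto simp flip: distrib_right)
        show "k *s u \<in> (\<lambda>x. x * c2) ` P" if "u \<in> (\<lambda>x. x * c2) ` P" for k u
          using that subspace_scale[OF sub_P] by (auto simp flip: scale_mult_left)
      qed
      show "ad h x \<in> (\<lambda>x. x * c2) ` P" if "x \<in> (\<lambda>x. x * c2) ` P" for h x
        using that P(1) by (auto simp: ad_mult_central[OF c2(1)] admissible_def ad_stable_def)
    qed
    show "(\<lambda>x. x * c2) ` P \<subseteq> A"
      using P(1) in_A[OF c2(2)] A(3) by (auto simp: admissible_def)
    show "y * x \<in> (\<lambda>x. x * c2) ` P" if "y \<in> Y" "x \<in> (\<lambda>x. x * c2) ` P" for y x
      using that P(1) by (auto simp: admissible_def simp flip: mult.assoc)
    have "c * c2 \<in> (\<lambda>x. x * c2) ` P" using c(1) by blast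
    then show "\<not> (\<lambda>x. x * c2) ` P \<subseteq> Y" using prod_not_in(1)[OF c(3) c2(2)] by blast
  qed
  from subsetD[OF least[OF this] c(1)] obtain x where x: "x \<in> P" "c = x * c2" by blast
  define d where "d = ad integral x"
  have d: "d \<in> P" "central d"
    using x(1) P(1) central_ad_integral by (simp_all add: d_def admissible_def ad_stable_def)
  have dc: "c = d * c2"
    using ad_mult_central[OF c2(1), of integral x] ad_central[OF c(2), of integral]
    by (simp add: d_def integral(2) flip: x(2))
  define p where "p = d * c"
  have p_central: "central p" unfolding p_def by (rule central_mult[OF d(2) c(2)])
  have pc: "p * c = c" by (simp only: p_def mult.assoc c2_def[symmetric] dc[symmetric])
  have "p = c * d" using d(2) by (simp add: p_def central_def)
  then have pp: "p * p = p" using pc by (metis mult.assoc)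
  have "d \<in> A" using d(1) P(1) by (auto simp: admissible_def)
  then have p_P: "p \<in> P" unfolding p_def by (rule stable[OF P(1) _ c(1)])
  have p1: "1 - p \<in> Y"
  proof -
    have "p \<in> A" using p_P P(1) by (auto simp: admissible_def)
    then obtain k y where y: "p = k *s 1 + y" "y \<in> Y" unfolding A_def by blast
    have "p * (c - 1) \<in> Y"
      using A(5)[OF c(3) \<open>p \<in> A\<close>] p_central by (simp add: central_def)
    then have "(c - 1) - p * (c - 1) \<in> Y" by (rule subspace_diff[OF sub_Y c(3)])
    moreover have "(c - 1) - p * (c - 1) = p - 1" by (simp add: algebra_simps pc)
    ultimately show ?thesis using subspace_neg[OF sub_Y, of "p - 1"] by simp
  qed
  have ee: "e * e = e"
  proof -
    have "e \<in> {x. e * x = x}"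
      using subsetD[OF left_ideal_gen_subset_right[OF Y(1)] e(2)]
    proof (rule span_subspace_induct)
      show "subspace {x. e * x = x}"
        by (rule subspaceI) (auto simp: distrib_left scale_mult_right)
      show "x \<in> {x. e * x = x}" if "x \<in> {y * h | y h. y \<in> Y}" for x
      proof -
        from that obtain y h where "x = y * h" "y \<in> Y" by blast
        moreover have "e * y = y" using e(1,3) \<open>y \<in> Y\<close> by (simp add: central_def)
        ultimately show ?thesis by (simp flip: mult.assoc)
      qed
    qed
    then show ?thesis by simp
  qed
  define N where "N = {x. e * x = x \<and> p * x = x}"
  interpret aug: ad_stable_augmentation scale comult counit antipode A Y N p e
  proof unfold_locales
    show "subspace N"
      unfolding N_def by (rule subspaceI) (auto simp: distrib_left scale_mult_right)
    show "h * n \<in> N" if "n \<in> N" for h n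
    proof -
      have "e * (h * n) = h * (e * n)" "p * (h * n) = h * (p * n)"
        using e(1) p_central unfolding central_def by (metis mult.assoc)+
      then show ?thesis using that by (simp add: N_def)
    qed
    show "p \<in> L" if "ad_stable L" "L \<subseteq> A" "\<And>y x. y \<in> Y \<Longrightarrow> x \<in> L \<Longrightarrow> y * x \<in> L" "\<not> L \<subseteq> Y" for L
      using least[of L] p_P that by (auto simp: admissible_def)
    show "e \<in> span {y * h | y h. y \<in> Y}"
      using e(2) left_ideal_gen_subset_right[OF Y(1)] by blast
  qed (use A Y(1) False p_central in \<open>auto simp: N_def\<close>)
  have "p * e = e * p" using e(1) by (simp add: central_def)
  then have "e * p \<in> N"
    using ee pp unfolding N_def mem_Collect_eq by (metis mult.assoc)
  then have "e * p = 0" by (rule aug.augmentation_module_trivial)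
  then have "e = (1 - p) * e" using \<open>p * e = e * p\<close> by (simp add: algebra_simps)
  then have "e = 1 - p" using e(3)[OF p1] by simp
  then show ?thesis using p1 by simp
qed

lemma normal_left_coideal_subalgebra_ad_stable:
  "normal_left_coideal_subalgebra N \<Longrightarrow> ad_stable N"
  by (simp add: normal_left_coideal_subalgebra_def subalgebra_def normal_def ad_stable_def ad_def)

lemma augmentation_ad_stable:
  assumes "ad_stable N"
  shows "ad_stable (augmentation N)"
proof -
  have "subspace {x. \<epsilon> x = 0}"
    by (rule subspaceI) (simp_all add: lin_toD[OF counit_linear])
  then have "subspace (augmentation N)"
    unfolding augmentation_def using ad_stableD(1)[OF assms] by (rule subspace_inter[rotated])
  then show ?thesis
    using assms by (simp add: ad_stable_def augmentation_def counit_ad)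
qed

lemma counit_hopf_commutator: "\<epsilon> (hopf_commutator a b) = \<epsilon> a * \<epsilon> b"
proof -
  have "\<epsilon> (hopf_commutator a b) = sweedler a (\<lambda>a1 a2. \<epsilon> (a1 * S a2) * \<epsilon> b)"
    by (simp add: hopf_commutator_eq_ad_right sweedler_linear[OF counit_linear] counit_mult counit_ad
        mult.commute mult.left_commute)
  also have "\<dots> = \<epsilon> a * \<epsilon> b"
    by (subst sweedler_antipode_right[where s = "(*)" and f = "\<lambda>y. \<epsilon> y * \<epsilon> b"]; (intro lin)?)
      (simp add: counit_one)
  finally show ?thesis .
qed

text \<open>
  Let \<open>z\<close> be the idempotent complementary to \<open>H M\<^sup>+\<close>. Since \<open>H z\<close> is commutative, the inner
  commutator in \<open>\<Delta>{a,b}\<close> becomes \<open>\<epsilon>(a2) \<epsilon>(b2) z\<close>, which makes \<open>{a,b}\<close> coinvariant. The space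
  \<open>C\<close> of all \<open>f(z1) z2\<close> then contains \<open>{a,b} 1\<close> as soon as it contains \<open>1\<close>.
\<close>

lemma commutative_quotient_contains_commutator:
  assumes M: "normal_left_coideal_subalgebra M" and comm: "commutative_quotient M"
  shows "hopf_commutator a b \<in> M"
proof -
  note stable = normal_left_coideal_subalgebra_ad_stable[OF M]
  have sub: "subspace M" and one: "1 \<in> M" and mult: "\<And>x y. x \<in> M \<Longrightarrow> y \<in> M \<Longrightarrow> x * y \<in> M"
    and coideal: "left_coideal M"
    using M by (simp_all add: normal_left_coideal_subalgebra_def subalgebra_def)
  let ?Y = "augmentation M"
  have Y: "ad_stable ?Y" by (rule augmentation_ad_stable[OF stable])
  obtain e where e: "e \<in> left_ideal_gen ?Y" "\<And>x. x \<in> left_ideal_gen ?Y \<Longrightarrow> x * e = x" "central e"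
    using ideal_central_idempotent[OF subspace_left_ideal_gen[of ?Y] left_ideal_gen_mult_left
        left_ideal_gen_mult_right[OF Y]] by metis
  have Y_ideal: "x \<in> left_ideal_gen ?Y" if "x \<in> ?Y" for x
    using left_ideal_genI[OF that, of 1] by simp
  \<comment> \<open>This is what puts \<open>z\<close> into \<open>M\<close>.\<close>
  have "e \<in> ?Y"
  proof (rule ad_stable_contains_unit[OF Y _ e(3,1)])
    show "x * y \<in> ?Y" if "x \<in> ?Y" "y \<in> ?Y" for x y
      using that by (simp add: augmentation_def mult counit_mult)
    show "y * e = y" if "y \<in> ?Y" for y
      by (rule e(2)[OF Y_ideal[OF that]])
  qed
  then have e_M: "e \<in> M" "\<epsilon> e = 0" by (auto simp: augmentation_def)
  define z where "z = 1 - e"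
  have z: "z \<in> M" "\<epsilon> z = 1" "central z"
    using e_M one e(3)
    by (simp_all add: z_def subspace_diff[OF sub] lin_toD(5)[OF counit_linear] counit_one
        central_def algebra_simps)
  have ideal_z: "x * z = 0" if "x \<in> left_ideal_gen ?Y" for x
    using e(2)[OF that] by (simp add: z_def algebra_simps)
  have M_z: "x * z = \<epsilon> x *s z" if "x \<in> M" for x
  proof -
    have "x - \<epsilon> x *s 1 \<in> ?Y"
      using that one by (simp add: augmentation_def subspace_diff[OF sub] subspace_scale[OF sub]
          lin_toD[OF counit_linear] counit_one)
    then have "(x - \<epsilon> x *s 1) * z = 0" by (intro ideal_z Y_ideal)
    then show ?thesis by (simp add: left_diff_distrib scale_mult_left)
  qed
  define C where "C = {right_hit f z | f. form f}"
  have C_M: "C \<subseteq> M" using left_coideal_right_hit[OF coideal z(1)] by (auto simp: C_def)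
  have C_left: "h * x \<in> C" if h: "coinvariant z h" and x: "x \<in> C" for h x
  proof -
    from x obtain f where f: "form f" "x = right_hit f z" unfolding C_def by blast
    have "form (\<lambda>u. f (S h * u))" by (intro lin form_comp[OF f(1)])
    then show ?thesis using coinvariant_mult_right_hit[OF h f(1)] unfolding f(2) C_def by auto
  qed
  have "1 \<in> C"
  proof (rule ad_stable_contains_unit)
    show "ad_stable C" unfolding C_def by (rule right_hit_range_ad_stable[OF z(3)])
    show "x * y \<in> C" if "x \<in> C" "y \<in> C" for x y
      using that C_M by (intro C_left left_coideal_coinvariant[OF coideal M_z]) auto
    show "1 \<in> left_ideal_gen C" unfolding C_def by (rule one_in_left_ideal_gen_right_hit[OF z(2)])
  qed (simp_all add: central_def)
  have swap: "x * y * w * z = y * x * w * z" for x y w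
  proof -
    have "(x * y - y * x) * z = 0"
      using comm unfolding commutative_quotient_def by (intro ideal_z) blast
    moreover have "z * w = w * z" using z(3) by (simp add: central_def)
    ultimately have "(x * y - y * x) * (w * z) = 0" by (metis mult.assoc mult_zero_left)
    then show ?thesis by (simp add: mult.assoc left_diff_distrib)
  qed
  have comm_z: "hopf_commutator a b * z = (\<epsilon> a * \<epsilon> b) *s z" for a b
  proof -
    have "hopf_commutator a b * z = sweedler a (\<lambda>a1 a2. sweedler b (\<lambda>b1 b2. a1 * S a2 * (b1 * S b2) * z))"
      unfolding hopf_commutator_def sweedler_mult_right
    proof -
      have "a1 * b1 * S a2 * S b2 * z = a1 * S a2 * (b1 * S b2) * z" for a1 a2 b1 b2
      proof -
        have "a1 * (b1 * S a2 * S b2 * z) = a1 * (S a2 * b1 * S b2 * z)"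
          by (simp only: swap)
        then show ?thesis by (simp add: mult.assoc)
      qed
      then show "sweedler a (\<lambda>a1 a2. sweedler b (\<lambda>b1 b2. a1 * b1 * S a2 * S b2 * z)) =
        sweedler a (\<lambda>a1 a2. sweedler b (\<lambda>b1 b2. a1 * S a2 * (b1 * S b2) * z))" by simp
    qed
    also have "\<dots> = sweedler a (\<lambda>a1 a2. \<epsilon> b *s (a1 * S a2 * z))"
      by (subst sweedler_antipode_right[where s = scale and f = "\<lambda>y. _ * y * z"]; (intro lin)?) simp
    also have "\<dots> = \<epsilon> a *s \<epsilon> b *s z"
      by (subst sweedler_antipode_right[where s = scale and f = "\<lambda>y. \<epsilon> b *s (y * z)"]; (intro lin)?) simp
    finally show ?thesis by simp
  qed
  have "coinvariant z (hopf_commutator a b)"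
    unfolding coinvariant_def
  proof (intro allI impI)
    fix F :: "'h \<Rightarrow> 'h \<Rightarrow> 'h" assume F: "bilin scale F"
    note l = lin lin_comp[OF bilinD(1)[OF F]] lin_comp[OF bilinD(2)[OF F]]
    have "sweedler (hopf_commutator a b) (\<lambda>h1 h2. F h1 (h2 * z)) =
        sweedler a (\<lambda>a1 a'. sweedler a' (\<lambda>a2 a3. sweedler b (\<lambda>b1 b'. sweedler b' (\<lambda>b2 b3.
          F (a1 * b1 * S a3 * S b3) (hopf_commutator a2 b2 * z)))))"
      by (rule sweedler_hopf_commutator[where s = scale]) (intro l)
    also have "\<dots> = sweedler a (\<lambda>a1 a'. sweedler a' (\<lambda>a2 a3. \<epsilon> a2 *s sweedler b (\<lambda>b1 b'. sweedler b' (\<lambda>b2 b3.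
          \<epsilon> b2 *s F (a1 * b1 * S a3 * S b3) z))))"
      by (simp add: comm_z lin_toD(3)[OF bilinD(1)[OF F]] sweedler_scale)
    also have "\<dots> = sweedler a (\<lambda>a1 a'. sweedler a' (\<lambda>a2 a3. \<epsilon> a2 *s sweedler b (\<lambda>b1 b3.
          F (a1 * b1 * S a3 * S b3) z)))"
      by (subst sweedler_counit_left[where s = scale]; (intro l)?) (rule refl)
    also have "\<dots> = sweedler a (\<lambda>a1 a3. sweedler b (\<lambda>b1 b3. F (a1 * b1 * S a3 * S b3) z))"
      by (subst sweedler_counit_left[where s = scale]; (intro l)?) (rule refl)
    also have "\<dots> = F (hopf_commutator a b) z"
      unfolding hopf_commutator_def by (simp add: sweedler_linear[OF bilinD(2)[OF F]])
    finally show "sweedler (hopf_commutator a b) (\<lambda>h1 h2. F h1 (h2 * z)) = F (hopf_commutator a b) z" .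
  qed
  then have "hopf_commutator a b * 1 \<in> C" using \<open>1 \<in> C\<close> by (rule C_left)
  then show ?thesis using C_M by auto
qed

lemma subalgebraI:
  "subspace N \<Longrightarrow> 1 \<in> N \<Longrightarrow> (\<And>x y. x \<in> N \<Longrightarrow> y \<in> N \<Longrightarrow> x * y \<in> N) \<Longrightarrow> subalgebra N"
  by (simp add: subalgebra_def)

lemma subalgebra_hull: "subalgebra (subalgebra hull X)"
proof (rule hull_in)
  fix T assume "Ball T subalgebra"
  then show "subalgebra (\<Inter>T)"
    unfolding subalgebra_def by (auto intro!: subspace_Inter)
qed

lemma hopf_commutator_in_Com: "hopf_commutator a b \<in> Com"
  unfolding Com_def by (rule span_base) blast

lemma hopf_commutator_in_hull: "hopf_commutator a b \<in> subalgebra hull Com"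
  using hopf_commutator_in_Com by (rule hull_inc)

lemma Com_subset: "subspace V \<Longrightarrow> (\<And>a b. hopf_commutator a b \<in> V) \<Longrightarrow> Com \<subseteq> V"
  unfolding Com_def by (rule span_minimal) auto

lemma hull_Com_ad_stable: "ad_stable (subalgebra hull Com)"
proof -
  let ?D = "subalgebra hull Com"
  have D: "subspace ?D" "1 \<in> ?D" "\<And>x y. x \<in> ?D \<Longrightarrow> y \<in> ?D \<Longrightarrow> x * y \<in> ?D"
    using subalgebra_hull[of Com] by (simp_all add: subalgebra_def)
  note comm = hopf_commutator_in_hull
  note ad = lin_toD[OF lin_ad_right[OF lin_id]]
  have "?D \<subseteq> {x \<in> ?D. \<forall>h. ad h x \<in> ?D}"
  proof (rule hull_minimal)
    have sub: "subspace {x \<in> ?D. \<forall>h. ad h x \<in> ?D}"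
      by (rule subspaceI) (simp_all add: ad subspace_0[OF D(1)] subspace_add[OF D(1)] subspace_scale[OF D(1)])
    show "subalgebra {x \<in> ?D. \<forall>h. ad h x \<in> ?D}"
    proof (rule subalgebraI[OF sub])
      show "1 \<in> {x \<in> ?D. \<forall>h. ad h x \<in> ?D}"
        by (simp add: ad_one_right D(2) subspace_scale[OF D(1)])
      show "x * y \<in> {x \<in> ?D. \<forall>h. ad h x \<in> ?D}"
        if "x \<in> {x \<in> ?D. \<forall>h. ad h x \<in> ?D}" "y \<in> {x \<in> ?D. \<forall>h. ad h x \<in> ?D}" for x y
        using that D(3) by (auto simp: ad_mult_right intro!: sweedler_in_subspace[OF D(1)])
    qed
    show "Com \<subseteq> {x \<in> ?D. \<forall>h. ad h x \<in> ?D}"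
    proof (rule Com_subset[OF sub])
      show "hopf_commutator a b \<in> {x \<in> ?D. \<forall>h. ad h x \<in> ?D}" for a b
        unfolding ad_hopf_commutator mem_Collect_eq
        by (intro conjI allI sweedler_in_subspace[OF D(1)] D(3) comm)
    qed
  qed
  then show ?thesis using D(1) by (auto simp: ad_stable_def)
qed

lemma lin_right_hit: "form f \<Longrightarrow> lin g \<Longrightarrow> lin (\<lambda>x. right_hit f (g x))"
  unfolding right_hit_def by (intro lin)

text \<open>Left coideals that are closed under products need to be tested on algebra generators only.\<close>

lemma right_hit_mult:
  assumes f: "form f"
  shows "right_hit f (x * y) = (\<Sum>b\<in>basis. right_hit (coef b) x * right_hit (\<lambda>u. f (b * u)) y)"
proof -
  note l = lin form_comp[OF f]
  have "right_hit f (x * y) = sweedler x (\<lambda>u v. sweedler y (\<lambda>u' v'. f (u * u') *s (v * v')))"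
    unfolding right_hit_def by (rule sweedler_mult[where s = scale]) (intro l f)
  also have "\<dots> = (\<Sum>b\<in>basis. sweedler y (\<lambda>u' v'. f (b * u') *s (right_hit (coef b) x * v')))"
    by (rule sweedler_expand) (intro l)
  finally show ?thesis
    by (simp add: right_hit_def[of _ y] sweedler_mult_left scale_mult_right)
qed

lemma hull_Com_left_coideal: "left_coideal (subalgebra hull Com)"
proof -
  let ?D = "subalgebra hull Com"
  have D: "subspace ?D" "1 \<in> ?D" "\<And>x y. x \<in> ?D \<Longrightarrow> y \<in> ?D \<Longrightarrow> x * y \<in> ?D"
    using subalgebra_hull[of Com] by (simp_all add: subalgebra_def)
  note comm = hopf_commutator_in_hull
  let ?E = "{x \<in> ?D. \<forall>f. form f \<longrightarrow> right_hit f x \<in> ?D}"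
  have "?D \<subseteq> ?E"
  proof (rule hull_minimal)
    have sub: "subspace ?E"
    proof (rule subspaceI)
      show "0 \<in> ?E"
        using subspace_0[OF D(1)] by (simp add: lin_toD(4)[OF lin_right_hit[OF _ lin_id]])
      show "x + y \<in> ?E" if "x \<in> ?E" "y \<in> ?E" for x y
        using that subspace_add[OF D(1)] by (simp add: lin_toD(2)[OF lin_right_hit[OF _ lin_id]])
      show "c *s x \<in> ?E" if "x \<in> ?E" for c x
        using that subspace_scale[OF D(1)] by (simp add: lin_toD(3)[OF lin_right_hit[OF _ lin_id]])
    qed
    show "subalgebra ?E"
    proof (rule subalgebraI[OF sub])
      have "right_hit f 1 = f 1 *s 1" if f: "form f" for f
        unfolding right_hit_def by (rule sweedler_one[where s = scale]) (intro lin f)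
      then show "1 \<in> ?E" using D(2) subspace_scale[OF D(1)] by simp
      show "x * y \<in> ?E" if xy: "x \<in> ?E" "y \<in> ?E" for x y
      proof -
        have "right_hit f (x * y) \<in> ?D" if f: "form f" for f
        proof -
          have "form (\<lambda>u. f (b * u))" for b by (intro lin form_comp[OF f])
          then show ?thesis
            unfolding right_hit_mult[OF f] using xy form_coef
            by (intro subspace_sum[OF D(1)] D(3)) blast+
        qed
        then show ?thesis using xy D(3) by blast
      qed
    qed
    show "Com \<subseteq> ?E"
    proof (rule Com_subset[OF sub], intro CollectI conjI allI impI comm)
      fix a b f assume f: "form f"
      note l = lin form_comp[OF f]
      have "right_hit f (hopf_commutator a b) = sweedler a (\<lambda>a1 a'. sweedler a' (\<lambda>a2 a3.
          sweedler b (\<lambda>b1 b'. sweedler b' (\<lambda>b2 b3.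
            f (a1 * b1 * S a3 * S b3) *s hopf_commutator a2 b2))))"
        unfolding right_hit_def by (rule sweedler_hopf_commutator[where s = scale]) (intro l f)
      also have "\<dots> \<in> ?D"
        by (intro sweedler_in_subspace[OF D(1)] subspace_scale[OF D(1)] comm)
      finally show "right_hit f (hopf_commutator a b) \<in> ?D" .
    qed
  qed
  then show ?thesis
    unfolding left_coideal_def using D(1) by (auto intro!: comult_in_tensor_spaceI)
qed

lemma hull_Com_commutative_quotient: "commutative_quotient (subalgebra hull Com)"
  unfolding commutative_quotient_def
proof (intro allI)
  fix a b
  let ?D = "subalgebra hull Com"
  let ?I = "left_ideal_gen (augmentation ?D)"
  have D: "subspace ?D" "1 \<in> ?D"
    using subalgebra_hull[of Com] by (simp_all add: subalgebra_def)
  note comm = hopf_commutator_in_hull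
  have in_I: "(hopf_commutator a1 b1 - (\<epsilon> a1 * \<epsilon> b1) *s 1) * k \<in> ?I" for a1 b1 k
  proof -
    have "hopf_commutator a1 b1 - (\<epsilon> a1 * \<epsilon> b1) *s 1 \<in> augmentation ?D"
      using D comm by (simp add: augmentation_def subspace_diff subspace_scale
          lin_toD[OF counit_linear] counit_hopf_commutator counit_one)
    then have "1 * (hopf_commutator a1 b1 - (\<epsilon> a1 * \<epsilon> b1) *s 1) \<in> ?I"
      by (rule left_ideal_genI)
    then show ?thesis
      using left_ideal_gen_mult_right[OF augmentation_ad_stable[OF hull_Com_ad_stable]] by simp
  qed
  have "b * a = sweedler a (\<lambda>a1 a2. sweedler b (\<lambda>b1 b2. (\<epsilon> a1 * \<epsilon> b1) *s (b2 * a2)))"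
  proof -
    have "sweedler b (\<lambda>b1 b2. (\<epsilon> a1 * \<epsilon> b1) *s (b2 * a2)) = \<epsilon> a1 *s (b * a2)" for a1 a2
    proof -
      have "sweedler b (\<lambda>b1 b2. \<epsilon> b1 *s (b2 * a2)) = b * a2"
        by (rule sweedler_counit_left) (intro lin)
      then show ?thesis by (simp flip: sweedler_scale scale_scale)
    qed
    moreover have "sweedler a (\<lambda>a1 a2. \<epsilon> a1 *s (b * a2)) = b * a"
      by (rule sweedler_counit_left) (intro lin)
    ultimately show ?thesis by simp
  qed
  then have "a * b = sweedler a (\<lambda>a1 a2. sweedler b (\<lambda>b1 b2.
      (hopf_commutator a1 b1 - (\<epsilon> a1 * \<epsilon> b1) *s 1) * (b2 * a2))) + b * a"
    by (simp add: mult_eq_hopf_commutator[of a b] scale_mult_left left_diff_distrib flip: sweedler_add)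
  then have "a * b - b * a = sweedler a (\<lambda>a1 a2. sweedler b (\<lambda>b1 b2.
      (hopf_commutator a1 b1 - (\<epsilon> a1 * \<epsilon> b1) *s 1) * (b2 * a2)))"
    by simp
  also have "\<dots> \<in> ?I"
    by (intro sweedler_in_subspace[OF subspace_left_ideal_gen] in_I)
  finally show "a * b - b * a \<in> ?I" .
qed

lemma is_commutator_subalgebra_iff:
  "is_commutator_subalgebra N \<longleftrightarrow> N = subalgebra hull Com"
proof -
  let ?D = "subalgebra hull Com"
  have D: "normal_left_coideal_subalgebra ?D" "commutative_quotient ?D"
    using hull_Com_ad_stable hull_Com_left_coideal hull_Com_commutative_quotient subalgebra_hull
    by (auto simp: normal_left_coideal_subalgebra_def normal_def ad_stable_def ad_def)
  have least: "?D \<subseteq> M" if M: "normal_left_coideal_subalgebra M" "commutative_quotient M" for M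
  proof (rule hull_minimal)
    show "subalgebra M" using M(1) by (simp add: normal_left_coideal_subalgebra_def)
    then show "Com \<subseteq> M"
      using commutative_quotient_contains_commutator[OF M] by (intro Com_subset) (simp_all add: subalgebra_def)
  qed
  show ?thesis
    unfolding is_commutator_subalgebra_def using D least by blast
qed

lemma commutative_iff_Com: "(\<forall>a b::'h. a * b = b * a) \<longleftrightarrow> Com = range (\<lambda>c. c *s 1)"
proof
  assume comm: "\<forall>a b::'h. a * b = b * a"
  have hc: "hopf_commutator a b = (\<epsilon> a * \<epsilon> b) *s 1" for a b
  proof -
    have "hopf_commutator a b = sweedler a (\<lambda>a1 a2. a1 * S a2 * \<epsilon> b *s 1)"
    proof -
      have "ad b x = \<epsilon> b *s x" for x
        using comm by (intro ad_central) (simp add: central_def)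
      then show ?thesis by (simp add: hopf_commutator_eq_ad_right scale_mult_right)
    qed
    also have "\<dots> = \<epsilon> a *s (1 * \<epsilon> b *s 1)"
      by (rule sweedler_antipode_right) (intro lin)
    finally show ?thesis by simp
  qed
  show "Com = range (\<lambda>c. c *s 1)"
  proof
    have "subspace (range (\<lambda>c. c *s 1))"
      by (auto intro!: subspaceI intro: range_eqI[of _ _ 0] simp flip: scale_left_distrib)
    then show "Com \<subseteq> range (\<lambda>c. c *s 1)"
      by (rule Com_subset) (simp add: hc)
    have "hopf_commutator 1 1 = 1" by (simp add: hc counit_one)
    then have "1 \<in> Com" using hopf_commutator_in_Com[of 1 1] by simp
    then show "range (\<lambda>c. c *s 1) \<subseteq> Com"
      unfolding Com_def by (auto intro: span_scale)
  qed
next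
  assume Com: "Com = range (\<lambda>c. c *s 1)"
  have hc: "hopf_commutator a b = (\<epsilon> a * \<epsilon> b) *s 1" for a b
  proof -
    obtain c where c: "hopf_commutator a b = c *s 1"
      using hopf_commutator_in_Com[of a b] unfolding Com by blast
    have "\<epsilon> (hopf_commutator a b) = c"
      unfolding c by (simp add: lin_toD(3)[OF counit_linear] counit_one)
    then show ?thesis using c counit_hopf_commutator[of a b] by simp
  qed
  show "\<forall>a b::'h. a * b = b * a"
  proof (intro allI)
    fix a b
    have "a * b = sweedler a (\<lambda>a1 a2. \<epsilon> a1 *s sweedler b (\<lambda>b1 b2. \<epsilon> b1 *s (b2 * a2)))"
      by (simp add: mult_eq_hopf_commutator[of a b] hc scale_mult_left sweedler_scale)
    also have "\<dots> = sweedler a (\<lambda>a1 a2. \<epsilon> a1 *s (b * a2))"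
      by (subst sweedler_counit_left; (intro lin)?) simp
    also have "\<dots> = b * a"
      by (rule sweedler_counit_left) (intro lin)
    finally show "a * b = b * a" .
  qed
qed

end

theorem proposition2p2:
  fixes scale :: "'k::{alg_closed_field, field_char_0} \<Rightarrow> 'h::ring_1 \<Rightarrow> 'h"
    and comult :: "'h \<Rightarrow> ('h \<Rightarrow> 'h \<Rightarrow> 'k) \<Rightarrow> 'k"
    and counit :: "'h \<Rightarrow> 'k"
    and antipode :: "'h \<Rightarrow> 'h"
  assumes "hopf_algebra scale comult counit antipode"
    and "\<exists>B. finite B \<and> module.span scale B = UNIV"
    and "semisimple_ring TYPE('h)"
  shows "(\<forall>N. hopf_algebra.is_commutator_subalgebra scale comult counit antipode N \<longleftrightarrow>
              N = hopf_algebra.subalgebra scale hull hopf_algebra.Com scale comult antipode) \<and>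
         ((\<forall>a b::'h. a * b = b * a) \<longleftrightarrow>
           hopf_algebra.Com scale comult antipode = range (\<lambda>c. scale c 1))"
proof -
  interpret semisimple_hopf_algebra scale comult counit antipode
    using assms by (simp add: semisimple_hopf_algebra_def semisimple_hopf_algebra_axioms_def)
  show ?thesis
    using is_commutator_subalgebra_iff commutative_iff_Com by blast
qed

end
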